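(* Let $(X_n,d_n,\mathfrak m_n,x_n)$, $n\in\mathbb N\cup\{\infty\}$, be pointed metric measure spaces such that $(X_n,d_n,\mathfrak m_n,x_n)$ converges to $(X_\infty,d_\infty,\mathfrak m_\infty,x_\infty)$ in the pointed measured Gromov–Hausdorff sense. Suppose that, for every $n\in\mathbb N$, $(X_n,d_n,\mathfrak m_n)$ satisfies the bounded interpolation property (BIP) with profile function $D\mapsto C^n_q(D)$, and that there exist nondecreasing assignments $D\mapsto C_q(D)$ such that $\limsup_{n\to\infty}C_q^n(D)\le C_q(D)<\infty$ for every $D>0$ and $q\in(1,\infty)$. Then $(X_\infty,d_\infty,\mathfrak m_\infty)$ has the (BIP) with profile function $D\mapsto C_q(D)$.
   Context: Metric measure space $(X,d,\mathfrak m)$: $(X,d)$ is a complete and separable metric space and $\mathfrak m\neq 0$ is a non-negative Borel measure, finite on bounded sets. A pointed metric measure space also has a chosen point $x\in X$. Pointed measured Gromov–Hausdorff (pmGH) convergence: $(X_n,d_n,\mathfrak m_n,x_n)\to(X_\infty,d_\infty,\mathfrak m_\infty,x_\infty)$ if there are a complete and separable metric space $(Z,d_Z)$ and isometric embeddings $\iota_n:X_n\to Z$, $\iota_\infty:X_\infty\to Z$ such that $\iota_n(x_n)\to\iota_\infty(x_\infty)$ and $(\iota_n)_\sharp\mathfrak m_n\rightharpoonup(\iota_\infty)_\sharp\mathfrak m_\infty$ in duality with $C_{bs}(Z)$, the continuous bounded functions with bounded support. Optimal transport: $e_t(\gamma):=\gamma_t$ for $\gamma\in C([0,1],X)$. Geodesics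 are constant speed curves on $[0,1]$ realizing the distance between their endpoints; $\mathrm{Geo}(X)$ is their set. $\mathrm{OptGeo}_q(\mu_0,\mu_1)$ is the set of $\pi\in\mathscr P(\mathrm{Geo}(X))$ such that $(e_0,e_1)_\sharp\pi$ is a coupling of $\mu_0,\mu_1$ that is optimal (minimal) for the cost $\int d^q(x,y)\,d\alpha(x,y)$. Bounded interpolation property (BIP): for every $q\in(1,\infty)$ there is a profile function $(0,\infty)\ni D\mapsto C_q(D)\in[1,\infty)$ such that for every $D>0$ and all Borel probability measures $\mu_0=\rho_0\mathfrak m$, $\mu_1=\rho_1\mathfrak m$ on $X$ with bounded densities and $\mathrm{diam}(\mathrm{supp}(\mu_0)\cup\mathrm{supp}(\mu_1))<D$, there exists $\pi\in\mathrm{OptGeo}_q(\mu_0,\mu_1)$ with $(e_t)_\sharp\pi=\rho_t\mathfrak m$ and $\|\rho_t\|_{L^\infty(\mathfrak m)}\le C_q(D)\,\big(\|\rho_0\|_{L^\infty(\mathfrak m)}\vee\|\rho_1\|_{L^\infty(\mathfrak m)}\big)$ for every $t\in[0,1]$. When this holds one says that the space has the (BIP) with profile function $D\mapsto C_q(D)$. *)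

theory Defs
  imports "HOL-Probability.Probability"
begin

section \<open>Metric measure spaces\<close>

definition mborel :: "'a metric \<Rightarrow> 'a measure" where
  "mborel X = sigma (mspace X) {U. openin (mtopology_of X) U}"

lemma open_subset_Pow: "{U. openin (mtopology_of X) U} \<subseteq> Pow (mspace X)"
  using openin_subset[of "mtopology_of X"] by auto

lemma space_mborel [simp]: "space (mborel X) = mspace X"
  unfolding mborel_def by (rule space_measure_of[OF open_subset_Pow])

lemma sets_mborel: "sets (mborel X) = sigma_sets (mspace X) {U. openin (mtopology_of X) U}"
  unfolding mborel_def by (rule sets_measure_of[OF open_subset_Pow])

abbreviation mbounded_in :: "'a metric \<Rightarrow> 'a set \<Rightarrow> bool" where
  "mbounded_in X S \<equiv> Metric_space.mbounded (mspace X) (mdist X) S"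

definition complete_separable :: "'a metric \<Rightarrow> bool" where
  "complete_separable X \<longleftrightarrow> mcomplete_of X \<and> separable_space (mtopology_of X)"

definition metric_measure_space :: "'a metric \<Rightarrow> 'a measure \<Rightarrow> bool" where
  "metric_measure_space X m \<longleftrightarrow>
     complete_separable X \<and>
     sets m = sets (mborel X) \<and>
     emeasure m (mspace X) \<noteq> 0 \<and>
     (\<forall>B\<in>sets m. mbounded_in X B \<longrightarrow> emeasure m B < \<infinity>)"

definition pointed_metric_measure_space :: "'a metric \<Rightarrow> 'a measure \<Rightarrow> 'a \<Rightarrow> bool" where
  "pointed_metric_measure_space X m x \<longleftrightarrow> metric_measure_space X m \<and> x \<in> mspace X"

definition borel_prob :: "'a metric \<Rightarrow> 'a measure set" where
  "borel_prob X = {\<mu>. sets \<mu> = sets (mborel X) \<and> prob_space \<mu>}"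

definition msupport :: "'a metric \<Rightarrow> 'a measure \<Rightarrow> 'a set" where
  "msupport X \<mu> = {x \<in> mspace X. \<forall>U. openin (mtopology_of X) U \<and> x \<in> U \<longrightarrow> emeasure \<mu> U > 0}"

text \<open>The diameter takes values in \<^typ>\<open>ennreal\<close>, so that unbounded sets have infinite diameter.\<close>

definition mdiam :: "'a metric \<Rightarrow> 'a set \<Rightarrow> ennreal" where
  "mdiam X S = (SUP (x, y)\<in>S \<times> S. ennreal (mdist X x y))"


section \<open>Pointed measured Gromov--Hausdorff convergence\<close>

definition isometric_embedding :: "'a metric \<Rightarrow> 'z metric \<Rightarrow> ('a \<Rightarrow> 'z) \<Rightarrow> bool" where
  "isometric_embedding X Z \<iota> \<longleftrightarrow>
     \<iota> \<in> mspace X \<rightarrow> mspace Z \<and>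
     (\<forall>x\<in>mspace X. \<forall>y\<in>mspace X. mdist Z (\<iota> x) (\<iota> y) = mdist X x y)"

definition C_bs :: "'z metric \<Rightarrow> ('z \<Rightarrow> real) set" where
  "C_bs Z = {\<phi>. continuous_map (mtopology_of Z) euclideanreal \<phi> \<and>
                bounded (\<phi> ` mspace Z) \<and>
                mbounded_in Z {z \<in> mspace Z. \<phi> z \<noteq> 0}}"

text \<open>
  The ambient space \<open>Z\<close> is an arbitrary complete separable metric space whose points are taken
  from the type \<open>'z\<close>. A definition cannot quantify over types, so this type is a parameter;
  where pmGH convergence is a hypothesis and \<open>'z\<close> occurs nowhere else, as in the theorem,
  the implicit universal quantification over \<open>'z\<close> amounts to ``there is some \<open>Z\<close>, over some type''.
  The spaces \<open>X n\<close> share the type \<open>'a\<close> but each has its own carrier and metric.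
\<close>

definition pmGH_converges ::
  "'z itself \<Rightarrow> (nat \<Rightarrow> 'a metric) \<Rightarrow> (nat \<Rightarrow> 'a measure) \<Rightarrow> (nat \<Rightarrow> 'a) \<Rightarrow>
     'b metric \<Rightarrow> 'b measure \<Rightarrow> 'b \<Rightarrow> bool" where
  "pmGH_converges _ X m x Xlim mlim xlim \<longleftrightarrow>
     (\<exists>(Z :: 'z metric) \<iota> \<iota>lim.
        complete_separable Z \<and>
        (\<forall>n. isometric_embedding (X n) Z (\<iota> n)) \<and>
        isometric_embedding Xlim Z \<iota>lim \<and>
        limitin (mtopology_of Z) (\<lambda>n. \<iota> n (x n)) (\<iota>lim xlim) sequentially \<and>
        (\<forall>\<phi>\<in>C_bs Z.
           (\<lambda>n. \<integral>z. \<phi> z \<partial>distr (m n) (mborel Z) (\<iota> n))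
             \<longlonglongrightarrow> (\<integral>z. \<phi> z \<partial>distr mlim (mborel Z) \<iota>lim)))"


section \<open>Optimal transport along geodesics\<close>

text \<open>
  The library space \<^const>\<open>cfunspace\<close> over \<open>[0,1]\<close> is \<open>C([0,1],X)\<close> with the supremum distance;
  its elements are functions on \<^typ>\<open>real\<close> that are \<^const>\<open>undefined\<close> outside \<open>[0,1]\<close>.
  Geodesics inherit this distance, and measures on them are Borel for it.
\<close>

definition Geo :: "'a metric \<Rightarrow> (real \<Rightarrow> 'a) metric" where
  "Geo X = submetric (cfunspace (top_of_set {0..1}) X)
     {\<gamma>. \<forall>s\<in>{0..1}. \<forall>t\<in>{0..1}. mdist X (\<gamma> s) (\<gamma> t) = \<bar>s - t\<bar> * mdist X (\<gamma> 0) (\<gamma> 1)}"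

definition couplings :: "'a metric \<Rightarrow> 'a measure \<Rightarrow> 'a measure \<Rightarrow> ('a \<times> 'a) measure set" where
  "couplings X \<mu> \<nu> =
     {\<alpha>. sets \<alpha> = sets (mborel X \<Otimes>\<^sub>M mborel X) \<and>
         distr \<alpha> (mborel X) fst = \<mu> \<and> distr \<alpha> (mborel X) snd = \<nu>}"

definition transport_cost :: "real \<Rightarrow> 'a metric \<Rightarrow> ('a \<times> 'a) measure \<Rightarrow> ennreal" where
  "transport_cost q X \<alpha> = (\<integral>\<^sup>+ (x, y). ennreal (mdist X x y powr q) \<partial>\<alpha>)"

definition optimal_coupling ::
  "real \<Rightarrow> 'a metric \<Rightarrow> 'a measure \<Rightarrow> 'a measure \<Rightarrow> ('a \<times> 'a) measure \<Rightarrow> bool" where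
  "optimal_coupling q X \<mu> \<nu> \<alpha> \<longleftrightarrow>
     \<alpha> \<in> couplings X \<mu> \<nu> \<and> (\<forall>\<beta>\<in>couplings X \<mu> \<nu>. transport_cost q X \<alpha> \<le> transport_cost q X \<beta>)"

definition OptGeo ::
  "real \<Rightarrow> 'a metric \<Rightarrow> 'a measure \<Rightarrow> 'a measure \<Rightarrow> (real \<Rightarrow> 'a) measure set" where
  "OptGeo q X \<mu>\<^sub>0 \<mu>\<^sub>1 =
     {\<pi> \<in> borel_prob (Geo X).
        optimal_coupling q X \<mu>\<^sub>0 \<mu>\<^sub>1 (distr \<pi> (mborel X \<Otimes>\<^sub>M mborel X) (\<lambda>\<gamma>. (\<gamma> 0, \<gamma> 1)))}"


section \<open>The bounded interpolation property\<close>

text \<open>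
  \<open>C q D\<close> is the value of the profile function for the exponent \<open>q\<close>; only \<open>q > 1\<close> and \<open>D > 0\<close>
  matter. Densities are \<^typ>\<open>ennreal\<close>-valued, so \<^const>\<open>esssup\<close> is their \<open>L\<^sup>\<infinity>(m)\<close>-norm, and
  \<^prop>\<open>esssup m \<rho> < \<infinity>\<close> says that the density is bounded (almost everywhere).
\<close>

definition has_BIP :: "'a metric \<Rightarrow> 'a measure \<Rightarrow> (real \<Rightarrow> real \<Rightarrow> real) \<Rightarrow> bool" where
  "has_BIP X m C \<longleftrightarrow>
     (\<forall>q>1. \<forall>D>0. C q D \<ge> 1 \<and>
        (\<forall>\<rho>\<^sub>0\<in>borel_measurable m. \<forall>\<rho>\<^sub>1\<in>borel_measurable m.
           density m \<rho>\<^sub>0 \<in> borel_prob X \<longrightarrow> density m \<rho>\<^sub>1 \<in> borel_prob X \<longrightarrow>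
           esssup m \<rho>\<^sub>0 < \<infinity> \<longrightarrow> esssup m \<rho>\<^sub>1 < \<infinity> \<longrightarrow>
           mdiam X (msupport X (density m \<rho>\<^sub>0) \<union> msupport X (density m \<rho>\<^sub>1)) < ennreal D \<longrightarrow>
           (\<exists>\<pi>\<in>OptGeo q X (density m \<rho>\<^sub>0) (density m \<rho>\<^sub>1). \<forall>t\<in>{0..1}.
              \<exists>\<rho>\<^sub>t\<in>borel_measurable m.
                distr \<pi> (mborel X) (\<lambda>\<gamma>. \<gamma> t) = density m \<rho>\<^sub>t \<and>
                esssup m \<rho>\<^sub>t \<le> ennreal (C q D) * max (esssup m \<rho>\<^sub>0) (esssup m (\<rho>\<^sub>1 :: 'a \<Rightarrow> ennreal)))))"

end

(* Embed everything isometrically into a complete space. Given mu_i = rho_i m with rho_i <= M on the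
   limit space, cut a neighbourhood of the supports into finitely many small cells by a continuous
   partition of unity c_l and transfer mu_i to X_n as the density sum_l (int c_l dmu_i / int c_l dm_n) c_l.
   Since int c_l dm_n -> int c_l dm, this density is at most M + e for large n, the supports
   still have diameter < D, and a coupling of mu_0, mu_1 on the limit space, averaged over pairs of cells,
   is a competitor for the transferred marginals whose cost is larger by O(e) only. BIP on X_n therefore
   yields random geodesics with time marginals at most (C + e) (M + e) m_n and almost minimal cost.
   The bound on the marginals makes them tight at each time, because m_n converges. A geodesic
   of length < D is D-Lipschitz, so the random geodesics converge in law along a subsequence. The time
   marginals of the limit are at most C M m; in particular they are carried by the closed image of the
   limit space. The end marginals are mu_0 and mu_1, and the cost passes to the limit because it is
   continuous and bounded on geodesics of length at most D. *)
theory Submission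
  imports Defs "HOL-Complex_Analysis.Great_Picard"
begin

text \<open>The supports need not be compact, so finitely many cells capture the two marginals only
  up to mass e; one remainder cell takes the rest, and its share of the cost is controlled by the
  bound D^q. The strict inequality diam < D leaves room for a cutoff around the supports, so BIP is
  used on X_n with the very same D. The competitor comes from an arbitrary coupling of the limit
  marginals, so minimality of the limit plan is proved against one coupling at a time. Weak
  compactness of curves is reduced to integer sequences: a curve is recorded by indices of nearby
  points of a countable set, at countably many times and at every precision 2^-j. There, convergence
  in law is convergence of countably many probabilities, the limit law comes from Kolmogorov
  extension, and each inequality that characterises records of geodesics involves finitely many
  entries, hence survives. The complete ambient space is a Banach space of bounded functions
  (Kuratowski). It need not be separable, which is why measurability of random points is expressed
  through distances to fixed points.\<close>

section \<open>Weak limits of random integer sequences\<close>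

text \<open>A form of Scheffe's lemma.\<close>
lemma pmf_limit:
  fixes p :: "nat \<Rightarrow> 'a pmf" and q :: "'a \<Rightarrow> real"
  assumes conv: "\<And>l. (\<lambda>k. pmf (p k) l) \<longlonglongrightarrow> q l"
    and tight: "\<And>e. e > 0 \<Longrightarrow> \<exists>A. finite A \<and> (\<forall>\<^sub>F k in sequentially. measure_pmf.prob (p k) (- A) \<le> e)"
  obtains P where "\<And>l. pmf P l = q l"
    and "\<And>f B. (\<And>l. \<bar>f l\<bar> \<le> (B::real)) \<Longrightarrow>
           (\<lambda>k. measure_pmf.expectation (p k) f) \<longlonglongrightarrow> measure_pmf.expectation P f"
proof -
  have q0: "q l \<ge> 0" for l
    by (rule LIMSEQ_le_const[OF conv]) auto
  have sumA: "(\<lambda>k. measure_pmf.prob (p k) A) \<longlonglongrightarrow> sum q A" if "finite A" for A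
    using tendsto_sum[of A "\<lambda>l k. pmf (p k) l" q sequentially] conv that
    by (simp add: measure_measure_pmf_finite)
  \<comment> \<open>Fatou: mass can only be lost in the limit. Tightness rules out the loss
    below.\<close>
  have "(\<integral>\<^sup>+x. ennreal (q x) \<partial>count_space UNIV) \<le> 1"
  proof -
    have "liminf (\<lambda>k. ennreal (pmf (p k) x)) = ennreal (q x)" for x
      by (intro lim_imp_Liminf tendsto_ennrealI conv) simp
    then have "(\<integral>\<^sup>+x. ennreal (q x) \<partial>count_space UNIV)
      = (\<integral>\<^sup>+x. liminf (\<lambda>k. ennreal (pmf (p k) x)) \<partial>count_space UNIV)" by simp
    also have "\<dots> \<le> liminf (\<lambda>k. \<integral>\<^sup>+x. ennreal (pmf (p k) x) \<partial>count_space UNIV)"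
      by (rule nn_integral_liminf) simp
    also have "\<dots> = 1"
      by (simp add: nn_integral_pmf Liminf_const)
    finally show ?thesis .
  qed
  moreover have big: "sum q A \<ge> 1 - e"
    if A: "finite A" "\<forall>\<^sub>F k in sequentially. measure_pmf.prob (p k) (- A) \<le> e" for A e
  proof (rule tendsto_lowerbound[OF sumA[OF A(1)]])
    show "\<forall>\<^sub>F k in sequentially. 1 - e \<le> measure_pmf.prob (p k) A"
      using A(2)
    proof eventually_elim
      case (elim k)
      then show ?case
        using measure_pmf.prob_compl[of A "p k"] by (auto simp: Compl_eq_Diff_UNIV)
    qed
  qed simp
  moreover have "(\<integral>\<^sup>+x. ennreal (q x) \<partial>count_space UNIV) \<ge> ennreal (1 - e)" if e: "e > 0" for e
  proof -
    obtain A where A: "finite A" "\<forall>\<^sub>F k in sequentially. measure_pmf.prob (p k) (- A) \<le> e"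
      using tight[OF e] by auto
    have "ennreal (1 - e) \<le> ennreal (sum q A)"
      using big[OF A] by (rule ennreal_leI)
    also have "\<dots> = (\<integral>\<^sup>+x. ennreal (q x) * indicator A x \<partial>count_space UNIV)"
      using A(1) q0 by (simp add: nn_integral_count_space_indicator[symmetric] nn_integral_count_space_finite)
    also have "\<dots> \<le> (\<integral>\<^sup>+x. ennreal (q x) \<partial>count_space UNIV)"
      by (rule nn_integral_mono) (auto simp: indicator_def)
    finally show ?thesis .
  qed
  then have "(\<integral>\<^sup>+x. ennreal (q x) \<partial>count_space UNIV) \<ge> 1"
  proof -
    assume *: "\<And>e. 0 < e \<Longrightarrow> ennreal (1 - e) \<le> (\<integral>\<^sup>+x. ennreal (q x) \<partial>count_space UNIV)"
    have "(\<lambda>n. ennreal (1 - 1 / Suc n)) \<longlonglongrightarrow> ennreal (1 - 0)"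
      by (intro tendsto_intros) (use LIMSEQ_inverse_real_of_nat in \<open>simp add: inverse_eq_divide\<close>)
    then show ?thesis
      using * by (intro LIMSEQ_le_const2[of _ 1]) auto
  qed
  ultimately have one: "(\<integral>\<^sup>+x. ennreal (q x) \<partial>count_space UNIV) = 1" by (simp add: antisym)
  define P where "P = embed_pmf q"
  have P: "pmf P l = q l" for l
    unfolding P_def using one q0 by (simp add: pmf_embed_pmf)
  have "(\<lambda>k. measure_pmf.expectation (p k) f) \<longlonglongrightarrow> measure_pmf.expectation P f"
    if f: "\<And>l. \<bar>f l\<bar> \<le> B" for f and B :: real
  proof -
    have B0: "B \<ge> 0" using f[of undefined] by linarith
    have int: "integrable (measure_pmf r) f" for r :: "'a pmf"
      by (rule measure_pmf.integrable_const_bound[of _ B]) (auto simp: f)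
    \<comment> \<open>Off a finite set \<open>A\<close> a bounded \<open>f\<close> contributes at
      most \<open>B\<close> times the tail mass, for every law.\<close>
    have split: "\<bar>measure_pmf.expectation r f - (\<Sum>l\<in>A. pmf r l * f l)\<bar> \<le> B * measure_pmf.prob r (-A)"
      if "finite A" for r :: "'a pmf" and A
    proof -
      have i1: "integrable (measure_pmf r) (\<lambda>x. indicator A x * f x)"
        by (rule measure_pmf.integrable_const_bound[of _ B]) (use f B0 in \<open>auto simp: indicator_def\<close>)
      have "(\<integral>x. indicator A x * f x \<partial>measure_pmf r) = (\<Sum>l\<in>A. pmf r l * f l)"
        using integral_measure_pmf[of A r "\<lambda>x. indicator A x * f x"] that
        by (auto simp: indicator_def split: if_splits intro!: sum.cong)
      then have "measure_pmf.expectation r f - (\<Sum>l\<in>A. pmf r l * f l) = (\<integral>x. f x - indicator A x * f x \<partial>measure_pmf r)"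
        using int i1 by simp
      also have "\<bar>\<dots>\<bar> \<le> (\<integral>x. B * indicator (-A) x \<partial>measure_pmf r)"
        by (rule order_trans[OF integral_abs_bound], rule integral_mono)
           (use f B0 int i1 in \<open>auto simp: indicator_def intro!: integrable_diff integrable_mult_right integrable_abs measure_pmf.integrable_const_bound[of _ 1]\<close>)
      finally show ?thesis by simp
    qed
    show ?thesis
    proof (rule tendstoI)
      fix e :: real assume e: "e > 0"
      \<comment> \<open>The budget is split into thirds: two tails and one finite sum.
        \<open>B + 1\<close> keeps the denominator positive when \<open>B\<close> is 0.\<close>
      define d where "d = e / (3 * (B + 1))"
      have d: "d > 0" using e B0 by (simp add: d_def)
      have Bd: "B * d \<le> e / 3" using e B0 by (simp add: d_def field_simps)
      obtain A where A: "finite A" "\<forall>\<^sub>F k in sequentially. measure_pmf.prob (p k) (- A) \<le> d"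
        using tight[OF d] by auto
      have "measure_pmf.prob P (- A) \<le> d"
        using big[OF A] A(1) measure_pmf.prob_compl[of A P] P
        by (simp add: Compl_eq_Diff_UNIV measure_measure_pmf_finite)
      then have PA: "B * measure_pmf.prob P (- A) \<le> e / 3"
        using Bd B0 by (meson mult_left_mono order_trans)
      have "(\<lambda>k. \<Sum>l\<in>A. pmf (p k) l * f l) \<longlonglongrightarrow> (\<Sum>l\<in>A. pmf P l * f l)"
        unfolding P by (intro tendsto_intros conv)
      then have "\<forall>\<^sub>F k in sequentially. dist (\<Sum>l\<in>A. pmf (p k) l * f l) (\<Sum>l\<in>A. pmf P l * f l) < e / 3"
        using e by (intro tendstoD) auto
      with A(2) show "\<forall>\<^sub>F k in sequentially. dist (measure_pmf.expectation (p k) f) (measure_pmf.expectation P f) < e"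
      proof eventually_elim
        case (elim k)
        have "B * measure_pmf.prob (p k) (- A) \<le> e / 3"
          using elim(1) Bd B0 by (meson mult_left_mono order_trans)
        with split[OF A(1), of "p k"] split[OF A(1), of P] PA elim(2)
        show ?case unfolding dist_real_def by linarith
      qed
    qed
  qed
  with P that show ?thesis by blast
qed

text \<open>The points of zero mass form a countable, hence null, set; so the law is carried by its
  atoms, which is what the pmf type demands.\<close>

lemma distr_count_space_eq_pmf:
  fixes X :: "'c \<Rightarrow> 'a::countable"
  assumes "prob_space Q" "X \<in> Q \<rightarrow>\<^sub>M count_space UNIV"
  obtains p where "measure_pmf p = distr Q (count_space UNIV) X"
proof -
  interpret prob_space Q by fact
  interpret D: prob_space "distr Q (count_space UNIV) X"
    using assms(2) by (rule prob_space_distr)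
  let ?D = "distr Q (count_space UNIV) X"
  have "(\<Union>x\<in>{x. measure ?D {x} = 0}. {x}) \<in> null_sets ?D"
    by (rule null_sets_UN') (auto simp: null_sets_def D.emeasure_eq_measure)
  then have "AE x in ?D. measure ?D {x} \<noteq> 0"
    by (rule AE_I') auto
  then have "measure_pmf (Abs_pmf ?D) = ?D"
    by (intro Abs_pmf_inverse) (auto simp: D.prob_space_axioms)
  then show ?thesis by (rule that)
qed

section \<open>Laws of finite prefixes and their projective limit\<close>

lemma measurable_map_upt [measurable]:
  fixes Y :: "'c \<Rightarrow> nat \<Rightarrow> 'a::countable"
  assumes "\<And>i. (\<lambda>\<omega>. Y \<omega> i) \<in> Q \<rightarrow>\<^sub>M count_space UNIV"
  shows "(\<lambda>\<omega>. map (Y \<omega>) [0..<N]) \<in> Q \<rightarrow>\<^sub>M count_space UNIV"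
proof (induction N)
  case (Suc N)
  note [measurable] = Suc assms
  have "(\<lambda>\<omega>. (\<lambda>(l, a). l @ [a]) (map (Y \<omega>) [0..<N], Y \<omega> N)) \<in> Q \<rightarrow>\<^sub>M count_space UNIV"
    by (rule measurable_compose[where N="count_space UNIV \<Otimes>\<^sub>M count_space UNIV"])
       (auto simp: pair_measure_countable)
  then show ?case by simp
qed simp

text \<open>Cylinder functions. On sequences of discrete values they play the role of the continuous
  test functions of weak convergence.\<close>

definition depends_on_first :: "nat \<Rightarrow> ((nat \<Rightarrow> 'a) \<Rightarrow> 'b) \<Rightarrow> bool" where
  "depends_on_first N f \<longleftrightarrow> (\<forall>x y. (\<forall>i<N. x i = y i) \<longrightarrow> f x = f y)"

lemma depends_on_first_factor:
  assumes "depends_on_first N f"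
  shows "f x = f (\<lambda>i. map x [0..<N] ! i)"
  using assms unfolding depends_on_first_def by auto

abbreviation nat_seqs :: "(nat \<Rightarrow> nat) measure" where
  "nat_seqs \<equiv> PiM UNIV (\<lambda>_. count_space UNIV)"

text \<open>Kolmogorov extension. The law is first built with real coordinates, as a projective
  limit over a Polish space, and then carried back to integers by rounding down.\<close>

lemma Kolmogorov_nat_lists:
  fixes q :: "nat \<Rightarrow> nat list pmf"
  assumes len: "\<And>N l. l \<in> set_pmf (q N) \<Longrightarrow> length l = N"
    and cons: "\<And>N M. N \<le> M \<Longrightarrow> map_pmf (take N) (q M) = q N"
  obtains P where "prob_space P" "sets P = sets nat_seqs"
    and "\<And>N. distr P (count_space UNIV) (\<lambda>x. map x [0..<N]) = measure_pmf (q N)"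
proof -
  \<comment> \<open>\<open>b J\<close> is the length of the shortest prefix that contains all
    indices in \<open>J\<close>; the empty set is treated apart because \<open>Max\<close> says
    nothing about it.\<close>
  define b where "b J = (if J = {} then 0 else Suc (Max J))" for J :: "nat set"
  have b: "i < b J" if "i \<in> J" "finite J" for i J
    using that by (auto simp: b_def less_Suc_eq_le)
  have b_mono: "b J \<le> b H" if "J \<subseteq> H" "finite H" for J H
    using that by (auto simp: b_def Max_mono)
  define T where "T J l = restrict (\<lambda>i. real (l ! i)) J" for J :: "nat set" and l :: "nat list"
  have T_in: "T J l \<in> space (PiM J (\<lambda>_. borel))" for J l
    by (auto simp: T_def space_PiM)
  have T_meas [measurable]: "T J \<in> measure_pmf p \<rightarrow>\<^sub>M PiM J (\<lambda>_. borel)" for J p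
    using T_in by (auto simp: measurable_def)
  define R where "R J = distr (measure_pmf (q (b J))) (PiM J (\<lambda>_. borel)) (T J)" for J
  have R_eq: "R J = distr (measure_pmf (q M)) (PiM J (\<lambda>_. borel)) (T J)"
    if "finite J" "b J \<le> M" for J M
  proof -
    have "R J = distr (distr (measure_pmf (q M)) (count_space UNIV) (take (b J))) (PiM J (\<lambda>_. borel)) (T J)"
      unfolding R_def cons[OF that(2), symmetric]
      by (simp add: map_pmf_rep_eq)
    also have "\<dots> = distr (measure_pmf (q M)) (PiM J (\<lambda>_. borel)) (T J \<circ> take (b J))"
      by (intro distr_distr) (auto simp: measurable_def T_in)
    also have "T J \<circ> take (b J) = T J"
      using b[OF _ that(1)] by (auto simp: T_def fun_eq_iff restrict_def)
    finally show ?thesis .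
  qed
  interpret polish_projective UNIV R
  proof (rule polish_projective.intro, rule projective_family.intro)
    fix J H :: "nat set" assume JH: "J \<subseteq> H" "finite H" "H \<subseteq> UNIV"
    have "distr (R H) (PiM J (\<lambda>_. borel)) (\<lambda>f. restrict f J)
       = distr (measure_pmf (q (b H))) (PiM J (\<lambda>_. borel)) ((\<lambda>f. restrict f J) \<circ> T H)"
      unfolding R_def using JH
      by (intro distr_distr measurable_restrict_subset T_meas) auto
    also have "(\<lambda>f. restrict f J) \<circ> T H = T J"
      using JH by (auto simp: T_def fun_eq_iff restrict_def)
    also have "distr (measure_pmf (q (b H))) (PiM J (\<lambda>_. borel)) (T J) = R J"
      using R_eq[of J "b H"] b_mono[of J H] JH finite_subset by metis
    finally show "R J = distr (R H) (PiM J (\<lambda>_. borel)) (\<lambda>f. restrict f J)" by (rule sym)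
  next
    fix J :: "nat set"
    show "prob_space (R J)"
      unfolding R_def by (intro measure_pmf.prob_space_distr T_meas)
  qed
  have lim_restrict: "distr lim (PiM J (\<lambda>_. borel)) (\<lambda>x. restrict x J) = R J" if "finite J" for J
  proof (rule measure_eqI)
    show "sets (distr lim (PiM J (\<lambda>_. borel)) (\<lambda>x. restrict x J)) = sets (R J)"
      by (simp add: R_def)
    have m: "(\<lambda>x. restrict x J) \<in> lim \<rightarrow>\<^sub>M PiM J (\<lambda>_. borel)"
      unfolding measurable_cong_sets[OF sets_lim refl] by (rule measurable_restrict_subset) simp
    fix A assume A: "A \<in> sets (distr lim (PiM J (\<lambda>_. borel)) (\<lambda>x. restrict x J))"
    then show "emeasure (distr lim (PiM J (\<lambda>_. borel)) (\<lambda>x. restrict x J)) A = emeasure (R J) A"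
      using emeasure_lim_emb[of J A] that
      by (subst emeasure_distr[OF m]) (auto simp: prod_emb_def space_PiM)
  qed
  \<comment> \<open>On vectors produced by \<open>T\<close> the coordinates are integers, so
    \<open>F\<close> undoes the passage to reals.\<close>
  define F :: "(nat \<Rightarrow> real) \<Rightarrow> nat \<Rightarrow> nat" where "F x = (\<lambda>i. nat \<lfloor>x i\<rfloor>)" for x
  have F_meas [measurable]: "F \<in> lim \<rightarrow>\<^sub>M nat_seqs"
    unfolding F_def measurable_cong_sets[OF sets_lim refl]
    by (rule measurable_abs_UNIV) measurable
  define P where "P = distr lim nat_seqs F"
  have "distr P (count_space UNIV) (\<lambda>x. map x [0..<N]) = measure_pmf (q N)" for N
  proof -
    have bN: "b {..<N} = N" by (cases N) (auto simp: b_def lessThan_Suc_atMost intro!: Max_eqI)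
    have m1: "(\<lambda>x. map x [0..<N]) \<in> nat_seqs \<rightarrow>\<^sub>M count_space UNIV"
      by (rule measurable_map_upt) simp
    have m2: "(\<lambda>x. map (F x) [0..<N]) \<in> PiM {..<N} (\<lambda>_. borel) \<rightarrow>\<^sub>M count_space UNIV"
    proof -
      have "(\<lambda>x. map (\<lambda>i. if i < N then nat \<lfloor>x i :: real\<rfloor> else 0) [0..<N]) \<in> PiM {..<N} (\<lambda>_. borel) \<rightarrow>\<^sub>M count_space UNIV"
      proof (rule measurable_map_upt)
        fix i show "(\<lambda>x. if i < N then nat \<lfloor>x i :: real\<rfloor> else 0) \<in> PiM {..<N} (\<lambda>_. borel) \<rightarrow>\<^sub>M count_space UNIV"
          by (cases "i < N") auto
      qed
      also have "(\<lambda>x. map (\<lambda>i. if i < N then nat \<lfloor>x i :: real\<rfloor> else 0) [0..<N]) = (\<lambda>x. map (F x) [0..<N])"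
        by (auto simp: F_def)
      finally show ?thesis .
    qed
    have "distr P (count_space UNIV) (\<lambda>x. map x [0..<N]) = distr lim (count_space UNIV) (\<lambda>x. map (F x) [0..<N])"
      unfolding P_def using m1 F_meas by (simp add: distr_distr comp_def)
    also have "\<dots> = distr lim (count_space UNIV) ((\<lambda>x. map (F x) [0..<N]) \<circ> (\<lambda>x. restrict x {..<N}))"
      by (intro arg_cong[where f="distr lim _"]) (auto simp: F_def fun_eq_iff)
    also have "\<dots> = distr (distr lim (PiM {..<N} (\<lambda>_. borel)) (\<lambda>x. restrict x {..<N})) (count_space UNIV) (\<lambda>x. map (F x) [0..<N])"
      unfolding measurable_cong_sets[OF sets_lim refl]
      by (intro distr_distr[symmetric] m2, unfold measurable_cong_sets[OF sets_lim refl]) (rule measurable_restrict_subset, simp)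
    also have "\<dots> = distr (measure_pmf (q N)) (count_space UNIV) ((\<lambda>x. map (F x) [0..<N]) \<circ> T {..<N})"
      unfolding lim_restrict[OF finite_lessThan] R_def bN by (intro distr_distr m2 T_meas)
    also have "\<dots> = distr (measure_pmf (q N)) (count_space UNIV) (\<lambda>l. l)"
    proof (intro distr_cong_AE)
      show "AE l in measure_pmf (q N). ((\<lambda>x. map (F x) [0..<N]) \<circ> T {..<N}) l = l"
        using len by (auto simp: AE_measure_pmf_iff F_def T_def intro!: nth_equalityI)
    qed auto
    also have "\<dots> = measure_pmf (q N)"
      by (metis map_pmf_rep_eq map_pmf_ident)
    finally show ?thesis .
  qed
  moreover have "prob_space P"
    unfolding P_def by (rule P.prob_space_distr) simp
  ultimately show ?thesis using that[of P] by (auto simp: P_def)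
qed

text \<open>Prokhorov's theorem for integer sequences. A diagonal subsequence makes all prefix
  probabilities converge, tightness of single coordinates gives tight prefixes and hence probability
  laws in the limit (\<open>pmf_limit\<close>), and these are consistent, so they come from one law
  on sequences.\<close>

lemma nat_seqs_compactness:
  fixes Q :: "nat \<Rightarrow> 'c measure" and Y :: "nat \<Rightarrow> 'c \<Rightarrow> nat \<Rightarrow> nat"
  assumes Q: "\<And>k. prob_space (Q k)"
    and Y: "\<And>k i. (\<lambda>\<omega>. Y k \<omega> i) \<in> Q k \<rightarrow>\<^sub>M count_space UNIV"
    and tight: "\<And>i e. e > 0 \<Longrightarrow>
      \<exists>N. \<forall>\<^sub>F k in sequentially. measure (Q k) {\<omega>\<in>space (Q k). N \<le> Y k \<omega> i} \<le> e"
  obtains r P where "strict_mono r" "prob_space P" "sets P = sets nat_seqs"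
    and "\<And>N f B. depends_on_first N f \<Longrightarrow> (\<And>x. \<bar>f x\<bar> \<le> (B::real)) \<Longrightarrow>
           (\<lambda>k. \<integral>\<omega>. f (Y (r k) \<omega>) \<partial>Q (r k)) \<longlonglongrightarrow> (\<integral>x. f x \<partial>P)"
proof -
  have Ymap: "(\<lambda>\<omega>. map (Y k \<omega>) [0..<N]) \<in> Q k \<rightarrow>\<^sub>M count_space UNIV" for k N
    using Y by (rule measurable_map_upt)
  have "\<exists>p. measure_pmf p = distr (Q k) (count_space UNIV) (\<lambda>\<omega>. map (Y k \<omega>) [0..<N])" for k N
    using distr_count_space_eq_pmf[OF Q Ymap] by metis
  then obtain p where p: "\<And>k N. measure_pmf (p k N) = distr (Q k) (count_space UNIV) (\<lambda>\<omega>. map (Y k \<omega>) [0..<N])"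
    by metis
  have p_prob: "measure_pmf.prob (p k N) A = measure (Q k) {\<omega>\<in>space (Q k). map (Y k \<omega>) [0..<N] \<in> A}" for k N A
    unfolding p using Ymap by (subst measure_distr) (auto intro!: arg_cong[where f="measure _"])
  have p_exp: "measure_pmf.expectation (p k N) f = (\<integral>\<omega>. f (map (Y k \<omega>) [0..<N]) \<partial>Q k)"
    for k N and f :: "nat list \<Rightarrow> real"
    unfolding p using Ymap by (subst integral_distr) auto
  \<comment> \<open>Diagonal argument over the countable set of pairs of a prefix length and a list,
    with 1 as the common bound of the probabilities.\<close>
  obtain r where r: "strict_mono r"
    and "\<And>Nl. Nl \<in> UNIV \<Longrightarrow> \<exists>c. (\<lambda>k. pmf (p (r k) (fst Nl)) (snd Nl)) \<longlonglongrightarrow> c"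
    by (rule function_convergent_subsequence[of "UNIV :: (nat \<times> nat list) set" "\<lambda>k Nl. pmf (p k (fst Nl)) (snd Nl)" 1])
       (auto simp: pmf_le_1)
  then have "\<exists>c. (\<lambda>k. pmf (p (r k) N) l) \<longlonglongrightarrow> c" for N l
    by (metis UNIV_I fst_conv snd_conv)
  then obtain c where c: "\<And>N l. (\<lambda>k. pmf (p (r k) N) l) \<longlonglongrightarrow> c N l" by metis
  have tightN: "\<exists>A. finite A \<and> (\<forall>\<^sub>F k in sequentially. measure_pmf.prob (p k N) (- A) \<le> e)"
    if "e > 0" for N e
    using that
  proof (induction N arbitrary: e)
    case 0
    have "measure_pmf.prob (p k 0) (- {[]}) = 0" for k
      by (simp add: p_prob)
    with 0 show ?case by (intro exI[of _ "{[]}"]) auto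
  next
    case (Suc N)
    from Suc have "e / 2 > 0" by simp
    from Suc.IH[OF this] obtain A where A: "finite A" "\<forall>\<^sub>F k in sequentially. measure_pmf.prob (p k N) (- A) \<le> e / 2"
      by auto
    from tight[OF \<open>e / 2 > 0\<close>] obtain m where
      m: "\<forall>\<^sub>F k in sequentially. measure (Q k) {\<omega>\<in>space (Q k). m \<le> Y k \<omega> N} \<le> e / 2" by auto
    \<comment> \<open>Prefixes in \<open>A\<close> followed by a last entry below \<open>m\<close>;
      either failure costs at most \<open>e / 2\<close>.\<close>
    let ?B = "(\<lambda>(l, a). l @ [a]) ` (A \<times> {..<m})"
    have "\<forall>\<^sub>F k in sequentially. measure_pmf.prob (p k (Suc N)) (- ?B) \<le> e"
      using A(2) m
    proof eventually_elim
      case (elim k)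
      interpret prob_space "Q k" by (rule Q)
      note [measurable] = Ymap Y
      have "measure_pmf.prob (p k (Suc N)) (- ?B)
        = measure (Q k) {\<omega>\<in>space (Q k). map (Y k \<omega>) [0..<Suc N] \<in> - ?B}" by (rule p_prob)
      also have "\<dots> \<le> measure (Q k) ({\<omega>\<in>space (Q k). map (Y k \<omega>) [0..<N] \<in> - A} \<union> {\<omega>\<in>space (Q k). m \<le> Y k \<omega> N})"
      proof (rule finite_measure_mono)
        show "{\<omega>\<in>space (Q k). map (Y k \<omega>) [0..<Suc N] \<in> - ?B}
          \<subseteq> {\<omega>\<in>space (Q k). map (Y k \<omega>) [0..<N] \<in> - A} \<union> {\<omega>\<in>space (Q k). m \<le> Y k \<omega> N}"
          by (auto simp: image_iff)
      qed measurable
      also have "\<dots> \<le> measure (Q k) {\<omega>\<in>space (Q k). map (Y k \<omega>) [0..<N] \<in> - A} + measure (Q k) {\<omega>\<in>space (Q k). m \<le> Y k \<omega> N}"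
        by (rule measure_Un_le) measurable
      also have "\<dots> \<le> e" using elim by (simp add: p_prob)
      finally show ?case .
    qed
    then show ?case using A(1) by (intro exI[of _ ?B]) auto
  qed
  have "\<exists>P. (\<forall>l. pmf P l = c N l) \<and> (\<forall>f B. (\<forall>l. \<bar>f l\<bar> \<le> (B::real)) \<longrightarrow>
           (\<lambda>k. measure_pmf.expectation (p (r k) N) f) \<longlonglongrightarrow> measure_pmf.expectation P f)" for N
  proof -
    have t: "\<exists>A. finite A \<and> (\<forall>\<^sub>F k in sequentially. measure_pmf.prob (p (r k) N) (- A) \<le> e)" if "e > 0" for e
      using tightN[OF that, of N] eventually_subseq[OF r] by blast
    show ?thesis
      using pmf_limit[of "\<lambda>k. p (r k) N" "c N", OF c t] by metis
  qed
  then obtain q where q: "\<And>N l. pmf (q N) l = c N l"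
    and q_lim: "\<And>N f B. (\<And>l. \<bar>f l\<bar> \<le> (B::real)) \<Longrightarrow>
           (\<lambda>k. measure_pmf.expectation (p (r k) N) f) \<longlonglongrightarrow> measure_pmf.expectation (q N) f"
    by metis
  have q_len: "length l = N" if "l \<in> set_pmf (q N)" for l N
  proof (rule ccontr)
    assume "length l \<noteq> N"
    then have "{\<omega> \<in> space (Q k). map (Y k \<omega>) [0..<N] \<in> {l}} = {}" for k
      by auto
    then have "pmf (p k N) l = 0" for k
      using p_prob[of k N "{l}"] by (simp only: measure_pmf_single measure_empty)
    then have "c N l = 0" using c[of N l] by (simp add: LIMSEQ_const_iff)
    with that show False by (simp add: set_pmf_iff q)
  qed
  \<comment> \<open>Truncation is exact before the limit and is tested by a bounded function, so it
    is inherited by the limit laws.\<close>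
  have q_cons: "map_pmf (take N) (q M) = q N" if "N \<le> M" for N M
  proof (rule pmf_eqI)
    fix l
    have ind: "measure_pmf.expectation s (indicator A) = measure_pmf.prob s A" for s :: "nat list pmf" and A
      by simp
    have "(\<lambda>k. measure_pmf.expectation (p (r k) M) (indicat_real (take N -` {l}))) \<longlonglongrightarrow> measure_pmf.expectation (q M) (indicator (take N -` {l}))"
      by (rule q_lim[where B = 1]) (auto simp: indicator_def)
    moreover have "measure_pmf.expectation (p k M) (indicator (take N -` {l})) = pmf (p k N) l" for k
      using that unfolding ind p_prob measure_pmf_single[symmetric]
      by (auto simp: take_map intro!: arg_cong[where f="measure _"])
    ultimately have "(\<lambda>k. pmf (p (r k) N) l) \<longlonglongrightarrow> pmf (map_pmf (take N) (q M)) l"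
      by (simp add: pmf_map)
    then show "pmf (map_pmf (take N) (q M)) l = pmf (q N) l"
      using c[of N l] q LIMSEQ_unique by fastforce
  qed
  obtain P where P: "prob_space P" "sets P = sets nat_seqs"
    and P_distr: "\<And>N. distr P (count_space UNIV) (\<lambda>x. map x [0..<N]) = measure_pmf (q N)"
    using Kolmogorov_nat_lists[of q] q_len q_cons by metis
  have "(\<lambda>k. \<integral>\<omega>. f (Y (r k) \<omega>) \<partial>Q (r k)) \<longlonglongrightarrow> (\<integral>x. f x \<partial>P)"
    if f: "depends_on_first N f" "\<And>x. \<bar>f x\<bar> \<le> B" for N f and B :: real
  proof -
    define g where "g l = f (\<lambda>i. l ! i)" for l
    have fg: "f x = g (map x [0..<N])" for x
      unfolding g_def by (rule depends_on_first_factor[OF f(1)])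
    have m: "(\<lambda>x. map x [0..<N]) \<in> P \<rightarrow>\<^sub>M count_space UNIV"
      unfolding measurable_cong_sets[OF P(2) refl] by (rule measurable_map_upt) simp
    have "(\<integral>x. f x \<partial>P) = measure_pmf.expectation (q N) g"
      unfolding P_distr[symmetric] fg using m by (subst integral_distr) auto
    moreover have "(\<integral>\<omega>. f (Y k \<omega>) \<partial>Q k) = measure_pmf.expectation (p k N) g" for k
      unfolding p_exp fg ..
    moreover have "\<bar>g l\<bar> \<le> B" for l using f(2) by (simp add: g_def)
    ultimately show ?thesis using q_lim[of g B N] by simp
  qed
  with r P that show ?thesis by blast
qed

text \<open>The function factors through the prefix, a random element of a countable discrete space,
  and every map out of such a space is measurable.\<close>

lemma depends_on_first_measurable:
  assumes "depends_on_first N f" "\<And>i. (\<lambda>\<omega>. Y \<omega> i) \<in> Q \<rightarrow>\<^sub>M count_space (UNIV :: 'a::countable set)"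
    and "\<And>x. f x \<in> space M"
  shows "(\<lambda>\<omega>. f (Y \<omega>)) \<in> Q \<rightarrow>\<^sub>M M"
proof -
  have "(\<lambda>\<omega>. f (Y \<omega>)) = (\<lambda>l. f (\<lambda>i. l ! i)) \<circ> (\<lambda>\<omega>. map (Y \<omega>) [0..<N])"
    using depends_on_first_factor[OF assms(1)] by (auto simp: fun_eq_iff)
  also have "\<dots> \<in> Q \<rightarrow>\<^sub>M M"
    by (rule measurable_comp[OF measurable_map_upt]) (use assms in auto)
  finally show ?thesis .
qed

lemma nat_seqs_component:
  "sets P = sets nat_seqs \<Longrightarrow> (\<lambda>x. x i) \<in> P \<rightarrow>\<^sub>M count_space UNIV"
  by (subst measurable_cong_sets[of P nat_seqs _ "count_space UNIV"]) auto

text \<open>The indicator of the failure of \<open>R\<close> is a bounded cylinder function; its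
  integrals vanish along the sequence, hence also in the limit.\<close>

lemma AE_limit_depends_on_first:
  assumes "prob_space P" "sets P = sets nat_seqs"
    and lim: "\<And>N f B. depends_on_first N f \<Longrightarrow> (\<And>x. \<bar>f x\<bar> \<le> (B::real)) \<Longrightarrow>
           (\<lambda>k. \<integral>\<omega>. f (Y k \<omega>) \<partial>Q k) \<longlonglongrightarrow> (\<integral>x. f x \<partial>P)"
    and R: "depends_on_first N R" and AE: "\<And>k. AE \<omega> in Q k. R (Y k \<omega>)"
  shows "AE x in P. R x"
proof -
  interpret prob_space P by fact
  define f :: "(nat \<Rightarrow> nat) \<Rightarrow> real" where "f x = (if R x then 0 else 1)" for x
  have f: "depends_on_first N f"
    using R by (auto simp: f_def depends_on_first_def)
  have f_meas: "f \<in> borel_measurable P"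
    by (rule depends_on_first_measurable[OF f, where Y="\<lambda>x. x"])
       (use nat_seqs_component[OF assms(2)] in auto)
  have "(\<lambda>k. \<integral>\<omega>. f (Y k \<omega>) \<partial>Q k) \<longlonglongrightarrow> (\<integral>x. f x \<partial>P)"
    by (rule lim[OF f, of 1]) (auto simp: f_def)
  moreover have "(\<integral>\<omega>. f (Y k \<omega>) \<partial>Q k) = 0" for k
    by (rule integral_eq_zero_AE) (use AE[of k] in \<open>auto simp: f_def\<close>)
  ultimately have "(\<integral>x. f x \<partial>P) = 0"
    by (simp add: LIMSEQ_const_iff)
  moreover have "integrable P f"
    by (rule integrable_const_bound[of _ 1]) (use f_meas in \<open>auto simp: f_def\<close>)
  ultimately have "AE x in P. f x = 0"
    by (subst (asm) integral_nonneg_eq_0_iff_AE) (auto simp: f_def)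
  then show ?thesis by (rule AE_mp) (auto simp: f_def)
qed

section \<open>Compactness of random geodesics\<close>

text \<open>Counterpart, in the ambient type, of the condition in \<open>Geo\<close>. Values outside
  [0,1] stay free here; curves are restricted only when they are pulled back to the limit
  space.\<close>

definition unit_geodesic :: "(real \<Rightarrow> 'w::metric_space) \<Rightarrow> bool" where
  "unit_geodesic c \<longleftrightarrow>
     (\<forall>s\<in>{0..1}. \<forall>t\<in>{0..1}. dist (c s) (c t) = \<bar>s - t\<bar> * dist (c 0) (c 1))"

text \<open>Functionals of a pair of curve points. Uniform continuity lets points be replaced by
  nearby coded points with one error for all curves; both time marginals and transport costs are of
  this kind.\<close>

definition unif_cont2 :: "('w::metric_space \<Rightarrow> 'w \<Rightarrow> real) \<Rightarrow> bool" where
  "unif_cont2 F \<longleftrightarrow>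
     (\<forall>e>0. \<exists>d>0. \<forall>u u' v v'. dist u u' < d \<longrightarrow> dist v v' < d \<longrightarrow> \<bar>F u v - F u' v'\<bar> < e)"

text \<open>The points of \<open>closure (range p)\<close> are encoded by integer sequences: the \<open>j\<close>-th code locates a point
  up to distance \<open>2\<^sup>-\<^sup>j\<close>. A random geodesic thus becomes a random integer sequence (its codes at a
  dense set of times), and compactness for random geodesics reduces to the discrete case.\<close>
definition code :: "(nat \<Rightarrow> 'w::metric_space) \<Rightarrow> nat \<Rightarrow> 'w \<Rightarrow> nat" where
  "code p j w = (LEAST i. dist w (p i) < (1/2)^j)"

lemma dist_code:
  assumes "w \<in> closure (range p)"
  shows "dist w (p (code p j w)) < (1/2)^j"
proof -
  have "\<exists>i. dist w (p i) < (1/2)^j"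
    using assms by (force simp: closure_approachable dist_commute)
  then show ?thesis unfolding code_def by (rule LeastI_ex)
qed

text \<open>The choice of the least index matters here: a large code says that all early points are
  far away, so tightness in terms of balls becomes tightness of codes.\<close>

lemma code_geD: "N \<le> code p j w \<Longrightarrow> i < N \<Longrightarrow> dist w (p i) \<ge> (1/2)^j"
  unfolding code_def using not_less_Least[of i "\<lambda>i. dist w (p i) < (1/2)^j"] by force

lemma measurable_code:
  assumes "\<And>i. (\<lambda>\<omega>. dist (c \<omega>) (p i)) \<in> borel_measurable Q"
  shows "(\<lambda>\<omega>. code p j (c \<omega>)) \<in> Q \<rightarrow>\<^sub>M count_space UNIV"
  unfolding code_def using assms by measurable

section \<open>Recovering points, functionals and curves from codes\<close>

lemma half_power_small:
  assumes "d > (0::real)" obtains j where "C * (1/2)^j < d"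
proof -
  have "(\<lambda>j. C * (1/2)^j :: real) \<longlonglongrightarrow> C * 0"
    by (intro tendsto_intros LIMSEQ_realpow_zero) auto
  then have "\<forall>\<^sub>F j in sequentially. C * (1/2)^j < d"
    using assms by (intro order_tendstoD) auto
  then show ?thesis using that by (auto simp: eventually_sequentially)
qed

lemma unif_cont2_LIMSEQ:
  assumes F: "unif_cont2 F" and u: "\<And>j. dist (u j) a \<le> (1/2)^j" and v: "\<And>j. dist (v j) b \<le> (1/2)^j"
  shows "(\<lambda>j. F (u j) (v j)) \<longlonglongrightarrow> F a b"
proof (rule LIMSEQ_I)
  fix e :: real assume "e > 0"
  then obtain d where d: "d > 0" "\<And>u u' v v'. dist u u' < d \<Longrightarrow> dist v v' < d \<Longrightarrow> \<bar>F u v - F u' v'\<bar> < e"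
    using F unfolding unif_cont2_def by metis
  obtain j where j: "1 * (1/2)^j < d" by (rule half_power_small[OF d(1)])
  have "norm (F (u i) (v i) - F a b) < e" if "i \<ge> j" for i
  proof -
    have "(1/2)^i \<le> ((1/2)^j :: real)" using that by (intro power_decreasing) auto
    then have "dist (u i) a < d" "dist (v i) b < d" using u[of i] v[of i] j by linarith+
    then show ?thesis using d(2) by simp
  qed
  then show "\<exists>no. \<forall>i\<ge>no. norm (F (u i) (v i) - F a b) < e" by blast
qed

text \<open>\<open>'w\<close> may be nonseparable, so joint measurability is not automatic. Here
  \<open>F\<close> is the pointwise limit of its values at coded points, which depend on the codes
  alone.\<close>

lemma borel_measurable_unif_cont2:
  fixes p :: "nat \<Rightarrow> 'w::metric_space"
  assumes F: "unif_cont2 F"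
    and "\<And>\<omega>. \<omega> \<in> space Q \<Longrightarrow> c1 \<omega> \<in> closure (range p)" "\<And>\<omega>. \<omega> \<in> space Q \<Longrightarrow> c2 \<omega> \<in> closure (range p)"
    and "\<And>i. (\<lambda>\<omega>. dist (c1 \<omega>) (p i)) \<in> borel_measurable Q" "\<And>i. (\<lambda>\<omega>. dist (c2 \<omega>) (p i)) \<in> borel_measurable Q"
  shows "(\<lambda>\<omega>. F (c1 \<omega>) (c2 \<omega>)) \<in> borel_measurable Q"
proof (rule borel_measurable_LIMSEQ_real)
  note [measurable] = measurable_code[OF assms(4)] measurable_code[OF assms(5)]
  show "(\<lambda>\<omega>. F (p (code p j (c1 \<omega>))) (p (code p j (c2 \<omega>)))) \<in> borel_measurable Q" for j
    by measurable
  show "(\<lambda>j. F (p (code p j (c1 \<omega>))) (p (code p j (c2 \<omega>)))) \<longlonglongrightarrow> F (c1 \<omega>) (c2 \<omega>)"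
    if "\<omega> \<in> space Q" for \<omega>
    using dist_code[OF assms(2)[OF that]] dist_code[OF assms(3)[OF that]]
    by (intro unif_cont2_LIMSEQ[OF F]) (auto simp: dist_commute less_imp_le)
qed

lemma unif_cont2_dist: "unif_cont2 (\<lambda>u v. dist u v)"
  unfolding unif_cont2_def
proof (intro allI impI)
  fix e :: real assume "e > 0"
  then show "\<exists>d>0. \<forall>u u' v v'. dist u u' < d \<longrightarrow> dist v v' < d \<longrightarrow> \<bar>dist u v - dist u' v'\<bar> < e"
    using abs_diff_le_iff by (intro exI[of _ "e/2"]) (smt (verit) dist_commute dist_triangle field_sum_of_halves)
qed

lemma unif_cont2_left:
  assumes "uniformly_continuous_on UNIV f"
  shows "unif_cont2 (\<lambda>u v. f u)"
  using assms unfolding unif_cont2_def uniformly_continuous_on_def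
  by (metis UNIV_I dist_commute dist_real_def)

lemma half_power_LIMSEQ_D:
  assumes "\<And>j. a j \<le> b j + C * (1/2)^j" "a \<longlonglongrightarrow> x" "b \<longlonglongrightarrow> y"
  shows "x \<le> (y::real)"
proof -
  have "(\<lambda>j. b j + C * (1/2)^j) \<longlonglongrightarrow> y + C * 0"
    by (intro tendsto_intros assms LIMSEQ_realpow_zero) auto
  then show ?thesis using assms(1,2) by (intro LIMSEQ_le[of a x]) auto
qed

text \<open>At each listed time the coded points form a Cauchy sequence. Their limits satisfy the
  geodesic identity exactly, because the error tends to 0 with \<open>j\<close>; the resulting
  Lipschitz map on a dense set of times then extends to [0,1].\<close>

lemma unit_geodesic_from_codes:
  fixes U :: "nat \<Rightarrow> nat \<Rightarrow> 'w::complete_space" and \<tau> :: "nat \<Rightarrow> real"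
  assumes \<tau>: "range \<tau> \<subseteq> {0..1}" "{0..1} \<subseteq> closure (range \<tau>)" "\<tau> a0 = 0" "\<tau> a1 = 1"
    and K: "closed K" "\<And>j a. U j a \<in> K"
    and Cau: "\<And>a j j'. dist (U j a) (U j' a) \<le> (1/2)^j + (1/2)^j'"
    and geo: "\<And>a b j. \<bar>dist (U j a) (U j b) - \<bar>\<tau> a - \<tau> b\<bar> * dist (U j a0) (U j a1)\<bar> \<le> 4 * (1/2)^j"
    and len: "\<And>j. dist (U j a0) (U j a1) \<le> D + 2 * (1/2)^j"
  shows "\<exists>\<gamma>. unit_geodesic \<gamma> \<and> dist (\<gamma> 0) (\<gamma> 1) \<le> D \<and> (\<forall>t\<in>{0..1}. \<gamma> t \<in> K) \<and>
    (\<forall>a j. dist (\<gamma> (\<tau> a)) (U j a) \<le> (1/2)^j)"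
proof -
  have "Cauchy (\<lambda>j. U j a)" for a
  proof (rule metric_CauchyI)
    fix e :: real assume "e > 0"
    then obtain j where j: "2 * (1/2)^j < e" by (rule half_power_small)
    have "dist (U m a) (U n a) < e" if "m \<ge> j" "n \<ge> j" for m n
    proof -
      have "(1/2)^m \<le> ((1/2)^j :: real)" "(1/2)^n \<le> ((1/2)^j :: real)"
        using that by (auto intro!: power_decreasing)
      then show ?thesis using Cau[of m a n] j by linarith
    qed
    then show "\<exists>M. \<forall>m\<ge>M. \<forall>n\<ge>M. dist (U m a) (U n a) < e" by blast
  qed
  then have "\<exists>l. (\<lambda>j. U j a) \<longlonglongrightarrow> l" for a
    by (simp add: Cauchy_convergent_iff convergent_def)
  then obtain g where g: "\<And>a. (\<lambda>j. U j a) \<longlonglongrightarrow> g a" by metis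
  have gK: "g a \<in> K" for a
    using closed_sequentially[OF K(1) _ g] K(2) by auto
  have gU: "dist (g a) (U j a) \<le> (1/2)^j" for a j
    by (rule half_power_LIMSEQ_D[of "\<lambda>i. dist (U i a) (U j a)" "\<lambda>_. (1/2)^j" 1])
       (use Cau in \<open>auto intro!: tendsto_intros g simp: add.commute\<close>)
  define L where "L = dist (g a0) (g a1)"
  have gg: "dist (g a) (g b) = \<bar>\<tau> a - \<tau> b\<bar> * L" for a b
  proof (rule antisym)
    have *: "(\<lambda>j. dist (U j a) (U j b)) \<longlonglongrightarrow> dist (g a) (g b)"
      "(\<lambda>j. \<bar>\<tau> a - \<tau> b\<bar> * dist (U j a0) (U j a1)) \<longlonglongrightarrow> \<bar>\<tau> a - \<tau> b\<bar> * L"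
      unfolding L_def by (intro tendsto_intros g)+
    have "dist (U j a) (U j b) \<le> \<bar>\<tau> a - \<tau> b\<bar> * dist (U j a0) (U j a1) + 4 * (1/2)^j"
         "\<bar>\<tau> a - \<tau> b\<bar> * dist (U j a0) (U j a1) \<le> dist (U j a) (U j b) + 4 * (1/2)^j" for j
      using geo[of j a b] by linarith+
    from half_power_LIMSEQ_D[OF this(1) *] half_power_LIMSEQ_D[OF this(2) *(2,1)]
    show "dist (g a) (g b) \<le> \<bar>\<tau> a - \<tau> b\<bar> * L" "\<bar>\<tau> a - \<tau> b\<bar> * L \<le> dist (g a) (g b)" .
  qed
  have LD: "L \<le> D"
    unfolding L_def by (rule half_power_LIMSEQ_D[of "\<lambda>j. dist (U j a0) (U j a1)" "\<lambda>_. D"])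
      (use len in \<open>auto intro!: tendsto_intros g\<close>)
  define h where "h t = g (SOME a. \<tau> a = t)" for t
  have h: "h (\<tau> a) = g a" for a
  proof -
    have "\<tau> (SOME a'. \<tau> a' = \<tau> a) = \<tau> a" by (rule someI) simp
    then have "dist (h (\<tau> a)) (g a) = 0" unfolding h_def gg by simp
    then show ?thesis by simp
  qed
  have L0: "L \<ge> 0" by (simp add: L_def)
  have hh: "dist (h s) (h t) = \<bar>s - t\<bar> * L" if "s \<in> range \<tau>" "t \<in> range \<tau>" for s t
    using that gg h by auto
  have "uniformly_continuous_on (range \<tau>) h"
    by (rule lipschitz_on_uniformly_continuous[of L])
       (auto intro!: lipschitz_onI simp: hh L0 dist_real_def mult.commute h gg)
  \<comment> \<open>Completeness of \<open>'w\<close> is used once more: a uniformly continuous map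
    on the listed times extends to their closure.\<close>
  then obtain \<gamma> where \<gamma>: "uniformly_continuous_on (closure (range \<tau>)) \<gamma>" "\<And>t. t \<in> range \<tau> \<Longrightarrow> h t = \<gamma> t"
    using uniformly_continuous_on_extension_on_closure by metis
  have cl: "closure (range \<tau>) = {0..1}"
    using \<tau>(1,2) by (simp add: antisym closure_minimal)
  have cont: "continuous_on {0..1} \<gamma>"
    using \<gamma>(1) cl by (simp add: uniformly_continuous_imp_continuous)
  have \<gamma>\<tau>: "\<gamma> (\<tau> a) = g a" for a using \<gamma>(2)[of "\<tau> a"] h by simp
  have seq: "\<exists>a. (\<lambda>n. \<tau> (a n)) \<longlonglongrightarrow> t \<and> (\<lambda>n. \<gamma> (\<tau> (a n))) \<longlonglongrightarrow> \<gamma> t" if "t \<in> {0..1}" for t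
  proof -
    have "t \<in> closure (range \<tau>)" using that cl by simp
    then obtain u where u: "\<And>n. u n \<in> range \<tau>" "u \<longlonglongrightarrow> t"
      unfolding closure_sequential by blast
    then have "\<forall>n. \<exists>a. u n = \<tau> a" by blast
    then obtain a where a: "u = (\<lambda>n. \<tau> (a n))" by metis
    have "(\<lambda>n. \<gamma> (u n)) \<longlonglongrightarrow> \<gamma> t"
      by (rule continuous_on_tendsto_compose[OF cont u(2) that]) (use u(1) \<tau>(1) in \<open>blast intro: always_eventually\<close>)
    with u a show ?thesis by auto
  qed
  have dd: "dist (\<gamma> s) (\<gamma> t) = \<bar>s - t\<bar> * L" if st: "s \<in> {0..1}" "t \<in> {0..1}" for s t
  proof -
    obtain a b where a: "(\<lambda>n. \<tau> (a n)) \<longlonglongrightarrow> s" "(\<lambda>n. \<gamma> (\<tau> (a n))) \<longlonglongrightarrow> \<gamma> s"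
      and b: "(\<lambda>n. \<tau> (b n)) \<longlonglongrightarrow> t" "(\<lambda>n. \<gamma> (\<tau> (b n))) \<longlonglongrightarrow> \<gamma> t"
      using seq[OF st(1)] seq[OF st(2)] by metis
    have "(\<lambda>n. dist (\<gamma> (\<tau> (a n))) (\<gamma> (\<tau> (b n)))) \<longlonglongrightarrow> dist (\<gamma> s) (\<gamma> t)"
      by (intro tendsto_intros a b)
    moreover have "(\<lambda>n. \<bar>\<tau> (a n) - \<tau> (b n)\<bar> * L) \<longlonglongrightarrow> \<bar>s - t\<bar> * L"
      by (intro tendsto_intros a b)
    ultimately show ?thesis
      unfolding \<gamma>\<tau> gg by (rule LIMSEQ_unique)
  qed
  have "\<gamma> t \<in> K" if t: "t \<in> {0..1}" for t
  proof -
    obtain a where "(\<lambda>n. \<gamma> (\<tau> (a n))) \<longlonglongrightarrow> \<gamma> t" using seq[OF t] by auto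
    then show ?thesis using closed_sequentially[OF K(1), of "\<lambda>n. \<gamma> (\<tau> (a n))"] gK by (auto simp: \<gamma>\<tau>)
  qed
  moreover have "unit_geodesic \<gamma>"
    unfolding unit_geodesic_def using dd by auto
  moreover have "dist (\<gamma> 0) (\<gamma> 1) \<le> D" using dd[of 0 1] LD by simp
  ultimately show ?thesis using gU \<gamma>\<tau> by auto
qed

text \<open>The codes of a random geodesic form a random integer sequence, tight because of the
  hypothesis on balls. A subsequential limit law lives on sequences that are almost surely codes of
  geodesics, and \<open>\<Gamma>\<close> decodes them. Convergence is needed only for functionals of
  two times: they give the time marginals and the cost.\<close>

lemma random_geodesics_compactness:
  fixes p :: "nat \<Rightarrow> 'w::complete_space" and c :: "nat \<Rightarrow> 'c \<Rightarrow> real \<Rightarrow> 'w"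
  assumes Q: "\<And>k. prob_space (Q k)"
    and geo: "\<And>k \<omega>. \<omega> \<in> space (Q k) \<Longrightarrow> unit_geodesic (c k \<omega>)"
    and rng: "\<And>k \<omega> t. \<omega> \<in> space (Q k) \<Longrightarrow> t \<in> {0..1} \<Longrightarrow> c k \<omega> t \<in> closure (range p)"
    and len: "\<And>k. AE \<omega> in Q k. dist (c k \<omega> 0) (c k \<omega> 1) \<le> D"
    and meas: "\<And>k t i. t \<in> {0..1} \<Longrightarrow> (\<lambda>\<omega>. dist (c k \<omega> t) (p i)) \<in> borel_measurable (Q k)"
    and tight: "\<And>t d e. t \<in> {0..1} \<Longrightarrow> d > 0 \<Longrightarrow> e > 0 \<Longrightarrow>
      \<exists>N. \<forall>\<^sub>F k in sequentially. measure (Q k) {\<omega>\<in>space (Q k). \<forall>i<N. d \<le> dist (c k \<omega> t) (p i)} \<le> e"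
  obtains r and P :: "(nat \<Rightarrow> nat) measure" and \<Gamma>
  where "strict_mono r" "prob_space P"
    and "\<And>x. unit_geodesic (\<Gamma> x)" "\<And>x. dist (\<Gamma> x 0) (\<Gamma> x 1) \<le> D"
    and "\<And>x t. t \<in> {0..1} \<Longrightarrow> \<Gamma> x t \<in> closure (range p)"
    and "\<And>t w. t \<in> {0..1} \<Longrightarrow> (\<lambda>x. dist (\<Gamma> x t) w) \<in> borel_measurable P"
    and "\<And>F B s t. (\<And>u v. \<bar>F u v\<bar> \<le> B) \<Longrightarrow> unif_cont2 F \<Longrightarrow> s \<in> {0..1} \<Longrightarrow> t \<in> {0..1} \<Longrightarrow>
           (\<lambda>k. \<integral>\<omega>. F (c (r k) \<omega> s) (c (r k) \<omega> t) \<partial>Q (r k)) \<longlonglongrightarrow> (\<integral>x. F (\<Gamma> x s) (\<Gamma> x t) \<partial>P)"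
proof -
  obtain T :: "real set" where T: "countable T" "T \<subseteq> {0..1}" "{0..1} \<subseteq> closure T"
    by (rule separable)
  \<comment> \<open>The endpoints are added to the dense set so that
    \<open>dist (c k \<omega> 0) (c k \<omega> 1)\<close> can be read off the codes.\<close>
  define \<tau> where "\<tau> = from_nat_into (T \<union> {0,1})"
  have ranget: "range \<tau> = T \<union> {0, 1}"
    unfolding \<tau>_def using T(1) by (intro range_from_nat_into) auto
  have \<tau>: "range \<tau> \<subseteq> {0..1}" "{0..1} \<subseteq> closure (range \<tau>)"
    unfolding ranget using T(2,3) closure_mono[of T "T \<union> {0,1}"] by auto
  obtain a0 a1 where a01: "\<tau> a0 = 0" "\<tau> a1 = 1"
    using ranget by (metis UnI2 insertCI rangeE)
  have \<tau>01: "\<tau> a \<in> {0..1}" for a using \<tau>(1) by blast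
  \<comment> \<open>\<open>Y\<close> writes the codes of a curve into one sequence;
    \<open>U j a\<close> reads off the point coded with precision \<open>j\<close> at time
    \<open>\<tau> a\<close>.\<close>
  define U where "U j a x = p (x (prod_encode (a, j)))" for j a and x :: "nat \<Rightarrow> nat"
  define Y where "Y k \<omega> i = code p (snd (prod_decode i)) (c k \<omega> (\<tau> (fst (prod_decode i))))" for k \<omega> i
  have U_Y: "U j a (Y k \<omega>) = p (code p j (c k \<omega> (\<tau> a)))" for j a k \<omega>
    by (simp add: U_def Y_def)
  have dU: "dist (c k \<omega> (\<tau> a)) (U j a (Y k \<omega>)) \<le> (1/2)^j" if "\<omega> \<in> space (Q k)" for k \<omega> a j
    unfolding U_Y using dist_code[OF rng[OF that \<tau>01]] by (simp add: less_imp_le)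
  have dep: "\<exists>N. depends_on_first N (\<lambda>x. f (U j a x) (U i b x) (U j a0 x) (U j a1 x))"
    for f :: "'w \<Rightarrow> 'w \<Rightarrow> 'w \<Rightarrow> 'w \<Rightarrow> 'd" and j i a b
    unfolding depends_on_first_def U_def
    by (rule exI[of _ "Suc (Max {prod_encode (a, j), prod_encode (b, i), prod_encode (a0, j), prod_encode (a1, j)})"])
       (simp add: less_Suc_eq_le)
  have Ym: "(\<lambda>\<omega>. Y k \<omega> i) \<in> Q k \<rightarrow>\<^sub>M count_space UNIV" for k i
    unfolding Y_def by (intro measurable_code meas \<tau>01)
  have "\<exists>N. \<forall>\<^sub>F k in sequentially. measure (Q k) {\<omega>\<in>space (Q k). N \<le> Y k \<omega> i} \<le> e" if e: "e > 0" for i e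
  proof -
    obtain a j where i: "prod_decode i = (a, j)" by fastforce
    obtain N where N: "\<forall>\<^sub>F k in sequentially. measure (Q k) {\<omega>\<in>space (Q k). \<forall>i<N. (1/2)^j \<le> dist (c k \<omega> (\<tau> a)) (p i)} \<le> e"
      using tight[OF \<tau>01 _ e, of "(1/2)^j" a] by auto
    have "measure (Q k) {\<omega>\<in>space (Q k). N \<le> Y k \<omega> i} \<le> measure (Q k) {\<omega>\<in>space (Q k). \<forall>i<N. (1/2)^j \<le> dist (c k \<omega> (\<tau> a)) (p i)}" for k
    proof -
      interpret prob_space "Q k" by (rule Q)
      have [measurable]: "(\<lambda>\<omega>. dist (c k \<omega> (\<tau> a)) (p i)) \<in> borel_measurable (Q k)" for i
        by (rule meas[OF \<tau>01])
      show ?thesis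
        by (rule finite_measure_mono) (auto simp: Y_def i dest: code_geD)
    qed
    then show ?thesis using N by (intro exI[of _ N]) (auto elim!: eventually_mono intro: order_trans)
  qed
  from nat_seqs_compactness[of Q Y, OF Q Ym this]
  obtain r P where r: "strict_mono r" and P: "prob_space P" and sP: "sets P = sets nat_seqs"
    and lim: "\<And>N f B. depends_on_first N f \<Longrightarrow> (\<And>x. \<bar>f x\<bar> \<le> (B::real)) \<Longrightarrow>
           (\<lambda>k. \<integral>\<omega>. f (Y (r k) \<omega>) \<partial>Q (r k)) \<longlonglongrightarrow> (\<integral>x. f x \<partial>P)"
    by blast
  interpret P: prob_space P by fact
  have AE_lim: "AE x in P. R (U j a x) (U i b x) (U j a0 x) (U j a1 x)"
    if AE: "\<And>k. AE \<omega> in Q k. R (U j a (Y k \<omega>)) (U i b (Y k \<omega>)) (U j a0 (Y k \<omega>)) (U j a1 (Y k \<omega>))"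
    for R :: "'w \<Rightarrow> 'w \<Rightarrow> 'w \<Rightarrow> 'w \<Rightarrow> bool" and j i a b
  proof -
    obtain N where N: "depends_on_first N (\<lambda>x. R (U j a x) (U i b x) (U j a0 x) (U j a1 x))"
      using dep by blast
    show ?thesis
    proof (rule AE_limit_depends_on_first[OF P sP _ N, where Q = "\<lambda>k. Q (r k)" and Y = "\<lambda>k. Y (r k)"])
      show "AE \<omega> in Q (r k). R (U j a (Y (r k) \<omega>)) (U i b (Y (r k) \<omega>)) (U j a0 (Y (r k) \<omega>)) (U j a1 (Y (r k) \<omega>))" for k
        by (rule AE)
    qed (rule lim)
  qed
  \<comment> \<open>Each instance involves finitely many entries and passes to the limit law by
    itself; countably many instances then hold together almost surely.\<close>
  define good where "good x \<longleftrightarrow>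
     (\<forall>a j i. dist (U j a x) (U i a x) \<le> (1/2)^j + (1/2)^i) \<and>
     (\<forall>a b j. \<bar>dist (U j a x) (U j b x) - \<bar>\<tau> a - \<tau> b\<bar> * dist (U j a0 x) (U j a1 x)\<bar> \<le> 4 * (1/2)^j) \<and>
     (\<forall>j. dist (U j a0 x) (U j a1 x) \<le> D + 2 * (1/2)^j)" for x
  have good: "AE x in P. good x"
    unfolding good_def AE_conj_iff AE_all_countable
  proof (intro conjI allI)
    show "AE x in P. dist (U j a x) (U i a x) \<le> (1/2)^j + (1/2)^i" for a j i
    proof (rule AE_lim[of "\<lambda>u v _ _. dist u v \<le> (1/2)^j + (1/2)^i"], rule AE_I2)
      fix k \<omega> assume "\<omega> \<in> space (Q k)"
      from dU[OF this, of a j] dU[OF this, of a i]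
      show "dist (U j a (Y k \<omega>)) (U i a (Y k \<omega>)) \<le> (1/2)^j + (1/2)^i"
        by (smt (verit) dist_commute dist_triangle)
    qed
    show "AE x in P. \<bar>dist (U j a x) (U j b x) - \<bar>\<tau> a - \<tau> b\<bar> * dist (U j a0 x) (U j a1 x)\<bar> \<le> 4 * (1/2)^j" for a b j
    proof (rule AE_lim[of "\<lambda>u v u0 u1. \<bar>dist u v - \<bar>\<tau> a - \<tau> b\<bar> * dist u0 u1\<bar> \<le> 4 * (1/2)^j"], rule AE_I2)
      fix k \<omega> assume w: "\<omega> \<in> space (Q k)"
      let ?c = "c k \<omega>" and ?U = "\<lambda>a. U j a (Y k \<omega>)"
      have close: "\<bar>dist (?U a) (?U b) - dist (?c (\<tau> a)) (?c (\<tau> b))\<bar> \<le> 2 * (1/2)^j" for a b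
      proof -
        have "dist (?U a) (?U b) \<le> dist (?U a) (?c (\<tau> a)) + dist (?c (\<tau> a)) (?c (\<tau> b)) + dist (?c (\<tau> b)) (?U b)"
          "dist (?c (\<tau> a)) (?c (\<tau> b)) \<le> dist (?c (\<tau> a)) (?U a) + dist (?U a) (?U b) + dist (?U b) (?c (\<tau> b))"
          by (meson add_mono_thms_linordered_semiring(3) dist_triangle order_trans)+
        then show ?thesis
          using dU[OF w, of a j] dU[OF w, of b j] by (simp add: dist_commute abs_le_iff)
      qed
      have "dist (?c (\<tau> a)) (?c (\<tau> b)) = \<bar>\<tau> a - \<tau> b\<bar> * dist (?c (\<tau> a0)) (?c (\<tau> a1))"
        using geo[OF w] \<tau>01 unfolding unit_geodesic_def a01 by blast
      then have "\<bar>dist (?U a) (?U b) - \<bar>\<tau> a - \<tau> b\<bar> * dist (?U a0) (?U a1)\<bar>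
        = \<bar>(dist (?U a) (?U b) - dist (?c (\<tau> a)) (?c (\<tau> b)))
           - \<bar>\<tau> a - \<tau> b\<bar> * (dist (?U a0) (?U a1) - dist (?c (\<tau> a0)) (?c (\<tau> a1)))\<bar>"
        by (simp add: algebra_simps)
      \<comment> \<open>Two distances are each off by \<open>2 * (1/2)^j\<close>; the second carries
        a time difference of at most 1 as a factor.\<close>
      also have "\<dots> \<le> 2 * (1/2)^j + 1 * (2 * (1/2)^j)"
      proof (rule order_trans[OF abs_triangle_ineq4], rule add_mono[OF close])
        show "\<bar>\<bar>\<tau> a - \<tau> b\<bar> * (dist (?U a0) (?U a1) - dist (?c (\<tau> a0)) (?c (\<tau> a1)))\<bar> \<le> 1 * (2 * (1/2)^j)"
          unfolding abs_mult abs_abs using \<tau>01[of a] \<tau>01[of b] by (intro mult_mono close) auto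
      qed
      finally show "\<bar>dist (?U a) (?U b) - \<bar>\<tau> a - \<tau> b\<bar> * dist (?U a0) (?U a1)\<bar> \<le> 4 * (1/2)^j"
        by simp
    qed
    show "AE x in P. dist (U j a0 x) (U j a1 x) \<le> D + 2 * (1/2)^j" for j
    proof (rule AE_lim[of "\<lambda>_ _ u0 u1. dist u0 u1 \<le> D + 2 * (1/2)^j"])
      fix k
      show "AE \<omega> in Q k. dist (U j a0 (Y k \<omega>)) (U j a1 (Y k \<omega>)) \<le> D + 2 * (1/2)^j"
        using len[of k] AE_space
      proof eventually_elim
        case (elim \<omega>)
        from dU[OF elim(2), of a0 j] dU[OF elim(2), of a1 j] elim(1)
        show ?case unfolding a01 by (smt (verit) dist_commute dist_triangle)
      qed
    qed
  qed
  \<comment> \<open>Off \<open>good\<close> the curve will be constant, and its length 0 must not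
    exceed \<open>D\<close>.\<close>
  have D0: "D \<ge> 0"
  proof -
    interpret prob_space "Q 0" by (rule Q)
    have "AE \<omega> in Q 0. D \<ge> 0"
      using len[of 0] by eventually_elim (rule order_trans[OF zero_le_dist])
    then show ?thesis by simp
  qed
  have "\<exists>\<gamma>. unit_geodesic \<gamma> \<and> dist (\<gamma> 0) (\<gamma> 1) \<le> D \<and> (\<forall>t\<in>{0..1}. \<gamma> t \<in> closure (range p)) \<and>
    (\<forall>a j. dist (\<gamma> (\<tau> a)) (if good x then U j a x else p 0) \<le> (1/2)^j)" for x
  proof (cases "good x")
    case True
    then have "\<exists>\<gamma>. unit_geodesic \<gamma> \<and> dist (\<gamma> 0) (\<gamma> 1) \<le> D \<and> (\<forall>t\<in>{0..1}. \<gamma> t \<in> closure (range p)) \<and>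
      (\<forall>a j. dist (\<gamma> (\<tau> a)) (U j a x) \<le> (1/2)^j)"
      using closure_subset[of "range p"]
      by (intro unit_geodesic_from_codes[OF \<tau> a01]) (auto simp: good_def U_def)
    with True show ?thesis by simp
  next
    case False
    then show ?thesis
      using D0 closure_subset[of "range p"] by (intro exI[of _ "\<lambda>_. p 0"]) (auto simp: unit_geodesic_def)
  qed
  then obtain \<Gamma> where \<Gamma>: "\<And>x. unit_geodesic (\<Gamma> x)" "\<And>x. dist (\<Gamma> x 0) (\<Gamma> x 1) \<le> D"
    "\<And>x t. t \<in> {0..1} \<Longrightarrow> \<Gamma> x t \<in> closure (range p)"
    and \<Gamma>U: "\<And>x a j. dist (\<Gamma> x (\<tau> a)) (if good x then U j a x else p 0) \<le> (1/2)^j"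
    by metis
  have U_meas: "(\<lambda>x. f (U j a x) (U i b x) (U j a0 x) (U j a1 x)) \<in> P \<rightarrow>\<^sub>M N"
    if "\<And>x y z w. f x y z w \<in> space N" for f :: "'w \<Rightarrow> 'w \<Rightarrow> 'w \<Rightarrow> 'w \<Rightarrow> 'd" and j i a b N
  proof -
    obtain n where n: "depends_on_first n (\<lambda>x. f (U j a x) (U i b x) (U j a0 x) (U j a1 x))"
      using dep by blast
    show ?thesis
      by (rule depends_on_first_measurable[OF n]) (use nat_seqs_component[OF sP] that in auto)
  qed
  have good_meas [measurable]: "Measurable.pred P good"
  proof -
    have [measurable]: "Measurable.pred P (\<lambda>x. dist (U j a x) (U i a x) \<le> (1/2)^j + (1/2)^i)" for a j i
      by (rule U_meas[of "\<lambda>u v _ _. dist u v \<le> (1/2)^j + (1/2)^i"]) simp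
    have [measurable]: "Measurable.pred P (\<lambda>x. \<bar>dist (U j a x) (U j b x) - \<bar>\<tau> a - \<tau> b\<bar> * dist (U j a0 x) (U j a1 x)\<bar> \<le> 4 * (1/2)^j)" for a b j
      by (rule U_meas[of "\<lambda>u v u0 u1. \<bar>dist u v - \<bar>\<tau> a - \<tau> b\<bar> * dist u0 u1\<bar> \<le> 4 * (1/2)^j"]) simp
    have [measurable]: "Measurable.pred P (\<lambda>x. dist (U j a0 x) (U j a1 x) \<le> D + 2 * (1/2)^j)" for j
      by (rule U_meas[of "\<lambda>_ _ u0 u1. dist u0 u1 \<le> D + 2 * (1/2)^j"]) simp
    show ?thesis unfolding good_def by measurable
  qed
  have tapprox: "\<exists>a. (\<lambda>n. \<tau> (a n)) \<longlonglongrightarrow> t" if "t \<in> {0..1}" for t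
  proof -
    have "t \<in> closure (range \<tau>)" using that \<tau>(2) by (rule subsetD[rotated])
    then obtain u where u: "\<And>n. u n \<in> range \<tau>" "u \<longlonglongrightarrow> t"
      unfolding closure_sequential by metis
    then have "\<forall>n. \<exists>a. u n = \<tau> a" by blast
    then obtain a where "u = (\<lambda>n. \<tau> (a n))" by metis
    with u show ?thesis by auto
  qed
  have lip: "dist (\<gamma> s) (\<gamma> t) \<le> \<bar>s - t\<bar> * D" if "unit_geodesic \<gamma>" "dist (\<gamma> 0) (\<gamma> 1) \<le> D" "s \<in> {0..1}" "t \<in> {0..1}"
    for \<gamma> :: "real \<Rightarrow> 'w" and s t
    using that unfolding unit_geodesic_def by (metis abs_ge_zero mult_left_mono)
  have \<Gamma>_meas_\<tau>: "(\<lambda>x. dist (\<Gamma> x (\<tau> a)) w) \<in> borel_measurable P" for a w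
  proof (rule borel_measurable_LIMSEQ_real)
    show "(\<lambda>x. dist (if good x then U j a x else p 0) w) \<in> borel_measurable P" for j
    proof -
      have [measurable]: "(\<lambda>x. dist (U j a x) w) \<in> borel_measurable P" by (rule U_meas[of "\<lambda>u _ _ _. dist u w"]) simp
      have "(\<lambda>x. if good x then dist (U j a x) w else dist (p 0) w) \<in> borel_measurable P" by measurable
      then show ?thesis by (simp add: if_distrib[of "\<lambda>u. dist u w"])
    qed
    show "(\<lambda>j. dist (if good x then U j a x else p 0) w) \<longlonglongrightarrow> dist (\<Gamma> x (\<tau> a)) w" for x
      using \<Gamma>U[of x a]
      by (intro unif_cont2_LIMSEQ[OF unif_cont2_dist]) (simp_all add: dist_commute)
  qed
  have \<Gamma>_meas: "(\<lambda>x. dist (\<Gamma> x t) w) \<in> borel_measurable P" if t: "t \<in> {0..1}" for t w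
  proof -
    obtain a where a: "(\<lambda>n. \<tau> (a n)) \<longlonglongrightarrow> t" using tapprox[OF t] by auto
    have lim\<Gamma>: "(\<lambda>n. \<Gamma> x (\<tau> (a n))) \<longlonglongrightarrow> \<Gamma> x t" for x
    proof (rule metric_tendsto_imp_tendsto)
      show "(\<lambda>n. \<bar>\<tau> (a n) - t\<bar> * D) \<longlonglongrightarrow> 0"
        using a by (auto intro!: tendsto_eq_intros)
      show "\<forall>\<^sub>F n in sequentially. dist (\<Gamma> x (\<tau> (a n))) (\<Gamma> x t) \<le> dist (\<bar>\<tau> (a n) - t\<bar> * D) 0"
        using lip[OF \<Gamma>(1,2) \<tau>01 t] D0 by (intro always_eventually) (auto simp: dist_real_def abs_mult)
    qed
    show ?thesis
      by (rule borel_measurable_LIMSEQ_real[OF _ \<Gamma>_meas_\<tau>]) (auto intro!: tendsto_intros lim\<Gamma>)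
  qed
  \<comment> \<open>Up to \<open>e / 3\<close> on either side the functional is a cylinder function
    of the codes, and the convergence is known for those.\<close>
  have conv: "(\<lambda>k. \<integral>\<omega>. F (c (r k) \<omega> s) (c (r k) \<omega> t) \<partial>Q (r k)) \<longlonglongrightarrow> (\<integral>x. F (\<Gamma> x s) (\<Gamma> x t) \<partial>P)"
    if FB: "\<And>u v. \<bar>F u v\<bar> \<le> B" and F: "unif_cont2 F" and st: "s \<in> {0..1}" "t \<in> {0..1}" for F B s t
  proof (rule LIMSEQ_I)
    fix e :: real assume e: "e > 0"
    then obtain d where d: "d > 0" "\<And>u u' v v'. dist u u' < d \<Longrightarrow> dist v v' < d \<Longrightarrow> \<bar>F u v - F u' v'\<bar> < e / 3"
      using F unfolding unif_cont2_def by (metis divide_pos_pos zero_less_numeral)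
    \<comment> \<open>Half of \<open>d\<close> pays for the precision of the code, the other half
      for moving to a coded time.\<close>
    obtain j where j: "1 * (1/2)^j < d / 2" using half_power_small[of "d/2" 1] d(1) by (metis half_gt_zero)
    have "\<exists>a. \<bar>t - \<tau> a\<bar> * D < d / 2" if t: "t \<in> {0..1}" for t
    proof -
      obtain a where a: "(\<lambda>n. \<tau> (a n)) \<longlonglongrightarrow> t" using tapprox[OF t] by auto
      then have "(\<lambda>n. \<bar>t - \<tau> (a n)\<bar> * D) \<longlonglongrightarrow> 0" by (auto intro!: tendsto_eq_intros)
      then have "\<forall>\<^sub>F n in sequentially. \<bar>t - \<tau> (a n)\<bar> * D < d / 2"
        using d by (intro order_tendstoD) auto
      then show ?thesis by (auto simp: eventually_sequentially)
    qed
    then obtain a b where ab: "\<bar>s - \<tau> a\<bar> * D < d / 2" "\<bar>t - \<tau> b\<bar> * D < d / 2"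
      using st by blast
    define f where "f x = F (U j a x) (U j b x)" for x
    have fB: "\<bar>f x\<bar> \<le> B" for x by (simp add: f_def FB)
    obtain N where N: "depends_on_first N f"
      using dep[of "\<lambda>u v _ _. F u v" j a j b] unfolding f_def by auto
    have close: "\<bar>F (\<gamma> s) (\<gamma> t) - F u v\<bar> \<le> e / 3"
      if "unit_geodesic \<gamma>" "dist (\<gamma> 0) (\<gamma> 1) \<le> D" "dist (\<gamma> (\<tau> a)) u \<le> (1/2)^j" "dist (\<gamma> (\<tau> b)) v \<le> (1/2)^j" for \<gamma> u v
    proof -
      have "dist (\<gamma> s) u < d" "dist (\<gamma> t) v < d"
        using lip[OF that(1,2) st(1) \<tau>01, of a] lip[OF that(1,2) st(2) \<tau>01, of b] ab j that(3,4)
          dist_triangle[of "\<gamma> s" u "\<gamma> (\<tau> a)"] dist_triangle[of "\<gamma> t" v "\<gamma> (\<tau> b)"] by linarith+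
      then show ?thesis using d(2) by (simp add: less_imp_le)
    qed
    have bound: "\<bar>(\<integral>\<omega>. g \<omega> \<partial>M) - (\<integral>\<omega>. h \<omega> \<partial>M)\<bar> \<le> e / 3"
      if "prob_space M" "g \<in> borel_measurable M" "h \<in> borel_measurable M" "AE \<omega> in M. \<bar>g \<omega> - h \<omega>\<bar> \<le> e / 3"
        "\<And>\<omega>. \<bar>g \<omega>\<bar> \<le> B" "\<And>\<omega>. \<bar>h \<omega>\<bar> \<le> B" for M :: "'e measure" and g h :: "'e \<Rightarrow> real"
    proof -
      interpret prob_space M by fact
      have int: "integrable M g" "integrable M h"
        using that by (auto intro!: integrable_const_bound[of _ B])
      then have "\<bar>(\<integral>\<omega>. g \<omega> \<partial>M) - (\<integral>\<omega>. h \<omega> \<partial>M)\<bar> = \<bar>\<integral>\<omega>. g \<omega> - h \<omega> \<partial>M\<bar>" by simp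
      also have "\<dots> \<le> (\<integral>\<omega>. \<bar>g \<omega> - h \<omega>\<bar> \<partial>M)" by (rule integral_abs_bound)
      also have "\<dots> \<le> (\<integral>\<omega>. e / 3 \<partial>M)" using that(4) int by (intro integral_mono_AE) auto
      finally show ?thesis by (simp add: prob_space)
    qed
    have Qclose: "\<bar>(\<integral>\<omega>. F (c k \<omega> s) (c k \<omega> t) \<partial>Q k) - (\<integral>\<omega>. f (Y k \<omega>) \<partial>Q k)\<bar> \<le> e / 3" for k
    proof (rule bound[OF Q])
      show "(\<lambda>\<omega>. F (c k \<omega> s) (c k \<omega> t)) \<in> borel_measurable (Q k)"
        by (rule borel_measurable_unif_cont2[OF F, where p = p]; (rule rng meas; (assumption | rule st)))
      show "(\<lambda>\<omega>. f (Y k \<omega>)) \<in> borel_measurable (Q k)"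
        by (rule depends_on_first_measurable[OF N Ym]) simp
      show "AE \<omega> in Q k. \<bar>F (c k \<omega> s) (c k \<omega> t) - f (Y k \<omega>)\<bar> \<le> e / 3"
        using len[of k] AE_space
      proof eventually_elim
        case (elim \<omega>)
        show ?case unfolding f_def
          by (rule close[OF geo[OF elim(2)] elim(1) dU[OF elim(2)] dU[OF elim(2)]])
      qed
    qed (use FB fB in auto)
    have Pclose: "\<bar>(\<integral>x. F (\<Gamma> x s) (\<Gamma> x t) \<partial>P) - (\<integral>x. f x \<partial>P)\<bar> \<le> e / 3"
    proof (rule bound[OF P])
      show "(\<lambda>x. F (\<Gamma> x s) (\<Gamma> x t)) \<in> borel_measurable P"
        by (rule borel_measurable_unif_cont2[OF F, where p = p]; (rule \<Gamma>(3) \<Gamma>_meas; rule st))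
      show "f \<in> borel_measurable P"
        unfolding f_def by (rule U_meas[of "\<lambda>u v _ _. F u v"]) simp
      show "AE x in P. \<bar>F (\<Gamma> x s) (\<Gamma> x t) - f x\<bar> \<le> e / 3"
        using good
      proof eventually_elim
        case (elim x)
        show ?case unfolding f_def
          by (rule close[OF \<Gamma>(1,2)]) (use \<Gamma>U[of x a j] \<Gamma>U[of x b j] elim in auto)
      qed
    qed (use FB fB in auto)
    from LIMSEQ_D[OF lim[OF N fB], of "e/3"] e obtain k0 where
      k0: "\<And>k. k \<ge> k0 \<Longrightarrow> \<bar>(\<integral>\<omega>. f (Y (r k) \<omega>) \<partial>Q (r k)) - (\<integral>x. f x \<partial>P)\<bar> < e / 3"
      by auto
    have "norm ((\<integral>\<omega>. F (c (r k) \<omega> s) (c (r k) \<omega> t) \<partial>Q (r k)) - (\<integral>x. F (\<Gamma> x s) (\<Gamma> x t) \<partial>P)) < e" if "k \<ge> k0" for k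
      using Qclose[of "r k"] Pclose k0[OF that] unfolding real_norm_def by linarith
    then show "\<exists>no. \<forall>k\<ge>no. norm ((\<integral>\<omega>. F (c (r k) \<omega> s) (c (r k) \<omega> t) \<partial>Q (r k)) - (\<integral>x. F (\<Gamma> x s) (\<Gamma> x t) \<partial>P)) < e"
      by blast
  qed
  show ?thesis
  proof (rule that[of r P \<Gamma>])
    show "strict_mono r" "prob_space P" by (rule r, rule P)
    show "unit_geodesic (\<Gamma> x)" "dist (\<Gamma> x 0) (\<Gamma> x 1) \<le> D" for x by (rule \<Gamma>(1), rule \<Gamma>(2))
    show "\<Gamma> x t \<in> closure (range p)" if "t \<in> {0..1}" for x t using that by (rule \<Gamma>(3))
    show "(\<lambda>x. dist (\<Gamma> x t) w) \<in> borel_measurable P" if "t \<in> {0..1}" for t w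
      using that by (rule \<Gamma>_meas)
    show "(\<lambda>k. \<integral>\<omega>. F (c (r k) \<omega> s) (c (r k) \<omega> t) \<partial>Q (r k)) \<longlonglongrightarrow> (\<integral>x. F (\<Gamma> x s) (\<Gamma> x t) \<partial>P)"
      if "\<And>u v. \<bar>F u v\<bar> \<le> B" "unif_cont2 F" "s \<in> {0..1}" "t \<in> {0..1}" for F B s t
      by (rule conv[OF that])
  qed
qed

section \<open>Borel measures on abstract metric spaces\<close>

abbreviation mtop :: "'a metric \<Rightarrow> 'a topology" where "mtop \<equiv> mtopology_of"

lemma openin_mtop:
  "openin (mtop X) U \<longleftrightarrow> U \<subseteq> mspace X \<and> (\<forall>x\<in>U. \<exists>r>0. \<forall>y\<in>mspace X. mdist X x y < r \<longrightarrow> y \<in> U)"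
proof -
  interpret Metric_space "mspace X" "mdist X" by simp
  have "mball x r \<subseteq> U \<longleftrightarrow> (\<forall>y\<in>mspace X. mdist X x y < r \<longrightarrow> y \<in> U)" if "x \<in> mspace X" for x r
    using that by auto
  then show ?thesis
    unfolding mtopology_of_def openin_mtopology by blast
qed

lemma openin_dist_less: "y \<in> mspace X \<Longrightarrow> openin (mtop X) {x \<in> mspace X. mdist X x y < r}"
proof -
  interpret Metric_space "mspace X" "mdist X" by simp
  assume "y \<in> mspace X"
  then have "{x \<in> mspace X. mdist X x y < r} = mball y r"
    by (auto simp: mball_def commute)
  then show ?thesis by (simp add: mtopology_of_def)
qed

lemma openin_sets_mborel: "openin (mtop X) U \<Longrightarrow> U \<in> sets (mborel X)"
  unfolding sets_mborel by auto

lemma closedin_sets_mborel: "closedin (mtop X) F \<Longrightarrow> F \<in> sets (mborel X)"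
  using sets.compl_sets[OF openin_sets_mborel, of X "mspace X - F"]
  by (auto simp: closedin_def double_diff)

lemma separable_dense_sequence:
  assumes "separable_space (mtop X)" "mspace X \<noteq> {}"
  obtains d :: "nat \<Rightarrow> 'a" where "\<And>i. d i \<in> mspace X"
    and "\<And>x e. x \<in> mspace X \<Longrightarrow> e > 0 \<Longrightarrow> \<exists>i. mdist X x (d i) < e"
proof -
  interpret Metric_space "mspace X" "mdist X" by simp
  obtain C where C: "countable C" "C \<subseteq> mspace X" "mtop X closure_of C = mspace X"
    using assms(1) unfolding separable_space_def by auto
  then have "C \<noteq> {}" using assms(2) by auto
  with C(1) have r: "range (from_nat_into C) = C" by (rule range_from_nat_into[rotated])
  show ?thesis
  proof (rule that[of "from_nat_into C"])
    show "from_nat_into C i \<in> mspace X" for i using r C(2) by blast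
    fix x e assume x: "x \<in> mspace X" "(e::real) > 0"
    then have "x \<in> mtop X closure_of C" using C by simp
    then obtain y where "y \<in> C" "mdist X x y < e"
      using x(2) unfolding mtopology_of_def metric_closure_of by auto
    then show "\<exists>i. mdist X x (from_nat_into C i) < e" using r by (metis rangeE)
  qed
qed

lemma measurable_into_mborel_gen:
  assumes "f \<in> space M \<rightarrow> mspace X"
    and "\<And>U. openin (mtop X) U \<Longrightarrow> f -` U \<inter> space M \<in> sets M"
  shows "f \<in> M \<rightarrow>\<^sub>M mborel X"
  unfolding mborel_def
  by (rule measurable_measure_of[OF open_subset_Pow]) (use assms in auto)

text \<open>In a separable space every open set is a countable union of balls with centres in a
  dense sequence and radii 1 / Suc n, so measurable distances suffice.\<close>

lemma measurable_into_mborel: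
  assumes sep: "separable_space (mtop X)" and f: "f \<in> space M \<rightarrow> mspace X"
    and meas: "\<And>y. y \<in> mspace X \<Longrightarrow> (\<lambda>\<omega>. mdist X (f \<omega>) y) \<in> borel_measurable M"
  shows "f \<in> M \<rightarrow>\<^sub>M mborel X"
proof (cases "mspace X = {}")
  case True
  with f have "space M = {}" by auto
  then show ?thesis by (simp add: measurable_empty_iff True)
next
  case False
  interpret Metric_space "mspace X" "mdist X" by simp
  obtain d where d: "\<And>i. d i \<in> mspace X" "\<And>x e. x \<in> mspace X \<Longrightarrow> e > 0 \<Longrightarrow> \<exists>i::nat. mdist X x (d i) < e"
    using separable_dense_sequence[OF sep False] by metis
  show ?thesis
  proof (rule measurable_into_mborel_gen[OF f])
    fix U assume U: "openin (mtop X) U"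
    define I where "I = {(i, n). \<forall>x\<in>mspace X. mdist X x (d i) < 1 / Suc n \<longrightarrow> x \<in> U}"
    have eq: "f -` U \<inter> space M = (\<Union>(i, n)\<in>I. {\<omega>\<in>space M. mdist X (f \<omega>) (d i) < 1 / Suc n})"
    proof safe
      fix \<omega> assume w: "\<omega> \<in> space M" "f \<omega> \<in> U"
      then obtain r where r: "r > 0" "\<And>y. y \<in> mspace X \<Longrightarrow> mdist X (f \<omega>) y < r \<Longrightarrow> y \<in> U"
        using U unfolding openin_mtop by blast
      obtain n where n: "1 / Suc n < r / 2" using r(1) nat_approx_posE[of "r/2"] by auto
      obtain i where i: "mdist X (f \<omega>) (d i) < 1 / Suc n" using d(2)[of "f \<omega>" "1 / Suc n"] w f by auto
      have "(i, n) \<in> I"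
        unfolding I_def
      proof (clarify)
        fix x assume x: "x \<in> mspace X" "mdist X x (d i) < 1 / Suc n"
        have "mdist X (f \<omega>) x \<le> mdist X (f \<omega>) (d i) + mdist X (d i) x"
          using w f d x by (intro triangle) auto
        then show "x \<in> U" using r(2)[OF x(1)] x(2) i n by (simp add: commute)
      qed
      with w i show "\<omega> \<in> (\<Union>(i, n)\<in>I. {\<omega>\<in>space M. mdist X (f \<omega>) (d i) < 1 / Suc n})" by auto
    qed (use f in \<open>auto simp: I_def\<close>)
    have [measurable]: "(\<lambda>\<omega>. mdist X (f \<omega>) (d i)) \<in> borel_measurable M" for i by (rule meas[OF d(1)])
    show "f -` U \<inter> space M \<in> sets M"
      unfolding eq by (intro sets.countable_UN') (auto intro: countable_subset[OF subset_UNIV])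
  qed
qed

lemma continuous_map_measurable_mborel:
  assumes "continuous_map (mtop X) (mtop Y) f" shows "f \<in> mborel X \<rightarrow>\<^sub>M mborel Y"
proof (rule measurable_into_mborel_gen)
  show "f \<in> space (mborel X) \<rightarrow> mspace Y"
    using assms by (auto simp: continuous_map_def)
  fix U assume "openin (mtop Y) U"
  then have "openin (mtop X) {x \<in> topspace (mtop X). f x \<in> U}"
    using assms unfolding continuous_map_def by blast
  moreover have "{x \<in> topspace (mtop X). f x \<in> U} = f -` U \<inter> space (mborel X)" by auto
  ultimately show "f -` U \<inter> space (mborel X) \<in> sets (mborel X)"
    using openin_sets_mborel by metis
qed

lemma continuous_map_borel_measurable:
  assumes "continuous_map (mtop X) euclidean f" shows "f \<in> borel_measurable (mborel X)"
proof (rule borel_measurableI)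
  fix U :: "'b set" assume "open U"
  then have "openin euclidean U" by (rule iffD1[OF open_openin])
  then have "openin (mtop X) {x \<in> topspace (mtop X). f x \<in> U}"
    by (rule openin_continuous_map_preimage[OF assms])
  moreover have "{x \<in> topspace (mtop X). f x \<in> U} = f -` U \<inter> space (mborel X)" by auto
  ultimately show "f -` U \<inter> space (mborel X) \<in> sets (mborel X)"
    using openin_sets_mborel by metis
qed

text \<open>The target is a type-class metric space, so that closure, \<open>infdist\<close> and
  uniform continuity are available for all the spaces in one common place.\<close>

definition isometric_on :: "'a metric \<Rightarrow> ('a \<Rightarrow> 'w::metric_space) \<Rightarrow> bool" where
  "isometric_on X J \<longleftrightarrow> (\<forall>x\<in>mspace X. \<forall>y\<in>mspace X. dist (J x) (J y) = mdist X x y)"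

lemma isometric_onD: "isometric_on X J \<Longrightarrow> x \<in> mspace X \<Longrightarrow> y \<in> mspace X \<Longrightarrow> dist (J x) (J y) = mdist X x y"
  by (simp add: isometric_on_def)

lemma isometric_on_continuous_map:
  assumes "isometric_on X J" shows "continuous_map (mtop X) euclidean J"
  unfolding continuous_map_def
proof safe
  fix U :: "'b set" assume "openin euclidean U"
  then have U: "open U" by (rule iffD2[OF open_openin])
  show "openin (mtop X) {x \<in> topspace (mtop X). J x \<in> U}"
    unfolding openin_mtop
  proof safe
    fix x assume x: "x \<in> topspace (mtop X)" "J x \<in> U"
    then obtain r where r: "r > 0" "\<And>y. dist y (J x) < r \<Longrightarrow> y \<in> U" using U unfolding open_dist by blast
    have "J y \<in> U" if "y \<in> mspace X" "mdist X x y < r" for y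
      using r(2)[of "J y"] isometric_onD[OF assms, of x y] that x by (simp add: dist_commute)
    then show "\<exists>r>0. \<forall>y\<in>mspace X. mdist X x y < r \<longrightarrow> y \<in> {x \<in> topspace (mtop X). J x \<in> U}"
      using r(1) by auto
  qed simp
qed auto

lemma isometric_on_measurable [measurable (raw)]:
  "isometric_on X J \<Longrightarrow> J \<in> borel_measurable (mborel X)"
  by (intro continuous_map_borel_measurable isometric_on_continuous_map)

lemma mm_sets: "metric_measure_space X m \<Longrightarrow> sets m = sets (mborel X)"
  by (simp add: metric_measure_space_def)

lemma mm_space: "metric_measure_space X m \<Longrightarrow> space m = mspace X"
  using sets_eq_imp_space_eq[OF mm_sets] by simp

lemma mm_separable: "metric_measure_space X m \<Longrightarrow> separable_space (mtop X)"
  by (simp add: metric_measure_space_def complete_separable_def)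

lemma mm_nonempty: "metric_measure_space X m \<Longrightarrow> mspace X \<noteq> {}"
  by (auto simp: metric_measure_space_def)

lemma mm_isometric_measurable:
  "metric_measure_space X m \<Longrightarrow> isometric_on X J \<Longrightarrow> J \<in> borel_measurable m"
  using isometric_on_measurable by (simp add: measurable_cong_sets[OF mm_sets refl])

lemma borel_measurable_dist_const [measurable (raw)]:
  fixes f :: "'c \<Rightarrow> 'w::metric_space"
  assumes "f \<in> borel_measurable M" shows "(\<lambda>x. dist (f x) w) \<in> borel_measurable M"
  by (rule measurable_compose[OF assms]) (intro borel_measurable_continuous_onI continuous_intros)

lemma mm_finite_ball:
  assumes mm: "metric_measure_space X m" and J: "isometric_on X J"
  shows "emeasure m {x \<in> mspace X. dist (J x) w \<le> R} < \<infinity>"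
proof -
  interpret Metric_space "mspace X" "mdist X" by simp
  have [measurable]: "J \<in> borel_measurable m" using mm_isometric_measurable[OF mm J] .
  have "{x \<in> space m. dist (J x) w \<le> R} \<in> sets m" by measurable
  moreover have "mbounded {x \<in> mspace X. dist (J x) w \<le> R}"
    unfolding mbounded_alt
  proof (intro conjI exI ballI)
    fix x y assume "x \<in> {x \<in> mspace X. dist (J x) w \<le> R}" "y \<in> {x \<in> mspace X. dist (J x) w \<le> R}"
    then show "mdist X x y \<le> R + R"
      using isometric_onD[OF J, of x y] dist_triangle2[of "J x" "J y" w] by simp
  qed auto
  ultimately show ?thesis using mm unfolding metric_measure_space_def mm_space[OF mm] by blast
qed

lemma mm_sigma_finite:
  assumes mm: "metric_measure_space X m" shows "sigma_finite_measure m"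
proof
  interpret Metric_space "mspace X" "mdist X" by simp
  obtain x0 where x0: "x0 \<in> mspace X" using mm_nonempty[OF mm] by auto
  define B where "B n = {x \<in> mspace X. mdist X x x0 < real n}" for n
  have B: "B n \<in> sets m" for n
    unfolding B_def mm_sets[OF mm] by (intro openin_sets_mborel openin_dist_less x0)
  moreover have "mbounded (B n)" for n
    unfolding mbounded B_def using x0 by (auto simp: commute intro!: exI[of _ x0] exI[of _ "real n"])
  ultimately have "emeasure m (B n) \<noteq> \<infinity>" for n
    using mm unfolding metric_measure_space_def by (metis less_irrefl)
  moreover have "(\<Union>n. B n) = space m"
    unfolding B_def mm_space[OF mm] using reals_Archimedean2 by auto
  ultimately show "\<exists>A. countable A \<and> A \<subseteq> sets m \<and> \<Union> A = space m \<and> (\<forall>a\<in>A. emeasure m a \<noteq> \<infinity>)"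
    using B by (intro exI[of _ "range B"]) auto
qed

lemma mm_integrable:
  assumes mm: "metric_measure_space X m" and J: "isometric_on X J"
    and f: "f \<in> borel_measurable borel" "\<And>w. \<bar>f w\<bar> \<le> (B::real)" "\<And>w. f w \<noteq> 0 \<Longrightarrow> dist w w0 \<le> R"
  shows "integrable m (\<lambda>x. f (J x))"
proof (rule integrableI_bounded_set)
  note [measurable] = mm_isometric_measurable[OF mm J] f(1)
  show "{x \<in> space m. dist (J x) w0 \<le> R} \<in> sets m" by measurable
  show "(\<lambda>x. f (J x)) \<in> borel_measurable m" by measurable
  show "emeasure m {x \<in> space m. dist (J x) w0 \<le> R} < \<infinity>"
    using mm_finite_ball[OF mm J] by (simp add: mm_space[OF mm])
  show "AE x in m. x \<in> {x \<in> space m. dist (J x) w0 \<le> R} \<longrightarrow> norm (f (J x)) \<le> B"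
    using f(2) by auto
  show "AE x in m. x \<notin> {x \<in> space m. dist (J x) w0 \<le> R} \<longrightarrow> f (J x) = 0"
    by (rule AE_I2) (use f(3) in auto)
qed

text \<open>A point off the support has a null neighbourhood, which contains a null ball around it
  from a fixed countable family; the union of the null balls in that family is null.\<close>

lemma AE_msupport:
  assumes sep: "separable_space (mtop X)" and \<mu>: "sets \<mu> = sets (mborel X)"
  shows "AE x in \<mu>. x \<in> msupport X \<mu>"
proof (cases "mspace X = {}")
  case True
  then have "space \<mu> = {}" using sets_eq_imp_space_eq[OF \<mu>] by simp
  then show ?thesis by (intro AE_I2) auto
next
  case False
  interpret Metric_space "mspace X" "mdist X" by simp
  obtain d where d: "\<And>i. d i \<in> mspace X" "\<And>x e. x \<in> mspace X \<Longrightarrow> e > 0 \<Longrightarrow> \<exists>i::nat. mdist X x (d i) < e"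
    using separable_dense_sequence[OF sep False] by metis
  define B where "B i n = {x\<in>mspace X. mdist X x (d i) < 1 / Suc n}" for i n
  define I where "I = {(i, n). emeasure \<mu> (B i n) = 0}"
  have Bs: "B i n \<in> sets \<mu>" for i n
    unfolding B_def \<mu> by (intro openin_sets_mborel openin_dist_less d)
  have "(\<Union>(i, n)\<in>I. B i n) \<in> null_sets \<mu>"
    by (rule null_sets_UN') (auto simp: I_def Bs intro: countable_subset[OF subset_UNIV])
  then show ?thesis
  proof (rule AE_I', safe)
    fix x assume x: "x \<in> space \<mu>" "x \<notin> msupport X \<mu>"
    then have xX: "x \<in> mspace X" using sets_eq_imp_space_eq[OF \<mu>] by simp
    with x obtain U where U: "openin (mtop X) U" "x \<in> U" "emeasure \<mu> U = 0"
      unfolding msupport_def by (auto simp: not_gr_zero)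
    then obtain r where r: "r > 0" "\<And>y. y \<in> mspace X \<Longrightarrow> mdist X x y < r \<Longrightarrow> y \<in> U"
      unfolding openin_mtop by blast
    obtain n where n: "1 / Suc n < r / 2" using r(1) nat_approx_posE[of "r/2"] by auto
    obtain i where i: "mdist X x (d i) < 1 / Suc n" using d(2)[of x "1 / Suc n"] xX by auto
    have "B i n \<subseteq> U"
    proof
      fix y assume y: "y \<in> B i n"
      have "mdist X x y \<le> mdist X x (d i) + mdist X (d i) y"
        using xX d y by (intro triangle) (auto simp: B_def)
      with y i n r(2)[of y] show "y \<in> U" by (simp add: commute B_def)
    qed
    then have "emeasure \<mu> (B i n) \<le> emeasure \<mu> U"
      using U(1) by (intro emeasure_mono) (auto simp: \<mu> openin_sets_mborel)
    with U(3) have "(i, n) \<in> I" by (simp add: I_def)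
    with xX i show "x \<in> (\<Union>(i, n)\<in>I. B i n)" by (auto simp: B_def)
  qed
qed

text \<open>Measurability is for the product sigma-algebra: by density, the distance is below
  \<open>r\<close> iff the detour through some \<open>d i\<close> is shorter than \<open>r\<close>,
  a countable union of conditions on sums of one-variable functions.\<close>

lemma borel_measurable_mdist:
  assumes sep: "separable_space (mtop X)"
  shows "(\<lambda>(x, y). mdist X x y) \<in> borel_measurable (mborel X \<Otimes>\<^sub>M mborel X)"
proof (cases "mspace X = {}")
  case True
  then show ?thesis by (auto simp: measurable_def space_pair_measure)
next
  case False
  interpret Metric_space "mspace X" "mdist X" by simp
  obtain d where d: "\<And>i. d i \<in> mspace X" "\<And>x e. x \<in> mspace X \<Longrightarrow> e > 0 \<Longrightarrow> \<exists>i::nat. mdist X x (d i) < e"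
    using separable_dense_sequence[OF sep False] by metis
  have [measurable]: "(\<lambda>x. mdist X (d i) x) \<in> borel_measurable (mborel X)" for i
    by (intro continuous_map_borel_measurable) (auto intro!: continuous_map_mdist simp: d)
  show ?thesis
  proof (rule borel_measurableI_less)
    fix r :: real
    have eq: "{p \<in> space (mborel X \<Otimes>\<^sub>M mborel X). (case p of (x, y) \<Rightarrow> mdist X x y) < r}
      = (\<Union>i. {p \<in> space (mborel X \<Otimes>\<^sub>M mborel X). mdist X (d i) (fst p) + mdist X (d i) (snd p) < r})"
    proof safe
      fix x y assume xy: "(x, y) \<in> space (mborel X \<Otimes>\<^sub>M mborel X)" "mdist X x y < r"
      then have X: "x \<in> mspace X" "y \<in> mspace X" by (auto simp: space_pair_measure)
      obtain i where i: "mdist X x (d i) < (r - mdist X x y) / 2"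
        using d(2)[OF X(1), of "(r - mdist X x y) / 2"] xy(2) by auto
      have "mdist X (d i) y \<le> mdist X (d i) x + mdist X x y" using X d by (intro triangle) auto
      with i have "mdist X (d i) x + mdist X (d i) y < r" by (simp add: commute field_simps)
      with xy show "(x, y) \<in> (\<Union>i. {p \<in> space (mborel X \<Otimes>\<^sub>M mborel X). mdist X (d i) (fst p) + mdist X (d i) (snd p) < r})"
        by auto
    next
      fix x y i assume xy: "(x, y) \<in> space (mborel X \<Otimes>\<^sub>M mborel X)" "mdist X (d i) (fst (x, y)) + mdist X (d i) (snd (x, y)) < r"
      then have "mdist X x y \<le> mdist X x (d i) + mdist X (d i) y"
        using d by (intro triangle) (auto simp: space_pair_measure)
      with xy(2) show "mdist X x y < r" by (simp add: commute)
    qed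
    show "{p \<in> space (mborel X \<Otimes>\<^sub>M mborel X). (case p of (x, y) \<Rightarrow> mdist X x y) < r} \<in> sets (mborel X \<Otimes>\<^sub>M mborel X)"
      unfolding eq by measurable
  qed
qed

text \<open>The sets that can be squeezed between closed and open sets form a sigma-algebra, and
  open sets belong to it because they are increasing unions of closed sets in a metric
  space.\<close>

lemma finite_measure_regular:
  assumes fin: "finite_measure \<nu>" and sets: "sets \<nu> = sets (mborel X)"
    and A: "A \<in> sets \<nu>" and e: "e > 0"
  shows "\<exists>F U. closedin (mtop X) F \<and> openin (mtop X) U \<and> F \<subseteq> A \<and> A \<subseteq> U \<and> measure \<nu> (U - F) < e"
proof -
  interpret finite_measure \<nu> by fact
  interpret X: Metric_space "mspace X" "mdist X" by simp
  have sO: "U \<in> sets \<nu>" if "openin (mtop X) U" for U using openin_sets_mborel[OF that] sets by simp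
  have sC: "F \<in> sets \<nu>" if "closedin (mtop X) F" for F using closedin_sets_mborel[OF that] sets by simp
  have "A \<in> sigma_sets (mspace X) {U. openin (mtop X) U}"
    using A sets sets_mborel by metis
  then show ?thesis using e
  proof (induction arbitrary: e rule: sigma_sets.induct)
    case (Basic U)
    then have U: "openin (mtop X) U" by simp
    then have "fsigma_in (mtop X) U"
      using open_imp_fsigma_in X.metrizable_space_mtopology unfolding mtopology_of_def by blast
    then obtain C where C: "\<And>n. closedin (mtop X) (C n)" "\<And>n. C n \<subseteq> C (Suc n)" "\<Union> (range C) = U"
      unfolding fsigma_in_ascending by blast
    have "(\<lambda>n. measure \<nu> (C n)) \<longlonglongrightarrow> measure \<nu> (\<Union> (range C))"
      by (rule finite_Lim_measure_incseq) (use C sC in \<open>auto intro!: incseq_SucI\<close>)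
    then have "\<forall>\<^sub>F n in sequentially. measure \<nu> U - e < measure \<nu> (C n)"
      using Basic(2) unfolding C(3) by (intro order_tendstoD(1)) auto
    then obtain n where "measure \<nu> U - e < measure \<nu> (C n)"
      by (auto simp: eventually_sequentially)
    moreover have "C n \<subseteq> U" using C(3) by auto
    ultimately show ?case
      using U C(1)[of n] finite_measure_Diff[OF sO[OF U] sC[OF C(1)], of n]
      by (intro exI[of _ "C n"] exI[of _ U]) auto
  next
    case Empty
    then show ?case by (intro exI[of _ "{}"]) auto
  next
    case (Compl A)
    obtain F U where FU: "closedin (mtop X) F" "openin (mtop X) U" "F \<subseteq> A" "A \<subseteq> U" "measure \<nu> (U - F) < e"
      using Compl.IH[OF Compl.prems] by metis
    have "(mspace X - F) - (mspace X - U) = U - F"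
      using openin_subset[OF FU(2)] by auto
    moreover have "closedin (mtop X) (mspace X - U)" "openin (mtop X) (mspace X - F)"
      using closedin_diff[OF closedin_topspace FU(2)] openin_diff[OF openin_topspace FU(1)] by simp_all
    moreover have "mspace X - U \<subseteq> mspace X - A" "mspace X - A \<subseteq> mspace X - F"
      using FU(3,4) by auto
    ultimately show ?case using FU(5) by metis
  next
    case (Union A)
    \<comment> \<open>These errors sum to \<open>e / 2\<close>; replacing the countable union of the
      closed sets by a finite one, which is closed, costs another \<open>e / 4\<close>.\<close>
    let ?d = "\<lambda>i::nat. e / 4 * (1/2)^i"
    have "\<exists>F U. closedin (mtop X) F \<and> openin (mtop X) U \<and> F \<subseteq> A i \<and> A i \<subseteq> U \<and> measure \<nu> (U - F) < ?d i" for i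
      by (rule Union.IH) (use Union.prems in auto)
    then obtain F U where FU: "\<And>i. closedin (mtop X) (F i)" "\<And>i. openin (mtop X) (U i)" "\<And>i. F i \<subseteq> A i" "\<And>i. A i \<subseteq> U i"
      "\<And>i. measure \<nu> (U i - F i) < ?d i"
      by metis
    define G where "G n = (\<Union>i<n. F i)" for n
    have G: "closedin (mtop X) (G n)" for n
      unfolding G_def by (intro closedin_Union) (auto simp: FU)
    have UU: "openin (mtop X) (\<Union>i. U i)" using FU by auto
    have "(\<lambda>n. measure \<nu> (G n)) \<longlonglongrightarrow> measure \<nu> (\<Union>n. G n)"
    proof (rule finite_Lim_measure_incseq)
      show "incseq G" unfolding G_def incseq_def by (intro allI impI UN_mono) auto
    qed (use G sC in auto)
    then have "\<forall>\<^sub>F n in sequentially. measure \<nu> (\<Union>n. G n) - e / 4 < measure \<nu> (G n)"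
      using Union.prems by (intro order_tendstoD(1)) auto
    then obtain n where n: "measure \<nu> (\<Union>n. G n) - e / 4 < measure \<nu> (G n)"
      by (auto simp: eventually_sequentially)
    have GU: "(\<Union>n. G n) = (\<Union>i. F i)" by (auto simp: G_def)
    have sF: "(\<Union>i. F i) \<in> sets \<nu>" using sC FU by auto
    have sum: "(\<lambda>i. ?d i) sums (e / 4 * 2)"
      using sums_mult[OF geometric_sums[of "1/2::real"], of "e/4"] by simp
    have "measure \<nu> ((\<Union>i. U i) - (\<Union>i. F i)) \<le> measure \<nu> (\<Union>i. U i - F i)"
      using sO sC FU by (intro finite_measure_mono) auto
    also have "\<dots> \<le> (\<Sum>i. measure \<nu> (U i - F i))"
      using sO sC FU sums_summable[OF sum]
      by (intro finite_measure_subadditive_countably summable_comparison_test'[OF sums_summable[OF sum], of 0])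
         (auto intro: less_imp_le)
    also have "\<dots> \<le> (\<Sum>i. ?d i)"
      using FU(5) by (intro suminf_le summable_comparison_test'[OF sums_summable[OF sum], of 0] sums_summable[OF sum])
         (auto intro: less_imp_le)
    also have "\<dots> = e / 2" using sum by (simp add: sums_iff)
    finally have 1: "measure \<nu> ((\<Union>i. U i) - (\<Union>i. F i)) \<le> e / 2" .
    have "(\<Union>i. U i) - G n = ((\<Union>i. U i) - (\<Union>i. F i)) \<union> ((\<Union>i. F i) - G n)"
      using order_trans[OF FU(3,4)] unfolding G_def by blast
    then have "measure \<nu> ((\<Union>i. U i) - G n) \<le> measure \<nu> ((\<Union>i. U i) - (\<Union>i. F i)) + measure \<nu> ((\<Union>i. F i) - G n)"
      using sO[OF UU] sF sC[OF G] by (auto intro!: measure_Un_le)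
    also have "measure \<nu> ((\<Union>i. F i) - G n) = measure \<nu> (\<Union>i. F i) - measure \<nu> (G n)"
      using sF sC[OF G] by (intro finite_measure_Diff) (auto simp: G_def)
    finally have "measure \<nu> ((\<Union>i. U i) - G n) < e"
      using 1 n Union.prems unfolding GU by simp
    moreover have "G n \<subseteq> (\<Union>i. A i)" "(\<Union>i. A i) \<subseteq> (\<Union>i. U i)"
      unfolding G_def using FU(3,4) by blast+
    ultimately show ?case
      using G[of n] UU by (intro exI[of _ "G n"] exI[of _ "\<Union>i. U i"]) simp
  qed
qed

section \<open>Comparison of measures through test functions\<close>

lemma uniformly_continuous_on_infdist_bump:
  fixes S :: "'w::metric_space set"
  assumes "N > (0::real)"
  shows "uniformly_continuous_on UNIV (\<lambda>w. max 0 (1 - N * infdist w S))"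
proof -
  have "N-lipschitz_on UNIV (\<lambda>w. max 0 (1 - N * infdist w S))"
  proof (rule lipschitz_onI)
    fix u v :: 'w
    have "dist (max 0 (1 - N * infdist u S)) (max 0 (1 - N * infdist v S)) \<le> \<bar>N * (infdist u S - infdist v S)\<bar>"
      unfolding dist_real_def by (simp add: algebra_simps max_def abs_real_def)
    also have "\<dots> = N * \<bar>infdist u S - infdist v S\<bar>"
      using assms by (simp add: abs_mult)
    also have "\<dots> \<le> N * dist u v"
      using assms by (intro mult_left_mono infdist_triangle_abs) simp
    finally show "dist (max 0 (1 - N * infdist u S)) (max 0 (1 - N * infdist v S)) \<le> N * dist u v" .
  qed (use assms in simp)
  then show ?thesis by (rule lipschitz_on_uniformly_continuous)
qed

lemma bounded_infdist_bump:
  assumes "N > (0::real)" "bounded S" "S \<noteq> {}"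
  shows "bounded {w. max 0 (1 - N * infdist w S) \<noteq> 0}"
proof -
  obtain a R where R: "\<And>y. y \<in> S \<Longrightarrow> dist a y \<le> R" using assms(2) unfolding bounded_def by blast
  have "dist a w \<le> R + 1/N" if "max 0 (1 - N * infdist w S) \<noteq> 0" for w
  proof -
    have "infdist w S < 1 / N" using that assms(1) by (simp add: max_def field_simps split: if_splits)
    then obtain y where "y \<in> S" "dist w y < 1 / N"
      using assms(3) by (auto simp: infdist_def cINF_less_iff split: if_splits)
    then show ?thesis using R[of y] dist_triangle[of a w y] by (simp add: dist_commute)
  qed
  then show ?thesis unfolding bounded_def by blast
qed

text \<open>Bounded support puts these functions within reach of the assumed convergence of the
  reference measures; uniform continuity controls their oscillation on cells of a given
  size.\<close>

definition test_function :: "('w::metric_space \<Rightarrow> real) \<Rightarrow> bool" where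
  "test_function \<phi> \<longleftrightarrow> (\<forall>w. 0 \<le> \<phi> w \<and> \<phi> w \<le> 1) \<and> uniformly_continuous_on UNIV \<phi> \<and> bounded {w. \<phi> w \<noteq> 0}"

lemma test_functionD:
  assumes "test_function \<phi>"
  shows "0 \<le> \<phi> w" "\<phi> w \<le> 1" "\<bar>\<phi> w\<bar> \<le> 1" "uniformly_continuous_on UNIV \<phi>" "continuous_on UNIV \<phi>"
    "\<phi> \<in> borel_measurable borel" "bounded {w. \<phi> w \<noteq> 0}"
  using assms unfolding test_function_def
  by (auto intro: uniformly_continuous_imp_continuous borel_measurable_continuous_onI simp: abs_le_iff)

lemma mm_integrable_test_function:
  assumes "metric_measure_space X m" "isometric_on X J" "test_function \<phi>"
  shows "integrable m (\<lambda>x. \<phi> (J x))"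
proof -
  obtain a R where "\<And>w. \<phi> w \<noteq> 0 \<Longrightarrow> dist a w \<le> R"
    using test_functionD(7)[OF assms(3)] unfolding bounded_def by blast
  then show ?thesis
    using mm_integrable[OF assms(1,2) test_functionD(6)[OF assms(3)] test_functionD(3)[OF assms(3)], of a R]
    by (simp add: dist_commute)
qed

text \<open>Bumps give the inequality on bounded closed sets by dominated convergence, exhaustion by
  balls extends it to closed sets, and regularity of \<open>\<nu>\<close> to all Borel sets. It
  serves both for the density bound and, with \<open>c = 1\<close>, for identifying the end
  marginals.\<close>

lemma emeasure_le_of_test_functions:
  fixes J :: "'a \<Rightarrow> 'w::metric_space"
  assumes mm: "metric_measure_space X m" and J: "isometric_on X J"
    and fin: "finite_measure \<nu>" and sets: "sets \<nu> = sets (mborel X)" and c: "c \<ge> 0"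
    and test: "\<And>\<phi>. test_function \<phi> \<Longrightarrow> (\<integral>x. \<phi> (J x) \<partial>\<nu>) \<le> c * (\<integral>x. \<phi> (J x) \<partial>m)"
    and A: "A \<in> sets \<nu>"
  shows "emeasure \<nu> A \<le> ennreal c * emeasure m A"
proof -
  interpret finite_measure \<nu> by fact
  interpret X: Metric_space "mspace X" "mdist X" by simp
  have sp: "space \<nu> = mspace X" using sets_eq_imp_space_eq[OF sets] by simp
  have Jm: "J \<in> borel_measurable m" "J \<in> borel_measurable \<nu>"
    using mm_isometric_measurable[OF mm J] isometric_on_measurable[OF J]
    by (auto simp: measurable_cong_sets[OF sets refl])
  obtain x0 where x0: "x0 \<in> mspace X" using mm_nonempty[OF mm] by auto
  have bounded_closed: "emeasure \<nu> F \<le> ennreal c * emeasure m F"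
    if F: "closedin (mtop X) F" "F \<subseteq> {x \<in> mspace X. dist (J x) (J x0) \<le> R}" for F R
  proof (cases "F = {}")
    case False
    have Fs: "F \<in> sets \<nu>" "F \<in> sets m" using closedin_sets_mborel[OF F(1)] sets mm_sets[OF mm] by auto
    have Fsub: "F \<subseteq> mspace X" using F(2) by auto
    have Fm: "emeasure m F < \<infinity>"
    proof (rule le_less_trans[OF emeasure_mono[OF F(2)] mm_finite_ball[OF mm J]])
      have "{x \<in> space m. dist (J x) (J x0) \<le> R} \<in> sets m" using Jm(1) by measurable
      then show "{x \<in> mspace X. dist (J x) (J x0) \<le> R} \<in> sets m" by (simp add: mm_space[OF mm])
    qed
    \<comment> \<open>Bumps of growing slope decrease to the indicator of \<open>F\<close>, and
      \<open>\<phi> 0\<close> dominates them all.\<close>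
    define \<phi> where "\<phi> n w = max 0 (1 - real (Suc n) * infdist w (J ` F))" for n w
    have bF: "bounded (J ` F)" using F(2) unfolding bounded_def by (intro exI[of _ "J x0"] exI[of _ R]) (auto simp: dist_commute)
    have tf: "test_function (\<phi> n)" for n
      unfolding test_function_def \<phi>_def
      using uniformly_continuous_on_infdist_bump[of "real (Suc n)" "J ` F"] bounded_infdist_bump[of "real (Suc n)" "J ` F"] bF False
      by (auto simp: infdist_nonneg)
    have lim: "(\<lambda>n. \<phi> n (J x)) \<longlonglongrightarrow> indicat_real F x" if x: "x \<in> mspace X" for x
    proof (cases "x \<in> F")
      case True
      then show ?thesis by (simp add: \<phi>_def)
    next
      case False
      have "openin (mtop X) (mspace X - F)" using F(1) by (simp add: closedin_def)
      then obtain r where r: "r > 0" "\<And>y. y \<in> mspace X \<Longrightarrow> mdist X x y < r \<Longrightarrow> y \<notin> F"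
        unfolding openin_mtop using x False by blast
      have "r \<le> dist (J x) (J y)" if "y \<in> F" for y
        using r(2)[of y] that Fsub x isometric_onD[OF J x, of y] by fastforce
      then have "infdist (J x) (J ` F) \<ge> r"
        using \<open>F \<noteq> {}\<close> by (auto simp: infdist_def intro!: cINF_greatest)
      then have "\<forall>\<^sub>F n in sequentially. \<phi> n (J x) = 0"
      proof -
        obtain n0 where n0: "real n0 > 1 / r" using reals_Archimedean2 by blast
        have "\<phi> n (J x) = 0" if "n \<ge> n0" for n
        proof -
          have "1 < real n0 * r" using n0 r(1) by (simp add: field_simps)
          also have "\<dots> \<le> real (Suc n) * infdist (J x) (J ` F)"
            using that r(1) \<open>infdist (J x) (J ` F) \<ge> r\<close> by (intro mult_mono) auto
          finally show ?thesis by (simp add: \<phi>_def)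
        qed
        then show ?thesis by (auto simp: eventually_sequentially)
      qed
      then show ?thesis using False by (simp add: tendsto_eventually)
    qed
    have le0: "\<phi> n (J x) \<le> \<phi> 0 (J x)" for n x
      unfolding \<phi>_def
      by (intro max.mono diff_left_mono mult_right_mono infdist_nonneg) auto
    have lim\<nu>: "(\<lambda>n. \<integral>x. \<phi> n (J x) \<partial>\<nu>) \<longlonglongrightarrow> (\<integral>x. indicat_real F x \<partial>\<nu>)"
    proof (rule integral_dominated_convergence[where M=\<nu> and f="indicat_real F" and w="\<lambda>_. 1" and s="\<lambda>n x. \<phi> n (J x)"])
      show "(\<lambda>x. \<phi> n (J x)) \<in> borel_measurable \<nu>" for n
        by (rule measurable_compose[OF Jm(2) test_functionD(6)[OF tf]])
      show "AE x in \<nu>. (\<lambda>n. \<phi> n (J x)) \<longlonglongrightarrow> indicat_real F x"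
        by (rule AE_I2) (simp add: lim sp)
      show "AE x in \<nu>. norm (\<phi> n (J x)) \<le> 1" for n
        by (rule AE_I2) (simp add: test_functionD(3)[OF tf])
    qed (use Fs in simp_all)
    have limm: "(\<lambda>n. \<integral>x. \<phi> n (J x) \<partial>m) \<longlonglongrightarrow> (\<integral>x. indicat_real F x \<partial>m)"
    proof (rule integral_dominated_convergence[where M=m and f="indicat_real F" and w="\<lambda>x. \<phi> 0 (J x)" and s="\<lambda>n x. \<phi> n (J x)"])
      show "(\<lambda>x. \<phi> n (J x)) \<in> borel_measurable m" for n
        by (rule measurable_compose[OF Jm(1) test_functionD(6)[OF tf]])
      show "integrable m (\<lambda>x. \<phi> 0 (J x))" by (rule mm_integrable_test_function[OF mm J tf])
      show "AE x in m. (\<lambda>n. \<phi> n (J x)) \<longlonglongrightarrow> indicat_real F x"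
        by (rule AE_I2) (simp add: lim mm_space[OF mm])
      show "AE x in m. norm (\<phi> n (J x)) \<le> \<phi> 0 (J x)" for n
        by (rule AE_I2) (simp add: le0 test_functionD(1)[OF tf])
    qed (use Fs in simp_all)
    have "(\<integral>x. indicat_real F x \<partial>\<nu>) \<le> c * (\<integral>x. indicat_real F x \<partial>m)"
      by (rule LIMSEQ_le[OF lim\<nu> tendsto_mult_left[OF limm]]) (use test[OF tf] in auto)
    then have "measure \<nu> F \<le> c * measure m F" using Fs sets.sets_into_space[of F] by (simp add: Int_absorb2)
    then have "ennreal (measure \<nu> F) \<le> ennreal c * ennreal (measure m F)"
      using c by (simp add: ennreal_mult[symmetric] ennreal_leI)
    then show ?thesis
      using Fm by (simp add: emeasure_eq_measure emeasure_eq_ennreal_measure)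
  qed simp
  have closed: "emeasure \<nu> F \<le> ennreal c * emeasure m F" if F: "closedin (mtop X) F" for F
  proof -
    define B where "B n = {x \<in> mspace X. dist (J x) (J x0) \<le> real n}" for n
    have cB: "closedin (mtop X) (B n)" for n
    proof -
      have "B n = mcball_of X x0 (real n)"
        using x0 isometric_onD[OF J x0] isometric_onD[OF J _ x0] by (auto simp: B_def X.commute)
      then show ?thesis by (simp add: mtopology_of_def mcball_of_def)
    qed
    have cFB: "closedin (mtop X) (F \<inter> B n)" for n using F cB by (rule closedin_Int)
    have Fs: "F \<in> sets m" using closedin_sets_mborel[OF F] mm_sets[OF mm] by auto
    have FBs: "F \<inter> B n \<in> sets \<nu>" for n using closedin_sets_mborel[OF cFB] sets by simp
    have "(\<lambda>n. emeasure \<nu> (F \<inter> B n)) \<longlonglongrightarrow> emeasure \<nu> (\<Union>n. F \<inter> B n)"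
      using FBs by (intro Lim_emeasure_incseq) (auto simp: B_def incseq_def)
    moreover have "(\<Union>n. F \<inter> B n) = F"
    proof -
      have "\<exists>n. x \<in> B n" if "x \<in> F" for x
        using closedin_subset[OF F] that real_arch_simple[of "dist (J x) (J x0)"]
        unfolding B_def topspace_mtopology_of by blast
      then show ?thesis by blast
    qed
    ultimately have lim: "(\<lambda>n. emeasure \<nu> (F \<inter> B n)) \<longlonglongrightarrow> emeasure \<nu> F" by (simp only:)
    show ?thesis
    proof (rule LIMSEQ_le_const2[OF lim])
      have "emeasure \<nu> (F \<inter> B n) \<le> ennreal c * emeasure m (F \<inter> B n)" for n
        by (rule bounded_closed[OF cFB, of n "real n"]) (auto simp: B_def)
      also have "ennreal c * emeasure m (F \<inter> B n) \<le> ennreal c * emeasure m F" for n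
        using Fs by (intro mult_left_mono emeasure_mono) auto
      finally show "\<exists>N. \<forall>n\<ge>N. emeasure \<nu> (F \<inter> B n) \<le> ennreal c * emeasure m F" by auto
    qed
  qed
  show ?thesis
  proof (rule ennreal_le_epsilon)
    fix e :: real assume e: "e > 0"
    \<comment> \<open>Only the inner approximation matters: \<open>\<nu>\<close> loses less than
      \<open>e\<close> in passing from \<open>A\<close> to its closed subset
      \<open>F\<close>.\<close>
    obtain F U where FU: "closedin (mtop X) F" "openin (mtop X) U" "F \<subseteq> A" "A \<subseteq> U" "measure \<nu> (U - F) < e"
      using finite_measure_regular[OF fin sets A e] by blast
    have Fs: "F \<in> sets \<nu>" "U \<in> sets \<nu>"
      using closedin_sets_mborel[OF FU(1)] openin_sets_mborel[OF FU(2)] sets by auto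
    have "measure \<nu> A \<le> measure \<nu> (F \<union> (U - F))"
      using Fs FU by (intro finite_measure_mono) auto
    also have "\<dots> \<le> measure \<nu> F + measure \<nu> (U - F)"
      using Fs by (intro measure_Un_le) auto
    also have "\<dots> \<le> measure \<nu> F + e" using FU(5) by simp
    finally have "emeasure \<nu> A \<le> emeasure \<nu> F + ennreal e"
      using e by (simp add: emeasure_eq_measure ennreal_plus[symmetric] del: ennreal_plus)
    also have "emeasure \<nu> F \<le> ennreal c * emeasure m F" by (rule closed[OF FU(1)])
    also have "\<dots> \<le> ennreal c * emeasure m A"
      using A FU(3) by (intro mult_left_mono emeasure_mono) (auto simp: mm_sets[OF mm] sets)
    finally show "emeasure \<nu> A \<le> ennreal c * emeasure m A + ennreal e" by simp
  qed
qed

section \<open>The space of geodesics\<close>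

text \<open>Continuity and boundedness, which membership in \<open>cfunspace\<close> demands, follow
  from the constant-speed identity, since it makes the curve Lipschitz.\<close>

lemma mspace_Geo:
  "\<gamma> \<in> mspace (Geo X) \<longleftrightarrow> \<gamma> \<in> extensional {0..1} \<and> \<gamma> \<in> {0..1} \<rightarrow> mspace X \<and>
     (\<forall>s\<in>{0..1}. \<forall>t\<in>{0..1}. mdist X (\<gamma> s) (\<gamma> t) = \<bar>s - t\<bar> * mdist X (\<gamma> 0) (\<gamma> 1))"
  (is "_ \<longleftrightarrow> ?R")
proof
  assume R: ?R
  interpret Metric_space "mspace X" "mdist X" by simp
  have rng: "\<gamma> t \<in> mspace X" if "t \<in> {0..1}" for t using R that by blast
  define L where "L = mdist X (\<gamma> 0) (\<gamma> 1)"
  have geo: "mdist X (\<gamma> s) (\<gamma> t) = \<bar>s - t\<bar> * L" if "s \<in> {0..1}" "t \<in> {0..1}" for s t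
    using R that unfolding L_def by blast
  have "Lipschitz_continuous_map (submetric euclidean_metric {0..1}) X \<gamma>"
    unfolding Lipschitz_continuous_map_def
    using rng by (auto simp: dist_real_def geo intro!: exI[of _ L])
  then have "continuous_map (top_of_set {0..1}) (mtop X) \<gamma>"
    using Lipschitz_continuous_imp_continuous_map by (fastforce simp: mtopology_of_submetric)
  moreover have "mbounded (\<gamma> ` {0..1})"
    unfolding mbounded_alt
  proof (intro conjI exI ballI)
    fix x y assume "x \<in> \<gamma> ` {0..1}" "y \<in> \<gamma> ` {0..1}"
    then obtain s t where st: "s \<in> {0..1}" "t \<in> {0..1}" "x = \<gamma> s" "y = \<gamma> t" by blast
    have "\<bar>s - t\<bar> * L \<le> 1 * L"
      using st by (intro mult_right_mono) (auto simp: L_def)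
    then show "mdist X x y \<le> L" using st geo by simp
  qed (use rng in blast)
  moreover have "\<forall>s\<in>{0..1}. \<forall>t\<in>{0..1}. mdist X (\<gamma> s) (\<gamma> t) = \<bar>s - t\<bar> * mdist X (\<gamma> 0) (\<gamma> 1)"
    using R by blast
  moreover have "\<gamma> \<in> extensional {0..1}" "\<gamma> \<in> {0..1} \<rightarrow> mspace X"
    using R by blast+
  ultimately show "\<gamma> \<in> mspace (Geo X)"
    unfolding Geo_def mspace_submetric mspace_cfunspace topspace_euclidean_subtopology Int_iff mem_Collect_eq by blast
next
  assume "\<gamma> \<in> mspace (Geo X)"
  then show ?R
    unfolding Geo_def mspace_submetric mspace_cfunspace topspace_euclidean_subtopology Int_iff mem_Collect_eq by blast
qed

lemma Geo_in_mspace: "\<gamma> \<in> mspace (Geo X) \<Longrightarrow> t \<in> {0..1} \<Longrightarrow> \<gamma> t \<in> mspace X"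
  unfolding mspace_Geo by (elim conjE) (rule funcset_mem)

lemma mdist_Geo_le:
  assumes "\<gamma> \<in> mspace (Geo X)" "\<eta> \<in> mspace (Geo X)"
  shows "mdist (Geo X) \<gamma> \<eta> \<le> a \<longleftrightarrow> (\<forall>t\<in>{0..1}. mdist X (\<gamma> t) (\<eta> t) \<le> a)"
proof -
  have "\<gamma> \<in> mspace (cfunspace (top_of_set {0..1}) X)" "\<eta> \<in> mspace (cfunspace (top_of_set {0..1}) X)"
    using assms unfolding Geo_def mspace_submetric by blast+
  from cfunspace_mdist_le[OF this, of a] show ?thesis
    unfolding Geo_def mdist_submetric by simp
qed

lemma Geo_eval_measurable:
  assumes "t \<in> {0..1}" shows "(\<lambda>\<gamma>. \<gamma> t) \<in> mborel (Geo X) \<rightarrow>\<^sub>M mborel X"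
proof (intro continuous_map_measurable_mborel Lipschitz_continuous_imp_continuous_map)
  show "Lipschitz_continuous_map (Geo X) X (\<lambda>\<gamma>. \<gamma> t)"
    unfolding Lipschitz_continuous_map_def
  proof (intro conjI exI ballI)
    show "(\<lambda>\<gamma>. \<gamma> t) \<in> mspace (Geo X) \<rightarrow> mspace X" using assms by (auto intro: Geo_in_mspace)
    fix \<gamma> \<eta> assume "\<gamma> \<in> mspace (Geo X)" "\<eta> \<in> mspace (Geo X)"
    from mdist_Geo_le[OF this, of "mdist (Geo X) \<gamma> \<eta>"] assms
    show "mdist X (\<gamma> t) (\<eta> t) \<le> 1 * mdist (Geo X) \<gamma> \<eta>" by simp
  qed
qed

text \<open>Between nodes both curves move by at most their length over \<open>N\<close>. Closeness
  at the two ends bounds the length of \<open>\<eta>\<close> by that of \<open>\<gamma>\<close> plus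
  \<open>4 / N \<le> 4\<close>; with L the length of \<open>\<gamma>\<close> the total is (L + 2 + L
  + 4) / N.\<close>

lemma mdist_Geo_nodes:
  assumes \<gamma>: "\<gamma> \<in> mspace (Geo X)" and \<eta>: "\<eta> \<in> mspace (Geo X)" and N: "N > 0"
    and nodes: "\<And>a. a \<le> N \<Longrightarrow> mdist X (\<gamma> (real a / real N)) (\<eta> (real a / real N)) \<le> 2 / N"
  shows "mdist (Geo X) \<gamma> \<eta> \<le> (2 * mdist X (\<gamma> 0) (\<gamma> 1) + 6) / N"
  unfolding mdist_Geo_le[OF \<gamma> \<eta>]
proof
  interpret Metric_space "mspace X" "mdist X" by simp
  have in\<gamma>: "\<gamma> t \<in> mspace X" and in\<eta>: "\<eta> t \<in> mspace X" if "t \<in> {0..1}" for t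
    using \<gamma> \<eta> that by (auto intro: Geo_in_mspace)
  have g: "mdist X (\<gamma> s) (\<gamma> t) = \<bar>s - t\<bar> * mdist X (\<gamma> 0) (\<gamma> 1)"
      "mdist X (\<eta> s) (\<eta> t) = \<bar>s - t\<bar> * mdist X (\<eta> 0) (\<eta> 1)" if "s \<in> {0..1}" "t \<in> {0..1}" for s t
    using \<gamma> \<eta> that unfolding mspace_Geo by blast+
  have "mdist X (\<eta> 0) (\<eta> 1) \<le> mdist X (\<eta> 0) (\<gamma> 0) + mdist X (\<gamma> 0) (\<eta> 1)"
    using in\<gamma> in\<eta> by (intro triangle) auto
  also have "mdist X (\<gamma> 0) (\<eta> 1) \<le> mdist X (\<gamma> 0) (\<gamma> 1) + mdist X (\<gamma> 1) (\<eta> 1)"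
    using in\<gamma> in\<eta> by (intro triangle) auto
  finally have "mdist X (\<eta> 0) (\<eta> 1) \<le> mdist X (\<gamma> 0) (\<gamma> 1) + 4 / N"
    using nodes[of 0] nodes[of N] N by (simp add: commute)
  also have "4 / real N \<le> 4" using N by (simp add: field_simps)
  finally have L: "mdist X (\<eta> 0) (\<eta> 1) \<le> mdist X (\<gamma> 0) (\<gamma> 1) + 4" by simp
  fix t :: real assume t: "t \<in> {0..1}"
  \<comment> \<open>The last node not after \<open>t\<close>, at distance at most
    \<open>1 / N\<close> from it.\<close>
  define a where "a = nat \<lfloor>t * N\<rfloor>"
  have a: "real a \<le> t * N" "t * N < real a + 1"
    using t N by (auto simp: a_def)
  have "t * N \<le> 1 * real N" using t by (intro mult_right_mono) auto
  with a have aN: "a \<le> N" by linarith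
  have at: "real a / N \<in> {0..1}" using aN N by simp
  have ta: "\<bar>t - real a / N\<bar> \<le> 1 / N"
  proof -
    have "t - real a / N = (t * N - real a) / N" using N by (simp add: field_simps)
    also have "\<bar>\<dots>\<bar> \<le> 1 / N" using a by (simp add: abs_divide divide_right_mono)
    finally show ?thesis .
  qed
  have "mdist X (\<gamma> t) (\<eta> t) \<le> mdist X (\<gamma> t) (\<gamma> (real a / N)) + mdist X (\<gamma> (real a / N)) (\<eta> t)"
    using in\<gamma> in\<eta> t at by (intro triangle) auto
  also have "mdist X (\<gamma> (real a / N)) (\<eta> t) \<le> mdist X (\<gamma> (real a / N)) (\<eta> (real a / N)) + mdist X (\<eta> (real a / N)) (\<eta> t)"
    using in\<gamma> in\<eta> t at by (intro triangle) auto
  also have "mdist X (\<eta> (real a / N)) (\<eta> t) \<le> 1 / N * (mdist X (\<gamma> 0) (\<gamma> 1) + 4)"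
    unfolding g[OF at t] using ta L by (intro mult_mono) auto
  also have "mdist X (\<gamma> t) (\<gamma> (real a / N)) \<le> 1 / N * mdist X (\<gamma> 0) (\<gamma> 1)"
    unfolding g(1)[OF t at] using ta by (intro mult_right_mono) auto
  also have "mdist X (\<gamma> (real a / N)) (\<eta> (real a / N)) \<le> 2 / N" by (rule nodes[OF aN])
  finally show "mdist X (\<gamma> t) (\<eta> t) \<le> (2 * mdist X (\<gamma> 0) (\<gamma> 1) + 6) / N"
    using N by (simp add: field_simps)
qed

text \<open>Borel sets for the uniform distance are generated by evaluations: finitely many nodes
  control that distance between geodesics, so an open set is a countable union of finite conditions
  on evaluations.\<close>

lemma measurable_into_Geo:
  assumes sep: "separable_space (mtop X)" and f: "f \<in> space M \<rightarrow> mspace (Geo X)"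
    and meas: "\<And>t. t \<in> {0..1} \<Longrightarrow> (\<lambda>\<omega>. f \<omega> t) \<in> M \<rightarrow>\<^sub>M mborel X"
  shows "f \<in> M \<rightarrow>\<^sub>M mborel (Geo X)"
proof (cases "mspace X = {}")
  case True
  then have "mspace (Geo X) = {}" using Geo_in_mspace[of _ X 0] by fastforce
  with f have "space M = {}" by auto
  then show ?thesis by (auto simp: measurable_def)
next
  case False
  interpret Metric_space "mspace X" "mdist X" by simp
  obtain d where d: "\<And>i. d i \<in> mspace X" "\<And>x e. x \<in> mspace X \<Longrightarrow> e > 0 \<Longrightarrow> \<exists>i::nat. mdist X x (d i) < e"
    using separable_dense_sequence[OF sep False] by metis
  \<comment> \<open>The list \<open>l\<close> names, for each of the \<open>N + 1\<close> nodes, a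
    point of the dense sequence that the curve must approach there.\<close>
  define near where "near N l \<eta> \<longleftrightarrow> (\<forall>a\<in>{..N}. mdist X (\<eta> (real a / real N)) (d (l ! a)) < 1 / N)"
    for N and l :: "nat list" and \<eta>
  show ?thesis
  proof (rule measurable_into_mborel_gen[OF f])
    fix U assume U: "openin (mtop (Geo X)) U"
    define I where "I = {(N, l). N > 0 \<and> (\<forall>\<eta>\<in>mspace (Geo X). near N l \<eta> \<longrightarrow> \<eta> \<in> U)}"
    have node: "real a / real N \<in> {0..1}" if "a \<le> N" for a N using that by (auto simp: divide_le_eq_1)
    have eq: "f -` U \<inter> space M = (\<Union>(N, l)\<in>I. {\<omega>\<in>space M. near N l (f \<omega>)})"
    proof safe
      fix \<omega> assume w: "\<omega> \<in> space M" "f \<omega> \<in> U"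
      let ?\<gamma> = "f \<omega>"
      have G: "?\<gamma> \<in> mspace (Geo X)" using w f by auto
      obtain r where r: "r > 0" "\<And>\<eta>. \<eta> \<in> mspace (Geo X) \<Longrightarrow> mdist (Geo X) ?\<gamma> \<eta> < r \<Longrightarrow> \<eta> \<in> U"
        using U w unfolding openin_mtop by blast
      \<comment> \<open>This makes the bound of \<open>mdist_Geo_nodes\<close>, applied with node
        distance \<open>2 / N\<close> through a common dense point, smaller than
        \<open>r\<close>.\<close>
      obtain N where N: "(2 * mdist X (?\<gamma> 0) (?\<gamma> 1) + 6) / r < real N" using reals_Archimedean2 by blast
      have "0 \<le> (2 * mdist X (?\<gamma> 0) (?\<gamma> 1) + 6) / r" using r by simp
      with N have N0: "N > 0" by linarith
      have Nr: "(2 * mdist X (?\<gamma> 0) (?\<gamma> 1) + 6) / N < r"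
        using N N0 r by (simp add: field_simps)
      have "\<forall>a. \<exists>i. a \<le> N \<longrightarrow> mdist X (?\<gamma> (real a / real N)) (d i) < 1 / N"
      proof
        fix a show "\<exists>i. a \<le> N \<longrightarrow> mdist X (?\<gamma> (real a / real N)) (d i) < 1 / N"
        proof (cases "a \<le> N")
          case True
          then have "?\<gamma> (real a / real N) \<in> mspace X" by (intro Geo_in_mspace[OF G] node)
          then show ?thesis using d(2)[of _ "1 / N"] N0 by auto
        qed simp
      qed
      then obtain i where i: "\<And>a. a \<le> N \<Longrightarrow> mdist X (?\<gamma> (real a / real N)) (d (i a)) < 1 / N" by metis
      define l where "l = map i [0..<Suc N]"
      have l: "l ! a = i a" if "a \<le> N" for a using that by (simp add: l_def del: upt_Suc)
      have near: "near N l ?\<gamma>" using i l by (simp add: near_def)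
      moreover have "(N, l) \<in> I"
        unfolding I_def
      proof (clarify, intro conjI N0 ballI impI)
        fix \<eta> assume \<eta>: "\<eta> \<in> mspace (Geo X)" "near N l \<eta>"
        have "mdist X (?\<gamma> (real a / real N)) (\<eta> (real a / real N)) \<le> 2 / N" if "a \<le> N" for a
        proof -
          have "mdist X (?\<gamma> (real a / real N)) (\<eta> (real a / real N)) \<le> mdist X (?\<gamma> (real a / real N)) (d (l ! a)) + mdist X (d (l ! a)) (\<eta> (real a / real N))"
            by (intro triangle Geo_in_mspace[OF G] Geo_in_mspace[OF \<eta>(1)] node[OF that] d)
          also have "mdist X (d (l ! a)) (\<eta> (real a / real N)) < 1 / N"
            using \<eta>(2) that by (simp add: near_def commute)
          also have "mdist X (?\<gamma> (real a / real N)) (d (l ! a)) < 1 / N"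
            using near that by (simp add: near_def)
          finally show ?thesis by simp
        qed
        then have "mdist (Geo X) ?\<gamma> \<eta> < r"
          by (rule le_less_trans[OF mdist_Geo_nodes[OF G \<eta>(1) N0] Nr])
        then show "\<eta> \<in> U" by (rule r(2)[OF \<eta>(1)])
      qed
      ultimately show "\<omega> \<in> (\<Union>(N, l)\<in>I. {\<omega>\<in>space M. near N l (f \<omega>)})" using w by auto
    qed (use f in \<open>auto simp: I_def\<close>)
    have "{\<omega>\<in>space M. near N l (f \<omega>)} \<in> sets M" for N l
    proof -
      have m: "(\<lambda>\<omega>. mdist X (f \<omega> (real a / real N)) (d (l ! a))) \<in> borel_measurable M" if "a \<in> {..N}" for a
      proof (rule measurable_compose[OF meas])
        show "real a / real N \<in> {0..1}" using node that by simp
        show "(\<lambda>x. mdist X x (d (l ! a))) \<in> borel_measurable (mborel X)"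
          by (intro continuous_map_borel_measurable) (auto intro!: continuous_map_mdist simp: d)
      qed
      have "{\<omega>\<in>space M. \<forall>a\<in>{..N}. mdist X (f \<omega> (real a / real N)) (d (l ! a)) < 1 / N} \<in> sets M"
      proof (rule sets.sets_Collect_finite_All)
        fix a assume "a \<in> {..N}"
        note [measurable] = m[OF this]
        show "{\<omega>\<in>space M. mdist X (f \<omega> (real a / real N)) (d (l ! a)) < 1 / N} \<in> sets M" by measurable
      qed simp
      then show ?thesis by (simp only: near_def)
    qed
    then show "f -` U \<inter> space M \<in> sets M"
      unfolding eq by (intro sets.countable_UN') (auto intro: countable_subset[OF subset_UNIV])
  qed
qed

section \<open>Partitions of unity and discretised densities\<close>

definition bump :: "real \<Rightarrow> 'w::metric_space \<Rightarrow> 'w \<Rightarrow> real" where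
  "bump \<delta> c w = max 0 (min 1 (2 - dist w c / \<delta>))"

lemma bump_bounds: "0 \<le> bump \<delta> c w" "bump \<delta> c w \<le> 1"
  by (auto simp: bump_def)

lemma bump_eq_1: "\<delta> > 0 \<Longrightarrow> dist w c \<le> \<delta> \<Longrightarrow> bump \<delta> c w = 1"
  by (simp add: bump_def field_simps)

lemma bump_nonzeroD: "\<delta> > 0 \<Longrightarrow> bump \<delta> c w \<noteq> 0 \<Longrightarrow> dist w c < 2 * \<delta>"
  by (auto simp: bump_def max_def min_def field_simps split: if_splits)

lemma continuous_on_bump: "\<delta> > 0 \<Longrightarrow> continuous_on UNIV (bump \<delta> c)"
  unfolding bump_def by (intro continuous_intros) auto

text \<open>Stick breaking: what the first \<open>l\<close> bumps leave over of the constant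
  1.\<close>

definition rest :: "real \<Rightarrow> (nat \<Rightarrow> 'w::metric_space) \<Rightarrow> nat \<Rightarrow> 'w \<Rightarrow> real" where
  "rest \<delta> p l w = (\<Prod>j<l. 1 - bump \<delta> (p j) w)"

text \<open>A continuous partition of \<open>\<theta>\<close>: for \<open>l < L\<close> the \<open>l\<close>-th cell lives near \<open>p l\<close>, and the cell with index \<open>L\<close> collects
  the remainder.\<close>
definition cell :: "('w::metric_space \<Rightarrow> real) \<Rightarrow> real \<Rightarrow> (nat \<Rightarrow> 'w) \<Rightarrow> nat \<Rightarrow> nat \<Rightarrow> 'w \<Rightarrow> real" where
  "cell \<theta> \<delta> p L l w = \<theta> w * (rest \<delta> p l w * (if l < L then bump \<delta> (p l) w else 1))"

lemma rest_bounds: "0 \<le> rest \<delta> p l w" "rest \<delta> p l w \<le> 1"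
  unfolding rest_def using bump_bounds by (auto intro!: prod_nonneg prod_le_1)

lemma rest_nonzeroD: "\<delta> > 0 \<Longrightarrow> rest \<delta> p l w \<noteq> 0 \<Longrightarrow> i < l \<Longrightarrow> \<delta> < dist w (p i)"
  using bump_eq_1[of \<delta> w "p i"] by (force simp: rest_def)

lemma continuous_on_rest: "\<delta> > 0 \<Longrightarrow> continuous_on UNIV (rest \<delta> p l)"
  unfolding rest_def by (intro continuous_intros continuous_on_bump)

lemma cell_nonneg: "0 \<le> \<theta> w \<Longrightarrow> 0 \<le> cell \<theta> \<delta> p L l w"
  by (auto simp: cell_def bump_bounds rest_bounds intro!: mult_nonneg_nonneg)

lemma cell_le: "0 \<le> \<theta> w \<Longrightarrow> cell \<theta> \<delta> p L l w \<le> \<theta> w"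
proof -
  assume "0 \<le> \<theta> w"
  moreover have "rest \<delta> p l w * (if l < L then bump \<delta> (p l) w else 1) \<le> 1 * 1"
    using bump_bounds[of \<delta> "p l" w] rest_bounds[of \<delta> p l w] by (intro mult_mono) auto
  ultimately show ?thesis unfolding cell_def using mult_left_mono by fastforce
qed

lemma continuous_on_cell:
  "\<delta> > 0 \<Longrightarrow> continuous_on UNIV \<theta> \<Longrightarrow> continuous_on UNIV (cell \<theta> \<delta> p L l)"
  unfolding cell_def
  by (cases "l < L") (auto intro!: continuous_intros continuous_on_rest continuous_on_bump)

text \<open>The first \<open>n\<close> pieces telescope to \<open>1 - rest\<close> at
  \<open>n\<close>, and the cell with index \<open>L\<close> is exactly the rest; so the sum is
  \<open>\<theta>\<close> without error, even where no bump reaches.\<close>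

lemma sum_cell: "(\<Sum>l\<le>L. cell \<theta> \<delta> p L l w) = \<theta> w"
proof -
  have "(\<Sum>l<n. rest \<delta> p l w * bump \<delta> (p l) w) = 1 - rest \<delta> p n w" for n
    by (induction n) (auto simp: rest_def algebra_simps)
  then have "(\<Sum>l<L. cell \<theta> \<delta> p L l w) = \<theta> w * (1 - rest \<delta> p L w)"
    by (simp add: cell_def sum_distrib_left[symmetric])
  moreover have "{..L} = insert L {..<L}" by auto
  ultimately show ?thesis by (simp add: cell_def algebra_simps)
qed

lemma cell_nonzeroD:
  assumes "\<delta> > 0" "cell \<theta> \<delta> p L l w \<noteq> 0"
  shows "\<theta> w \<noteq> 0" "l < L \<Longrightarrow> dist w (p l) < 2 * \<delta>" "i < l \<Longrightarrow> \<delta> < dist w (p i)"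
  using assms bump_nonzeroD rest_nonzeroD by (auto simp: cell_def)

text \<open>Only nonnegativity and integrability of the weights are retained, so that the same
  computations apply to the cells pulled back to any approximating space.\<close>

locale discretization = sigma_finite_measure m for m :: "'a measure" +
  fixes I :: "'i set" and f :: "'i \<Rightarrow> 'a \<Rightarrow> real"
  assumes finI: "finite I" and f_int: "\<And>l. l \<in> I \<Longrightarrow> integrable m (f l)"
    and f_nonneg: "\<And>l x. l \<in> I \<Longrightarrow> 0 \<le> f l x"
begin

definition mass :: "'i \<Rightarrow> real" where "mass l = (\<integral>x. f l x \<partial>m)"

text \<open>The mass \<open>a l\<close> is distributed over cell \<open>l\<close> proportionally to
  \<open>f l\<close>. A cell of mass 0 contributes 0 by the convention for division; where total
  mass matters, \<open>a l = 0\<close> is assumed there.\<close>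

definition spread :: "('i \<Rightarrow> real) \<Rightarrow> 'a \<Rightarrow> real" where
  "spread a x = (\<Sum>l\<in>I. a l / mass l * f l x)"

text \<open>The mass \<open>B l l'\<close> is distributed over a pair of cells as a product density:
  the coupling is kept between cells and made independent inside each pair.\<close>

definition spread2 :: "('i \<Rightarrow> 'i \<Rightarrow> real) \<Rightarrow> 'a \<times> 'a \<Rightarrow> real" where
  "spread2 B = (\<lambda>(x, y). \<Sum>l\<in>I. \<Sum>l'\<in>I. B l l' / (mass l * mass l') * (f l x * f l' y))"

text \<open>Proofs below interpret \<open>pair_sigma_finite\<close>, which hides this fact.\<close>
lemmas iterated_integral = nn_integral_fst

lemma f_meas [measurable]: "l \<in> I \<Longrightarrow> f l \<in> borel_measurable m"
  using f_int by auto

lemma mass_nonneg: "l \<in> I \<Longrightarrow> 0 \<le> mass l"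
  unfolding mass_def using f_nonneg by (intro integral_nonneg_AE) auto

lemma spread_measurable [measurable]: "spread a \<in> borel_measurable m"
  unfolding spread_def by measurable

lemma spread_nonneg: "(\<And>l. l \<in> I \<Longrightarrow> 0 \<le> a l) \<Longrightarrow> 0 \<le> spread a x"
  unfolding spread_def using f_nonneg mass_nonneg by (intro sum_nonneg mult_nonneg_nonneg divide_nonneg_nonneg) auto

text \<open>Every quotient \<open>a l / mass l\<close> is at most \<open>M\<close> (it is 0 for an
  empty cell), so the density never exceeds \<open>M\<close> times the sum of the cell
  functions.\<close>

lemma spread_le:
  assumes "0 \<le> M" "\<And>l. l \<in> I \<Longrightarrow> 0 \<le> a l" "\<And>l. l \<in> I \<Longrightarrow> a l \<le> M * mass l"
  shows "spread a x \<le> M * (\<Sum>l\<in>I. f l x)"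
  unfolding spread_def sum_distrib_left
proof (rule sum_mono)
  fix l assume l: "l \<in> I"
  have "a l / mass l \<le> M"
    using assms(1) assms(3)[OF l] mass_nonneg[OF l] by (cases "mass l = 0") (auto simp: field_simps)
  then show "a l / mass l * f l x \<le> M * f l x" using f_nonneg[OF l] by (rule mult_right_mono)
qed

lemma integral_spread_mult:
  assumes "\<And>l. l \<in> I \<Longrightarrow> integrable m (\<lambda>x. g x * f l x)"
  shows "integrable m (\<lambda>x. spread a x * g x)"
    "(\<integral>x. spread a x * g x \<partial>m) = (\<Sum>l\<in>I. a l / mass l * (\<integral>x. g x * f l x \<partial>m))"
proof -
  have "(\<lambda>x. spread a x * g x) = (\<lambda>x. \<Sum>l\<in>I. a l / mass l * (g x * f l x))"
    by (simp add: spread_def sum_distrib_left sum_distrib_right mult_ac)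
  then show "integrable m (\<lambda>x. spread a x * g x)"
    "(\<integral>x. spread a x * g x \<partial>m) = (\<Sum>l\<in>I. a l / mass l * (\<integral>x. g x * f l x \<partial>m))"
    using assms by (auto intro!: integrable_sum integrable_mult_right simp: integral_sum)
qed

lemma integral_spread:
  assumes "\<And>l. l \<in> I \<Longrightarrow> mass l = 0 \<Longrightarrow> a l = 0"
  shows "integrable m (spread a)" "(\<integral>x. spread a x \<partial>m) = (\<Sum>l\<in>I. a l)"
proof -
  show "integrable m (spread a)" using integral_spread_mult(1)[of "\<lambda>_. 1" a] f_int by simp
  have "(\<integral>x. spread a x \<partial>m) = (\<Sum>l\<in>I. a l / mass l * mass l)"
    using integral_spread_mult(2)[of "\<lambda>_. 1" a] f_int by (simp add: mass_def)
  also have "\<dots> = (\<Sum>l\<in>I. a l)" using assms by (intro sum.cong) auto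
  finally show "(\<integral>x. spread a x \<partial>m) = (\<Sum>l\<in>I. a l)" .
qed

lemma prob_space_spread:
  assumes "\<And>l. l \<in> I \<Longrightarrow> 0 \<le> a l" "\<And>l. l \<in> I \<Longrightarrow> mass l = 0 \<Longrightarrow> a l = 0" "(\<Sum>l\<in>I. a l) = 1"
  shows "prob_space (density m (\<lambda>x. ennreal (spread a x)))"
proof
  have "emeasure (density m (\<lambda>x. ennreal (spread a x))) (space m) = (\<integral>\<^sup>+x. ennreal (spread a x) \<partial>m)"
    by (subst emeasure_density) (auto intro!: nn_integral_cong)
  also have "\<dots> = ennreal (\<integral>x. spread a x \<partial>m)"
    using integral_spread[of a] assms spread_nonneg[of a] by (intro nn_integral_eq_integral) auto
  finally show "emeasure (density m (\<lambda>x. ennreal (spread a x))) (space (density m (\<lambda>x. ennreal (spread a x)))) = 1"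
    using integral_spread[of a] assms by simp
qed

lemma integral_density_spread:
  assumes "\<And>l. l \<in> I \<Longrightarrow> 0 \<le> a l" and [measurable]: "g \<in> borel_measurable m"
    and "\<And>l. l \<in> I \<Longrightarrow> integrable m (\<lambda>x. g x * f l x)"
  shows "(\<integral>x. g x \<partial>density m (\<lambda>x. ennreal (spread a x))) = (\<Sum>l\<in>I. a l / mass l * (\<integral>x. g x * f l x \<partial>m))"
  using spread_nonneg[of a] assms(1) integral_spread_mult(2)[OF assms(3)]
  by (subst integral_density) auto

section \<open>Spreading a discrete coupling over pairs of cells\<close>

context
  fixes B :: "'i \<Rightarrow> 'i \<Rightarrow> real" and a b :: "'i \<Rightarrow> real"
  assumes B_nonneg: "\<And>l l'. l \<in> I \<Longrightarrow> l' \<in> I \<Longrightarrow> 0 \<le> B l l'"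
    and B_a: "\<And>l. l \<in> I \<Longrightarrow> (\<Sum>l'\<in>I. B l l') = a l"
    and B_b: "\<And>l'. l' \<in> I \<Longrightarrow> (\<Sum>l\<in>I. B l l') = b l'"
    and a0: "\<And>l. l \<in> I \<Longrightarrow> mass l = 0 \<Longrightarrow> a l = 0" and b0: "\<And>l. l \<in> I \<Longrightarrow> mass l = 0 \<Longrightarrow> b l = 0"
begin

lemma spread2_measurable [measurable]: "spread2 B \<in> borel_measurable (m \<Otimes>\<^sub>M m)"
  unfolding spread2_def by measurable

lemma spread2_nonneg: "0 \<le> spread2 B z"
  unfolding spread2_def using f_nonneg mass_nonneg B_nonneg
  by (auto intro!: sum_nonneg mult_nonneg_nonneg divide_nonneg_nonneg split: prod.split)

lemma B_le: "l \<in> I \<Longrightarrow> l' \<in> I \<Longrightarrow> B l l' \<le> a l" "l \<in> I \<Longrightarrow> l' \<in> I \<Longrightarrow> B l l' \<le> b l'"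
  using B_a[of l, symmetric] B_b[of l', symmetric] B_nonneg finI
  by (auto intro!: member_le_sum[of l' I "B l"] member_le_sum[of l I "\<lambda>l. B l l'"])

text \<open>An entry of \<open>B\<close> is at most its row sum and its column sum, which vanish for
  empty cells; hence the divisions by masses lose nothing.\<close>

lemma B_zero: "l \<in> I \<Longrightarrow> l' \<in> I \<Longrightarrow> mass l = 0 \<or> mass l' = 0 \<Longrightarrow> B l l' = 0"
  using B_le[of l l'] B_nonneg[of l l'] a0[of l] b0[of l'] by auto

text \<open>Integrating the second factor cancels \<open>mass l'\<close>, and the row sums of
  \<open>B\<close> are \<open>a\<close>. The other marginal is symmetric.\<close>

lemma spread2_inner_snd: "(\<integral>\<^sup>+y. ennreal (spread2 B (x, y)) \<partial>m) = ennreal (spread a x)"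
proof -
  have "integrable m (\<lambda>y. spread2 B (x, y))"
    unfolding spread2_def using f_int by (auto intro!: integrable_sum integrable_mult_right)
  then have "(\<integral>\<^sup>+y. ennreal (spread2 B (x, y)) \<partial>m) = ennreal (\<integral>y. spread2 B (x, y) \<partial>m)"
    using spread2_nonneg by (intro nn_integral_eq_integral) auto
  also have "(\<integral>y. spread2 B (x, y) \<partial>m) = (\<Sum>l\<in>I. \<Sum>l'\<in>I. B l l' / (mass l * mass l') * (f l x * mass l'))"
    unfolding spread2_def mass_def using f_int
    by (auto intro!: sum.cong integrable_sum integrable_mult_right simp: integral_sum)
  also have "\<dots> = (\<Sum>l\<in>I. \<Sum>l'\<in>I. B l l' / mass l * f l x)"
    using B_zero by (intro sum.cong refl) (auto simp: field_simps)
  also have "\<dots> = spread a x"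
    unfolding spread_def by (intro sum.cong refl) (simp add: B_a[symmetric] sum_distrib_right sum_divide_distrib)
  finally show ?thesis .
qed

lemma spread2_inner_fst: "(\<integral>\<^sup>+x. ennreal (spread2 B (x, y)) \<partial>m) = ennreal (spread b y)"
proof -
  have "integrable m (\<lambda>x. spread2 B (x, y))"
    unfolding spread2_def using f_int by (auto intro!: integrable_sum integrable_mult_right)
  then have "(\<integral>\<^sup>+x. ennreal (spread2 B (x, y)) \<partial>m) = ennreal (\<integral>x. spread2 B (x, y) \<partial>m)"
    using spread2_nonneg by (intro nn_integral_eq_integral) auto
  also have "(\<integral>x. spread2 B (x, y) \<partial>m) = (\<Sum>l\<in>I. \<Sum>l'\<in>I. B l l' / (mass l * mass l') * (mass l * f l' y))"
    unfolding spread2_def mass_def using f_int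
    by (auto intro!: sum.cong integrable_sum integrable_mult_right simp: integral_sum)
  also have "\<dots> = (\<Sum>l\<in>I. \<Sum>l'\<in>I. B l l' / mass l' * f l' y)"
    using B_zero by (intro sum.cong refl) (auto simp: field_simps)
  also have "\<dots> = (\<Sum>l'\<in>I. \<Sum>l\<in>I. B l l' / mass l' * f l' y)" by (rule sum.swap)
  also have "\<dots> = spread b y"
    unfolding spread_def by (intro sum.cong refl) (simp add: B_b[symmetric] sum_distrib_right sum_divide_distrib)
  finally show ?thesis .
qed

lemma distr_spread2_fst:
  "distr (density (m \<Otimes>\<^sub>M m) (\<lambda>z. ennreal (spread2 B z))) m fst = density m (\<lambda>x. ennreal (spread a x))"
proof (rule measure_eqI)
  interpret pair_sigma_finite m m ..
  fix A assume "A \<in> sets (distr (density (m \<Otimes>\<^sub>M m) (\<lambda>z. ennreal (spread2 B z))) m fst)"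
  then have [measurable]: "A \<in> sets m" by simp
  have "emeasure (distr (density (m \<Otimes>\<^sub>M m) (\<lambda>z. ennreal (spread2 B z))) m fst) A
    = (\<integral>\<^sup>+z. ennreal (spread2 B z) * indicator A (fst z) \<partial>(m \<Otimes>\<^sub>M m))"
    by (subst emeasure_distr, simp, simp, subst emeasure_density)
       (auto intro!: nn_integral_cong simp: indicator_def)
  also have "\<dots> = (\<integral>\<^sup>+x. \<integral>\<^sup>+y. ennreal (spread2 B (x, y)) * indicator A x \<partial>m \<partial>m)"
    using iterated_integral[where f = "\<lambda>z. ennreal (spread2 B z) * indicator A (fst z)"] by simp
  also have "\<dots> = (\<integral>\<^sup>+x. ennreal (spread a x) * indicator A x \<partial>m)"
    by (intro nn_integral_cong) (simp add: nn_integral_multc spread2_inner_snd)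
  finally show "emeasure (distr (density (m \<Otimes>\<^sub>M m) (\<lambda>z. ennreal (spread2 B z))) m fst) A
    = emeasure (density m (\<lambda>x. ennreal (spread a x))) A"
    by (simp add: emeasure_density)
qed simp

lemma distr_spread2_snd:
  "distr (density (m \<Otimes>\<^sub>M m) (\<lambda>z. ennreal (spread2 B z))) m snd = density m (\<lambda>x. ennreal (spread b x))"
proof (rule measure_eqI)
  interpret pair_sigma_finite m m ..
  fix A assume "A \<in> sets (distr (density (m \<Otimes>\<^sub>M m) (\<lambda>z. ennreal (spread2 B z))) m snd)"
  then have [measurable]: "A \<in> sets m" by simp
  have "emeasure (distr (density (m \<Otimes>\<^sub>M m) (\<lambda>z. ennreal (spread2 B z))) m snd) A
    = (\<integral>\<^sup>+z. ennreal (spread2 B z) * indicator A (snd z) \<partial>(m \<Otimes>\<^sub>M m))"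
    by (subst emeasure_distr, simp, simp, subst emeasure_density)
       (auto intro!: nn_integral_cong simp: indicator_def)
  also have "\<dots> = (\<integral>\<^sup>+y. \<integral>\<^sup>+x. ennreal (spread2 B (x, y)) * indicator A y \<partial>m \<partial>m)"
    using nn_integral_snd[where f = "\<lambda>z. ennreal (spread2 B z) * indicator A (snd z)"] by simp
  also have "\<dots> = (\<integral>\<^sup>+y. ennreal (spread b y) * indicator A y \<partial>m)"
    by (intro nn_integral_cong) (simp add: nn_integral_multc spread2_inner_fst)
  finally show "emeasure (distr (density (m \<Otimes>\<^sub>M m) (\<lambda>z. ennreal (spread2 B z))) m snd) A
    = emeasure (density m (\<lambda>x. ennreal (spread b x))) A"
    by (simp add: emeasure_density)
qed simp

text \<open>On each pair of cells the integrand is at most a constant, and the product density has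
  total mass \<open>B l l'\<close> there; Tonelli separates the variables.\<close>

lemma nn_integral_spread2_le:
  assumes [measurable]: "k \<in> borel_measurable (m \<Otimes>\<^sub>M m)"
    and K: "\<And>l l'. l \<in> I \<Longrightarrow> l' \<in> I \<Longrightarrow> 0 \<le> K l l'"
    and k: "\<And>l l' x y. l \<in> I \<Longrightarrow> l' \<in> I \<Longrightarrow> x \<in> space m \<Longrightarrow> y \<in> space m \<Longrightarrow> f l x \<noteq> 0 \<Longrightarrow> f l' y \<noteq> 0 \<Longrightarrow>
      k (x, y) \<le> ennreal (K l l')"
  shows "(\<integral>\<^sup>+z. k z \<partial>density (m \<Otimes>\<^sub>M m) (\<lambda>z. ennreal (spread2 B z))) \<le> ennreal (\<Sum>l\<in>I. \<Sum>l'\<in>I. B l l' * K l l')"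
proof -
  interpret pair_sigma_finite m m ..
  let ?w = "\<lambda>l l'. B l l' / (mass l * mass l')"
  have w: "0 \<le> ?w l l'" if "l \<in> I" "l' \<in> I" for l l'
    using B_nonneg mass_nonneg that by (intro divide_nonneg_nonneg) auto
  have fi: "(\<integral>\<^sup>+x. ennreal (f l x) \<partial>m) = ennreal (mass l)" if "l \<in> I" for l
    unfolding mass_def using that f_nonneg f_int by (intro nn_integral_eq_integral) auto
  have "(\<integral>\<^sup>+z. k z \<partial>density (m \<Otimes>\<^sub>M m) (\<lambda>z. ennreal (spread2 B z))) = (\<integral>\<^sup>+z. ennreal (spread2 B z) * k z \<partial>(m \<Otimes>\<^sub>M m))"
    by (subst nn_integral_density) auto
  also have "\<dots> \<le> (\<integral>\<^sup>+(x, y). (\<Sum>l\<in>I. \<Sum>l'\<in>I. ennreal (?w l l' * K l l') * (ennreal (f l x) * ennreal (f l' y))) \<partial>(m \<Otimes>\<^sub>M m))"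
  proof (rule nn_integral_mono)
    fix z assume "z \<in> space (m \<Otimes>\<^sub>M m)"
    then obtain x y where z: "z = (x, y)" "x \<in> space m" "y \<in> space m" by (auto simp: space_pair_measure)
    have nn: "0 \<le> ?w l l' * (f l x * f l' y)" if "l \<in> I" "l' \<in> I" for l l'
      using w[OF that] f_nonneg that by (intro mult_nonneg_nonneg) auto
    have "ennreal (spread2 B z) = (\<Sum>l\<in>I. ennreal (\<Sum>l'\<in>I. ?w l l' * (f l x * f l' y)))"
      unfolding spread2_def z(1) prod.case by (rule sum_ennreal[symmetric]) (intro sum_nonneg nn)
    also have "\<dots> = (\<Sum>l\<in>I. \<Sum>l'\<in>I. ennreal (?w l l' * (f l x * f l' y)))"
      by (intro sum.cong refl sum_ennreal[symmetric] nn)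
    finally have "ennreal (spread2 B z) * k z = (\<Sum>l\<in>I. \<Sum>l'\<in>I. ennreal (?w l l' * (f l x * f l' y)) * k z)"
      by (simp only: sum_distrib_right)
    also have "\<dots> \<le> (\<Sum>l\<in>I. \<Sum>l'\<in>I. ennreal (?w l l' * (f l x * f l' y)) * ennreal (K l l'))"
    proof (intro sum_mono)
      fix l l' assume "l \<in> I" "l' \<in> I"
      then show "ennreal (?w l l' * (f l x * f l' y)) * k z \<le> ennreal (?w l l' * (f l x * f l' y)) * ennreal (K l l')"
        using k[of l l' x y] z
        by (cases "f l x = 0"; cases "f l' y = 0") (simp_all add: mult_left_mono)
    qed
    also have "\<dots> = (\<Sum>l\<in>I. \<Sum>l'\<in>I. ennreal (?w l l' * K l l') * (ennreal (f l x) * ennreal (f l' y)))"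
    proof (intro sum.cong refl)
      fix l l' assume l: "l \<in> I" "l' \<in> I"
      show "ennreal (?w l l' * (f l x * f l' y)) * ennreal (K l l') = ennreal (?w l l' * K l l') * (ennreal (f l x) * ennreal (f l' y))"
        unfolding ennreal_mult[OF w[OF l] K[OF l]] ennreal_mult[OF w[OF l] mult_nonneg_nonneg[OF f_nonneg[OF l(1)] f_nonneg[OF l(2)]]]
          ennreal_mult[OF f_nonneg[OF l(1)] f_nonneg[OF l(2)]] by (simp only: mult_ac)
    qed
    finally show "ennreal (spread2 B z) * k z \<le> (case z of (x, y) \<Rightarrow> \<Sum>l\<in>I. \<Sum>l'\<in>I. ennreal (?w l l' * K l l') * (ennreal (f l x) * ennreal (f l' y)))"
      by (simp add: z(1))
  qed
  also have "\<dots> = (\<Sum>l\<in>I. \<Sum>l'\<in>I. ennreal (?w l l' * K l l') * (ennreal (mass l) * ennreal (mass l')))"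
  proof -
    have "(\<integral>\<^sup>+(x, y). (\<Sum>l\<in>I. \<Sum>l'\<in>I. ennreal (?w l l' * K l l') * (ennreal (f l x) * ennreal (f l' y))) \<partial>(m \<Otimes>\<^sub>M m))
      = (\<integral>\<^sup>+x. \<integral>\<^sup>+y. (\<Sum>l\<in>I. \<Sum>l'\<in>I. ennreal (?w l l' * K l l') * (ennreal (f l x) * ennreal (f l' y))) \<partial>m \<partial>m)"
      by (subst iterated_integral[symmetric]) auto
    also have "\<dots> = (\<integral>\<^sup>+x. (\<Sum>l\<in>I. \<Sum>l'\<in>I. ennreal (?w l l' * K l l') * (ennreal (f l x) * ennreal (mass l'))) \<partial>m)"
      by (intro nn_integral_cong) (auto simp: nn_integral_sum nn_integral_cmult fi intro!: sum.cong)
    also have "\<dots> = (\<Sum>l\<in>I. \<Sum>l'\<in>I. ennreal (?w l l' * K l l') * (ennreal (mass l) * ennreal (mass l')))"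
      by (auto simp: nn_integral_sum nn_integral_cmult nn_integral_multc fi intro!: sum.cong)
    finally show ?thesis .
  qed
  also have "\<dots> = (\<Sum>l\<in>I. \<Sum>l'\<in>I. ennreal (B l l' * K l l'))"
  proof (intro sum.cong refl)
    fix l l' assume l: "l \<in> I" "l' \<in> I"
    have "ennreal (?w l l' * K l l') * (ennreal (mass l) * ennreal (mass l')) = ennreal (?w l l' * K l l' * (mass l * mass l'))"
      using mult_nonneg_nonneg[OF w[OF l] K[OF l]] mass_nonneg l by (simp only: ennreal_mult mult_nonneg_nonneg)
    also have "?w l l' * K l l' * (mass l * mass l') = B l l' * K l l'"
      using B_zero[OF l] by (cases "mass l = 0 \<or> mass l' = 0") auto
    finally show "ennreal (?w l l' * K l l') * (ennreal (mass l) * ennreal (mass l')) = ennreal (B l l' * K l l')" .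
  qed
  also have "\<dots> = ennreal (\<Sum>l\<in>I. \<Sum>l'\<in>I. B l l' * K l l')"
    using B_nonneg K by (simp add: sum_nonneg)
  finally show ?thesis .
qed

end

end

section \<open>Approximate plans on the converging spaces\<close>

text \<open>Uniform continuity of u powr q on the compact interval up to \<open>D + 8\<close>;
  keeping \<open>d \<le> 1\<close> keeps \<open>u + 8 * d\<close> inside. The factor 8 is the total
  displacement met in \<open>K_le\<close>.\<close>

lemma powr_increment:
  assumes "q > (0::real)" "D \<ge> 0" "e > 0"
  obtains d where "d > 0" "d \<le> e" "\<And>u. 0 \<le> u \<Longrightarrow> u \<le> D \<Longrightarrow> (u + 8 * d) powr q \<le> u powr q + e"
proof -
  have "continuous_on {0..D + 8} (\<lambda>u. u powr q)"
    using assms by (intro continuous_on_powr' continuous_intros) auto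
  then have "uniformly_continuous_on {0..D + 8} (\<lambda>u. u powr q)"
    by (rule compact_uniformly_continuous) simp
  then obtain d0 where d0: "d0 > 0"
    "\<And>u v. u \<in> {0..D + 8} \<Longrightarrow> v \<in> {0..D + 8} \<Longrightarrow> dist u v < d0 \<Longrightarrow> dist (u powr q) (v powr q) < e"
    using assms(3) unfolding uniformly_continuous_on_def by metis
  define d where "d = min (min 1 e) (d0 / 16)"
  have d: "d > 0" "d \<le> 1" "d \<le> e" "8 * d < d0" using d0(1) assms by (auto simp: d_def)
  show ?thesis
  proof (rule that[OF d(1,3)])
    fix u assume u: "0 \<le> u" "u \<le> D"
    then have "dist ((u + 8 * d) powr q) (u powr q) < e"
      using d by (intro d0(2)) (auto simp: dist_real_def)
    then show "(u + 8 * d) powr q \<le> u powr q + e" by (simp add: dist_real_def)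
  qed
qed

lemma infdist_lessD: "infdist u S < t \<Longrightarrow> S \<noteq> {} \<Longrightarrow> \<exists>a\<in>S. dist u a < t"
  by (auto simp: infdist_def cINF_less_iff)

text \<open>The data on the limit space, seen inside \<open>'w\<close>: two marginals with densities
  at most \<open>M\<close>, and a sequence \<open>p\<close> whose closure contains the image of the
  space and provides the cell centres.\<close>

locale transport_pair =
  fixes X :: "'b metric" and m :: "'b measure" and J :: "'b \<Rightarrow> 'w::complete_space" and p :: "nat \<Rightarrow> 'w"
    and \<rho>\<^sub>0 \<rho>\<^sub>1 :: "'b \<Rightarrow> ennreal" and M D q :: real
  assumes mm: "metric_measure_space X m" and J: "isometric_on X J"
    and dense: "\<And>x. x \<in> mspace X \<Longrightarrow> J x \<in> closure (range p)"
    and \<rho>_meas [measurable]: "\<rho>\<^sub>0 \<in> borel_measurable m" "\<rho>\<^sub>1 \<in> borel_measurable m"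
    and \<mu>_prob: "density m \<rho>\<^sub>0 \<in> borel_prob X" "density m \<rho>\<^sub>1 \<in> borel_prob X"
    and M: "M \<ge> 0" "AE x in m. \<rho>\<^sub>0 x \<le> ennreal M" "AE x in m. \<rho>\<^sub>1 x \<le> ennreal M"
    and D: "D > 0" and q: "q > 1"
    and diam: "mdiam X (msupport X (density m \<rho>\<^sub>0) \<union> msupport X (density m \<rho>\<^sub>1)) < ennreal D"
begin

abbreviation "\<mu>\<^sub>0 \<equiv> density m \<rho>\<^sub>0"
abbreviation "\<mu>\<^sub>1 \<equiv> density m \<rho>\<^sub>1"

sublocale P0: prob_space \<mu>\<^sub>0 using \<mu>_prob by (simp add: borel_prob_def)
sublocale P1: prob_space \<mu>\<^sub>1 using \<mu>_prob by (simp add: borel_prob_def)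

definition S where "S = J ` (msupport X \<mu>\<^sub>0 \<union> msupport X \<mu>\<^sub>1)"
definition s where "s = enn2real (mdiam X (msupport X \<mu>\<^sub>0 \<union> msupport X \<mu>\<^sub>1))"
text \<open>A third of the gap between \<open>s\<close> and \<open>D\<close>: two points within
  \<open>\<eta>\<close> of \<open>S\<close> are at distance at most \<open>s + 2 * \<eta>\<close>,
  still strictly below \<open>D\<close>.\<close>

definition \<eta> where "\<eta> = (D - s) / 3"
definition \<theta> where "\<theta> w = max 0 (1 - 1 / \<eta> * infdist w S)"

lemma s: "0 \<le> s" "s < D" "u \<in> S \<Longrightarrow> v \<in> S \<Longrightarrow> dist u v \<le> s"
proof -
  let ?U = "msupport X \<mu>\<^sub>0 \<union> msupport X \<mu>\<^sub>1"
  show "0 \<le> s" by (simp add: s_def)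
  have fin: "mdiam X ?U < top" using diam by (metis ennreal_less_top less_trans)
  have ms: "mdiam X ?U = ennreal s"
    unfolding s_def using fin by (simp add: less_top)
  with diam show "s < D" using \<open>0 \<le> s\<close> by (simp add: ennreal_less_iff)
  assume "u \<in> S" "v \<in> S"
  then obtain x y where xy: "x \<in> ?U" "y \<in> ?U" "u = J x" "v = J y" unfolding S_def by blast
  then have "x \<in> mspace X" "y \<in> mspace X" by (auto simp: msupport_def)
  then have "dist u v = mdist X x y" using xy isometric_onD[OF J] by simp
  moreover have "ennreal (mdist X x y) \<le> mdiam X ?U"
    unfolding mdiam_def by (rule SUP_upper2[of "(x, y)"]) (use xy in auto)
  ultimately show "dist u v \<le> s" using ms \<open>0 \<le> s\<close> by simp
qed

lemma \<eta>: "\<eta> > 0" "s + 2 * \<eta> < D"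
  using s(1,2) by (auto simp: \<eta>_def field_simps)

lemma AE_S: "AE x in \<mu>\<^sub>0. J x \<in> S" "AE x in \<mu>\<^sub>1. J x \<in> S"
proof -
  have "sets \<mu>\<^sub>0 = sets (mborel X)" "sets \<mu>\<^sub>1 = sets (mborel X)" using \<mu>_prob by (auto simp: borel_prob_def)
  from this[THEN AE_msupport[OF mm_separable[OF mm]]]
  show "AE x in \<mu>\<^sub>0. J x \<in> S" "AE x in \<mu>\<^sub>1. J x \<in> S"
    by (auto simp: S_def elim!: AE_mp)
qed

lemma S_nonempty: "S \<noteq> {}"
proof
  assume "S = {}"
  then have "AE x in \<mu>\<^sub>0. False" using AE_S(1) by simp
  then show False using P0.AE_False by simp
qed

lemma S_bounded: "bounded S"
  using S_nonempty s(3) unfolding bounded_def by blast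

text \<open>The infimum in \<open>infdist\<close> need not be attained, so the triangle inequality
  is run with a strictly larger radius \<open>t\<close>, which \<open>near_S_\<eta>\<close> then
  lets shrink to \<open>\<eta>\<close>.\<close>

lemma near_S:
  assumes "infdist u S \<le> r" "infdist v S \<le> r" "r < t"
  shows "dist u v \<le> s + 2 * t"
proof -
  obtain a b where "a \<in> S" "dist u a < t" "b \<in> S" "dist v b < t"
    using infdist_lessD[OF le_less_trans[OF assms(1,3)] S_nonempty] infdist_lessD[OF le_less_trans[OF assms(2,3)] S_nonempty]
    by blast
  then show ?thesis
    using s(3)[of a b] dist_triangle[of u v a] dist_triangle[of a v b] by (simp add: dist_commute)
qed

lemma near_S_\<eta>: "infdist u S \<le> \<eta> \<Longrightarrow> infdist v S \<le> \<eta> \<Longrightarrow> dist u v \<le> s + 2 * \<eta>"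
proof (rule field_le_epsilon)
  fix e :: real assume "infdist u S \<le> \<eta>" "infdist v S \<le> \<eta>" "e > 0"
  then show "dist u v \<le> s + 2 * \<eta> + e"
    using near_S[of u \<eta> v "\<eta> + e/2"] by simp
qed

lemma \<theta>_nonzeroD: "\<theta> w \<noteq> 0 \<Longrightarrow> infdist w S \<le> \<eta>"
  using \<eta>(1) by (auto simp: \<theta>_def max_def field_simps split: if_splits)

lemma \<theta>_dist: "\<theta> u \<noteq> 0 \<Longrightarrow> \<theta> v \<noteq> 0 \<Longrightarrow> dist u v \<le> D"
  using near_S_\<eta>[OF \<theta>_nonzeroD \<theta>_nonzeroD, of u v] \<eta>(2) by simp

lemma \<theta>_test: "test_function \<theta>"
  unfolding test_function_def \<theta>_def[abs_def]
  using uniformly_continuous_on_infdist_bump[of "1/\<eta>" S] bounded_infdist_bump[of "1/\<eta>" S] S_bounded S_nonempty \<eta>(1)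
  by (auto simp: infdist_nonneg)

lemma \<theta>_nonneg: "0 \<le> \<theta> w" and \<theta>_le1: "\<theta> w \<le> 1"
  using test_functionD(1,2)[OF \<theta>_test] by auto

lemma \<theta>_S: "w \<in> S \<Longrightarrow> \<theta> w = 1" by (simp add: \<theta>_def)

abbreviation "c \<delta> L \<equiv> cell \<theta> \<delta> p L"

lemma c_bounds: "0 \<le> c \<delta> L l w" "c \<delta> L l w \<le> 1" "\<bar>c \<delta> L l w\<bar> \<le> 1"
  using cell_nonneg[of \<theta> w \<delta> p L l] cell_le[of \<theta> w \<delta> p L l] \<theta>_nonneg[of w] \<theta>_le1[of w] by auto

lemma c_measurable: "\<delta> > 0 \<Longrightarrow> c \<delta> L l \<in> borel_measurable borel"
  by (intro borel_measurable_continuous_onI continuous_on_cell test_functionD(5)[OF \<theta>_test])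

lemma c_bounded: "\<delta> > 0 \<Longrightarrow> bounded {w. c \<delta> L l w \<noteq> 0}"
  by (rule bounded_subset[OF test_functionD(7)[OF \<theta>_test]]) (auto dest: cell_nonzeroD)

lemma c_integrable:
  assumes "metric_measure_space X' m'" "isometric_on X' J'" "\<delta> > 0"
  shows "integrable m' (\<lambda>x. c \<delta> L l (J' x))"
proof -
  obtain a R where "\<And>w. c \<delta> L l w \<noteq> 0 \<Longrightarrow> dist a w \<le> R"
    using c_bounded[OF assms(3)] unfolding bounded_def by blast
  then show ?thesis
    using mm_integrable[OF assms(1,2) c_measurable[OF assms(3)] c_bounds(3), of L l a R]
    by (simp add: dist_commute)
qed

text \<open>The mass that the first marginal gives to cell \<open>l\<close>; \<open>a1\<close> is
  the same for the second.\<close>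

definition a0 where "a0 \<delta> L l = (\<integral>x. c \<delta> L l (J x) \<partial>\<mu>\<^sub>0)"
definition a1 where "a1 \<delta> L l = (\<integral>x. c \<delta> L l (J x) \<partial>\<mu>\<^sub>1)"

lemma J_meas [measurable]: "J \<in> borel_measurable m" by (rule mm_isometric_measurable[OF mm J])

lemma c_integrable_\<mu>: "\<delta> > 0 \<Longrightarrow> integrable \<mu>\<^sub>0 (\<lambda>x. c \<delta> L l (J x))" "\<delta> > 0 \<Longrightarrow> integrable \<mu>\<^sub>1 (\<lambda>x. c \<delta> L l (J x))"
proof -
  assume \<delta>: "\<delta> > 0"
  have [measurable]: "(\<lambda>x. c \<delta> L l (J x)) \<in> borel_measurable m"
    by (rule measurable_compose[OF J_meas c_measurable[OF \<delta>]])
  show "integrable \<mu>\<^sub>0 (\<lambda>x. c \<delta> L l (J x))"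
    by (rule P0.integrable_const_bound[of _ 1]) (auto simp: c_bounds)
  show "integrable \<mu>\<^sub>1 (\<lambda>x. c \<delta> L l (J x))"
    by (rule P1.integrable_const_bound[of _ 1]) (auto simp: c_bounds)
qed

lemma a_nonneg: "0 \<le> a0 \<delta> L l" "0 \<le> a1 \<delta> L l"
  unfolding a0_def a1_def by (intro integral_nonneg_AE AE_I2 c_bounds)+

text \<open>The cells sum to \<open>\<theta>\<close>, which is 1 on \<open>S\<close>, and both
  marginals are carried by \<open>S\<close>.\<close>

lemma sum_a: assumes "\<delta> > 0" shows "(\<Sum>l\<le>L. a0 \<delta> L l) = 1" "(\<Sum>l\<le>L. a1 \<delta> L l) = 1"
proof -
  have "(\<Sum>l\<le>L. a0 \<delta> L l) = (\<integral>x. (\<Sum>l\<le>L. c \<delta> L l (J x)) \<partial>\<mu>\<^sub>0)"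
    unfolding a0_def by (subst Bochner_Integration.integral_sum) (auto intro: c_integrable_\<mu> assms)
  also have "\<dots> = (\<integral>x. 1 \<partial>\<mu>\<^sub>0)"
    unfolding sum_cell by (intro integral_cong_AE) (use AE_S(1) in \<open>auto elim!: AE_mp simp: \<theta>_S intro: measurable_compose[OF J_meas test_functionD(6)[OF \<theta>_test]]\<close>)
  finally show "(\<Sum>l\<le>L. a0 \<delta> L l) = 1" using P0.prob_space by simp
  have "(\<Sum>l\<le>L. a1 \<delta> L l) = (\<integral>x. (\<Sum>l\<le>L. c \<delta> L l (J x)) \<partial>\<mu>\<^sub>1)"
    unfolding a1_def by (subst Bochner_Integration.integral_sum) (auto intro: c_integrable_\<mu> assms)
  also have "\<dots> = (\<integral>x. 1 \<partial>\<mu>\<^sub>1)"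
    unfolding sum_cell by (intro integral_cong_AE) (use AE_S(2) in \<open>auto elim!: AE_mp simp: \<theta>_S intro: measurable_compose[OF J_meas test_functionD(6)[OF \<theta>_test]]\<close>)
  finally show "(\<Sum>l\<le>L. a1 \<delta> L l) = 1" using P1.prob_space by simp
qed

text \<open>The bound on the densities in the form that survives convergence: an inequality between
  integrals of cell functions.\<close>

lemma a_le:
  assumes \<delta>: "\<delta> > 0"
  shows "a0 \<delta> L l \<le> M * (\<integral>x. c \<delta> L l (J x) \<partial>m)" "a1 \<delta> L l \<le> M * (\<integral>x. c \<delta> L l (J x) \<partial>m)"
proof -
  have [measurable]: "(\<lambda>x. c \<delta> L l (J x)) \<in> borel_measurable m"
    by (rule measurable_compose[OF J_meas c_measurable[OF \<delta>]])
  have gen: "(\<integral>x. c \<delta> L l (J x) \<partial>density m \<rho>) \<le> M * (\<integral>x. c \<delta> L l (J x) \<partial>m)"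
    if [measurable]: "\<rho> \<in> borel_measurable m" and \<rho>: "AE x in m. \<rho> x \<le> ennreal M"
      and i: "integrable (density m \<rho>) (\<lambda>x. c \<delta> L l (J x))" for \<rho>
  proof -
    have "ennreal (\<integral>x. c \<delta> L l (J x) \<partial>density m \<rho>) = (\<integral>\<^sup>+x. ennreal (c \<delta> L l (J x)) \<partial>density m \<rho>)"
      by (rule nn_integral_eq_integral[OF i, symmetric]) (simp add: c_bounds)
    also have "\<dots> = (\<integral>\<^sup>+x. \<rho> x * ennreal (c \<delta> L l (J x)) \<partial>m)"
      by (rule nn_integral_density) auto
    also have "\<dots> \<le> (\<integral>\<^sup>+x. ennreal M * ennreal (c \<delta> L l (J x)) \<partial>m)"
      by (rule nn_integral_mono_AE) (use \<rho> in \<open>auto elim!: AE_mp intro!: mult_right_mono\<close>)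
    also have "\<dots> = ennreal M * (\<integral>\<^sup>+x. ennreal (c \<delta> L l (J x)) \<partial>m)"
      by (rule nn_integral_cmult) auto
    also have "(\<integral>\<^sup>+x. ennreal (c \<delta> L l (J x)) \<partial>m) = ennreal (\<integral>x. c \<delta> L l (J x) \<partial>m)"
      by (rule nn_integral_eq_integral[OF c_integrable[OF mm J \<delta>]]) (simp add: c_bounds)
    finally have *: "ennreal (\<integral>x. c \<delta> L l (J x) \<partial>density m \<rho>) \<le> ennreal M * ennreal (\<integral>x. c \<delta> L l (J x) \<partial>m)" .
    have "0 \<le> (\<integral>x. c \<delta> L l (J x) \<partial>m)" by (intro integral_nonneg_AE) (simp add: c_bounds)
    with * M(1) show ?thesis by (simp add: ennreal_mult[symmetric])
  qed
  show "a0 \<delta> L l \<le> M * (\<integral>x. c \<delta> L l (J x) \<partial>m)" "a1 \<delta> L l \<le> M * (\<integral>x. c \<delta> L l (J x) \<partial>m)"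
    unfolding a0_def a1_def using M(2,3) c_integrable_\<mu>[OF \<delta>] by (auto intro!: gen)
qed

text \<open>At a fixed point the remainder cell is zero as soon as \<open>L\<close> exceeds the
  index of some \<open>p i\<close> within \<open>\<delta>\<close>; dominated convergence does the
  rest.\<close>

lemma rest_vanishes:
  assumes \<delta>: "\<delta> > 0"
  shows "(\<lambda>L. a0 \<delta> L L) \<longlonglongrightarrow> 0" "(\<lambda>L. a1 \<delta> L L) \<longlonglongrightarrow> 0"
proof -
  have [measurable]: "(\<lambda>x. c \<delta> L l (J x)) \<in> borel_measurable m" for L l
    by (rule measurable_compose[OF J_meas c_measurable[OF \<delta>]])
  have lim: "(\<lambda>L. c \<delta> L L (J x)) \<longlonglongrightarrow> 0" if x: "x \<in> mspace X" for x
  proof -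
    obtain i where i: "dist (p i) (J x) < \<delta>"
      using dense[OF x] \<delta> unfolding closure_approachable by blast
    have "c \<delta> L L (J x) = 0" if "L \<ge> Suc i" for L
      using cell_nonzeroD(3)[OF \<delta>, of \<theta> p L L "J x" i] i that by (auto simp: dist_commute)
    then show ?thesis by (intro tendsto_eventually) (auto simp: eventually_sequentially)
  qed
  have "(\<lambda>L. a0 \<delta> L L) \<longlonglongrightarrow> (\<integral>x. 0 \<partial>\<mu>\<^sub>0)"
    unfolding a0_def
    by (rule integral_dominated_convergence[where w="\<lambda>_. 1" and f="\<lambda>_. 0" and M=\<mu>\<^sub>0 and s="\<lambda>L x. c \<delta> L L (J x)"])
       (auto simp: c_bounds mm_space[OF mm] intro!: AE_I2 lim)
  then show "(\<lambda>L. a0 \<delta> L L) \<longlonglongrightarrow> 0" by simp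
  have "(\<lambda>L. a1 \<delta> L L) \<longlonglongrightarrow> (\<integral>x. 0 \<partial>\<mu>\<^sub>1)"
    unfolding a1_def
    by (rule integral_dominated_convergence[where w="\<lambda>_. 1" and f="\<lambda>_. 0" and M=\<mu>\<^sub>1 and s="\<lambda>L x. c \<delta> L L (J x)"])
       (auto simp: c_bounds mm_space[OF mm] intro!: AE_I2 lim)
  then show "(\<lambda>L. a1 \<delta> L L) \<longlonglongrightarrow> 0" by simp
qed

text \<open>Cells small enough for the cost to oscillate by at most \<open>e\<close>, and numerous
  enough to leave mass at most \<open>e\<close> in the remainder cell; \<open>\<delta>\<close> is
  chosen before \<open>L\<close>.\<close>

definition good_scale where
  "good_scale e \<delta> L \<longleftrightarrow> 0 < \<delta> \<and> \<delta> \<le> e \<and> (\<forall>u. 0 \<le> u \<longrightarrow> u \<le> D \<longrightarrow> (u + 8 * \<delta>) powr q \<le> u powr q + e) \<and>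
     a0 \<delta> L L \<le> e \<and> a1 \<delta> L L \<le> e"

lemma good_scale_exists: assumes "e > 0" obtains \<delta> L where "good_scale e \<delta> L"
proof -
  obtain \<delta> where \<delta>: "\<delta> > 0" "\<delta> \<le> e" "\<And>u. 0 \<le> u \<Longrightarrow> u \<le> D \<Longrightarrow> (u + 8 * \<delta>) powr q \<le> u powr q + e"
    by (rule powr_increment[of q D e]) (use q D assms in auto)
  have "\<forall>\<^sub>F L in sequentially. a0 \<delta> L L < e \<and> a1 \<delta> L L < e"
    using rest_vanishes[OF \<delta>(1)] assms by (intro eventually_conj order_tendstoD) auto
  then obtain L where "a0 \<delta> L L < e" "a1 \<delta> L L < e" by (auto simp: eventually_sequentially)
  then show ?thesis using that[of \<delta> L] \<delta> by (simp add: good_scale_def)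
qed

text \<open>An upper bound for the cost between two cells, and up to an error also a lower bound; if a
  remainder cell is involved, only the bound by the diameter is available.\<close>
definition K where
  "K \<delta> L l l' = (if l < L \<and> l' < L then (dist (p l) (p l') + 4 * \<delta>) powr q else D powr q)"

lemma K_nonneg: "0 \<le> K \<delta> L l l'" by (simp add: K_def)

lemma powr_dist_le_K:
  assumes \<delta>: "\<delta> > 0" and c: "c \<delta> L l u \<noteq> 0" "c \<delta> L l' v \<noteq> 0"
  shows "dist u v powr q \<le> K \<delta> L l l'"
proof (cases "l < L \<and> l' < L")
  case True
  then have "dist u (p l) < 2 * \<delta>" "dist v (p l') < 2 * \<delta>" using cell_nonzeroD(2)[OF \<delta>] c by blast+
  then have "dist u v \<le> dist (p l) (p l') + 4 * \<delta>"
    using dist_triangle[of u v "p l"] dist_triangle[of "p l" v "p l'"] by (simp add: dist_commute)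
  then show ?thesis using True q by (simp add: K_def powr_mono2)
next
  case False
  have "dist u v \<le> D" using \<theta>_dist cell_nonzeroD(1)[OF \<delta>] c by blast
  then show ?thesis unfolding K_def if_not_P[OF False] using q by (intro powr_mono2) auto
qed

text \<open>\<open>K\<close> already contains a margin of \<open>4 * \<delta>\<close>; moving from
  the two centres to points of the cells costs \<open>2 * \<delta>\<close> each, so
  \<open>8 * \<delta>\<close> in all.\<close>

lemma K_le:
  assumes gs: "good_scale e \<delta> L" and l: "l < L" "l' < L" and c: "c \<delta> L l u \<noteq> 0" "c \<delta> L l' v \<noteq> 0"
  shows "K \<delta> L l l' \<le> dist u v powr q + e"
proof -
  have \<delta>: "\<delta> > 0" using gs by (simp add: good_scale_def)
  have "dist u (p l) < 2 * \<delta>" "dist v (p l') < 2 * \<delta>" using cell_nonzeroD(2)[OF \<delta>] c l by blast+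
  then have "dist (p l) (p l') + 4 * \<delta> \<le> dist u v + 8 * \<delta>"
    using dist_triangle[of "p l" "p l'" u] dist_triangle[of u "p l'" v] by (simp add: dist_commute)
  then have "K \<delta> L l l' \<le> (dist u v + 8 * \<delta>) powr q"
    using l \<delta> q by (simp add: K_def powr_mono2)
  also have "\<dots> \<le> dist u v powr q + e"
    using gs \<theta>_dist cell_nonzeroD(1)[OF \<delta>] c unfolding good_scale_def by (metis zero_le_dist)
  finally show ?thesis .
qed

text \<open>A weighted average over pairs of cells with weights summing to 1. Pairs of proper cells
  obey \<open>K_le\<close>; each occurrence of the remainder cell adds at most
  \<open>D powr q\<close> times its weight.\<close>

lemma sum_K_le:
  assumes gs: "good_scale e \<delta> L" and \<theta>: "\<theta> u = 1" "\<theta> v = 1"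
  shows "(\<Sum>l\<le>L. \<Sum>l'\<le>L. c \<delta> L l u * c \<delta> L l' v * K \<delta> L l l') \<le>
    dist u v powr q + e + D powr q * (c \<delta> L L u + c \<delta> L L v)"
proof -
  let ?A = "dist u v powr q + e"
  have \<delta>: "\<delta> > 0" and e: "e > 0" using gs by (auto simp: good_scale_def)
  have su: "(\<Sum>l\<le>L. c \<delta> L l u) = 1" "(\<Sum>l\<le>L. c \<delta> L l v) = 1" using \<theta> by (simp_all add: sum_cell)
  have "(\<Sum>l\<le>L. \<Sum>l'\<le>L. c \<delta> L l u * c \<delta> L l' v * K \<delta> L l l')
    \<le> (\<Sum>l\<le>L. \<Sum>l'\<le>L. c \<delta> L l u * c \<delta> L l' v * (?A + (if l = L then D powr q else 0) + (if l' = L then D powr q else 0)))"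
  proof (intro sum_mono)
    fix l l' assume ll: "l \<in> {..L}" "l' \<in> {..L}"
    show "c \<delta> L l u * c \<delta> L l' v * K \<delta> L l l' \<le> c \<delta> L l u * c \<delta> L l' v * (?A + (if l = L then D powr q else 0) + (if l' = L then D powr q else 0))"
    proof (cases "c \<delta> L l u \<noteq> 0 \<and> c \<delta> L l' v \<noteq> 0")
      case True
      have A0: "0 \<le> ?A" using e by (simp add: add_nonneg_nonneg)
      have "K \<delta> L l l' \<le> ?A + (if l = L then D powr q else 0) + (if l' = L then D powr q else 0)"
      proof (cases "l < L \<and> l' < L")
        case True
        with \<open>c \<delta> L l u \<noteq> 0 \<and> c \<delta> L l' v \<noteq> 0\<close> show ?thesis using K_le[OF gs, of l l' u v] by simp
      next
        case False
        then show ?thesis using A0 ll unfolding K_def if_not_P[OF False] by (cases "l = L"; cases "l' = L") auto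
      qed
      then show ?thesis by (intro mult_left_mono mult_nonneg_nonneg c_bounds)
    qed auto
  qed
  also have "\<dots> = ?A * ((\<Sum>l\<le>L. c \<delta> L l u) * (\<Sum>l'\<le>L. c \<delta> L l' v))
     + (\<Sum>l\<le>L. (if l = L then D powr q else 0) * c \<delta> L l u) * (\<Sum>l'\<le>L. c \<delta> L l' v)
     + (\<Sum>l\<le>L. c \<delta> L l u) * (\<Sum>l'\<le>L. (if l' = L then D powr q else 0) * c \<delta> L l' v)"
    unfolding sum_product by (simp add: sum_distrib_left sum.distrib algebra_simps)
  also have "\<dots> = ?A + D powr q * (c \<delta> L L u + c \<delta> L L v)"
    unfolding su by (simp add: if_distrib[of "\<lambda>t. t * _"] sum.delta algebra_simps cong: if_cong)
  finally show ?thesis .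
qed

text \<open>The discrete coupling that \<open>\<beta>\<close> induces between cells.\<close>

definition B where "B \<beta> \<delta> L l l' = (\<integral>z. c \<delta> L l (J (fst z)) * c \<delta> L l' (J (snd z)) \<partial>\<beta>)"

text \<open>The real-valued form of \<open>transport_cost\<close>; for couplings of the two
  marginals it is finite, since they charge only pairs at distance at most \<open>D\<close>.\<close>

definition real_cost where "real_cost \<beta> = (\<integral>z. dist (J (fst z)) (J (snd z)) powr q \<partial>\<beta>)"

section \<open>Discretising a coupling of the limit marginals\<close>

context
  fixes \<beta> assumes \<beta>: "\<beta> \<in> couplings X \<mu>\<^sub>0 \<mu>\<^sub>1"
begin

lemma \<beta>_sets: "sets \<beta> = sets (mborel X \<Otimes>\<^sub>M mborel X)"
  and \<beta>_distr: "distr \<beta> (mborel X) fst = \<mu>\<^sub>0" "distr \<beta> (mborel X) snd = \<mu>\<^sub>1"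
  using \<beta> by (auto simp: couplings_def)

lemma \<beta>_proj [measurable]: "fst \<in> \<beta> \<rightarrow>\<^sub>M mborel X" "snd \<in> \<beta> \<rightarrow>\<^sub>M mborel X"
  unfolding measurable_cong_sets[OF \<beta>_sets refl] by auto

lemma \<beta>_prob: "prob_space \<beta>"
proof
  have "emeasure \<mu>\<^sub>0 (space \<mu>\<^sub>0) = emeasure \<beta> (fst -` mspace X \<inter> space \<beta>)"
    unfolding \<beta>_distr(1)[symmetric] using sets.top[of "mborel X"] by (subst emeasure_distr) auto
  also have "fst -` mspace X \<inter> space \<beta> = space \<beta>"
    using measurable_space[OF \<beta>_proj(1)] by auto
  finally show "emeasure \<beta> (space \<beta>) = 1" using P0.emeasure_space_1 by simp
qed

lemma \<beta>_space: "z \<in> space \<beta> \<Longrightarrow> fst z \<in> mspace X \<and> snd z \<in> mspace X"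
  using measurable_space[OF \<beta>_proj(1)] measurable_space[OF \<beta>_proj(2)] by auto

lemma J_borel [measurable]: "J \<in> borel_measurable (mborel X)" by (rule isometric_on_measurable[OF J])

lemma AE_\<beta>: "AE z in \<beta>. \<theta> (J (fst z)) = 1 \<and> \<theta> (J (snd z)) = 1"
proof -
  have "AE x in distr \<beta> (mborel X) fst. J x \<in> S" "AE x in distr \<beta> (mborel X) snd. J x \<in> S"
    unfolding \<beta>_distr by (rule AE_S)+
  from AE_distrD[OF \<beta>_proj(1) this(1)] AE_distrD[OF \<beta>_proj(2) this(2)] show ?thesis
    by eventually_elim (simp add: \<theta>_S)
qed

lemma c_\<beta>_measurable:
  assumes "\<delta> > 0"
  shows "(\<lambda>z. c \<delta> L l (J (fst z))) \<in> borel_measurable \<beta>" "(\<lambda>z. c \<delta> L l (J (snd z))) \<in> borel_measurable \<beta>"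
  using measurable_compose[OF measurable_compose[OF \<beta>_proj(1) J_borel] c_measurable[OF assms]]
    measurable_compose[OF measurable_compose[OF \<beta>_proj(2) J_borel] c_measurable[OF assms]] by auto

lemma cc_integrable:
  assumes "\<delta> > 0"
  shows "integrable \<beta> (\<lambda>z. c \<delta> L l (J (fst z)) * c \<delta> L l' (J (snd z)))"
proof -
  interpret prob_space \<beta> by (rule \<beta>_prob)
  show ?thesis
    using c_\<beta>_measurable[OF assms] c_bounds(3) 
    by (intro integrable_const_bound[of _ 1]) (auto simp: abs_mult intro!: mult_le_one c_bounds)
qed

text \<open>The detour through \<open>mdist\<close> uses the separability of \<open>X\<close>; in a
  nonseparable \<open>'w\<close> the distance may fail to be measurable for the product
  sigma-algebra.\<close>

lemma dist_\<beta>_measurable: "(\<lambda>z. dist (J (fst z)) (J (snd z))) \<in> borel_measurable \<beta>"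
proof -
  have "(\<lambda>z. (\<lambda>(x, y). mdist X x y) (fst z, snd z)) \<in> borel_measurable \<beta>"
    by (rule measurable_compose[OF _ borel_measurable_mdist[OF mm_separable[OF mm]]]) measurable
  then show ?thesis
    by (subst measurable_cong[where g = "\<lambda>z. mdist X (fst z) (snd z)"]) (use \<beta>_space isometric_onD[OF J] in \<open>auto simp: case_prod_beta'\<close>)
qed

text \<open>Summing one index replaces its cells by \<open>\<theta>\<close>, which is 1 almost
  everywhere for \<open>\<beta>\<close>; what remains is an integral against a marginal of
  \<open>\<beta>\<close>.\<close>

lemma B_sums:
  assumes \<delta>: "\<delta> > 0"
  shows "(\<Sum>l'\<le>L. B \<beta> \<delta> L l l') = a0 \<delta> L l" "(\<Sum>l\<le>L. B \<beta> \<delta> L l l') = a1 \<delta> L l'"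
proof -
  interpret prob_space \<beta> by (rule \<beta>_prob)
  note [measurable] = c_\<beta>_measurable[OF \<delta>]
  have [measurable]: "(\<lambda>z. \<theta> (J (fst z))) \<in> borel_measurable \<beta>" "(\<lambda>z. \<theta> (J (snd z))) \<in> borel_measurable \<beta>"
    using measurable_compose[OF measurable_compose[OF \<beta>_proj(1) J_borel] test_functionD(6)[OF \<theta>_test]]
      measurable_compose[OF measurable_compose[OF \<beta>_proj(2) J_borel] test_functionD(6)[OF \<theta>_test]] by auto
  have "(\<Sum>l'\<le>L. B \<beta> \<delta> L l l') = (\<integral>z. (\<Sum>l'\<le>L. c \<delta> L l (J (fst z)) * c \<delta> L l' (J (snd z))) \<partial>\<beta>)"
    unfolding B_def by (subst Bochner_Integration.integral_sum) (auto intro: cc_integrable \<delta>)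
  also have "\<dots> = (\<integral>z. c \<delta> L l (J (fst z)) \<partial>\<beta>)"
    unfolding sum_distrib_left[symmetric] sum_cell
    by (intro integral_cong_AE) (use AE_\<beta> in \<open>auto elim!: AE_mp\<close>)
  also have "\<dots> = a0 \<delta> L l"
    unfolding a0_def \<beta>_distr(1)[symmetric]
    by (rule integral_distr[symmetric, OF \<beta>_proj(1) measurable_compose[OF J_borel c_measurable[OF \<delta>]]])
  finally show "(\<Sum>l'\<le>L. B \<beta> \<delta> L l l') = a0 \<delta> L l" .
  have "(\<Sum>l\<le>L. B \<beta> \<delta> L l l') = (\<integral>z. (\<Sum>l\<le>L. c \<delta> L l (J (fst z)) * c \<delta> L l' (J (snd z))) \<partial>\<beta>)"
    unfolding B_def by (subst Bochner_Integration.integral_sum) (auto intro: cc_integrable \<delta>)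
  also have "\<dots> = (\<integral>z. c \<delta> L l' (J (snd z)) \<partial>\<beta>)"
    unfolding sum_distrib_right[symmetric] sum_cell
    by (intro integral_cong_AE) (use AE_\<beta> in \<open>auto elim!: AE_mp\<close>)
  also have "\<dots> = a1 \<delta> L l'"
    unfolding a1_def \<beta>_distr(2)[symmetric]
    by (rule integral_distr[symmetric, OF \<beta>_proj(2) measurable_compose[OF J_borel c_measurable[OF \<delta>]]])
  finally show "(\<Sum>l\<le>L. B \<beta> \<delta> L l l') = a1 \<delta> L l'" .
qed

lemma B_nonneg: "0 \<le> B \<beta> \<delta> L l l'"
  unfolding B_def by (intro integral_nonneg_AE AE_I2 mult_nonneg_nonneg c_bounds)

lemma real_cost_integrable: "integrable \<beta> (\<lambda>z. dist (J (fst z)) (J (snd z)) powr q)"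
  and transport_cost_\<beta>: "transport_cost q X \<beta> = ennreal (real_cost \<beta>)"
proof -
  interpret prob_space \<beta> by (rule \<beta>_prob)
  note [measurable] = dist_\<beta>_measurable
  show i: "integrable \<beta> (\<lambda>z. dist (J (fst z)) (J (snd z)) powr q)"
  proof (rule integrable_const_bound[of _ "D powr q"])
    show "AE z in \<beta>. norm (dist (J (fst z)) (J (snd z)) powr q) \<le> D powr q"
      using AE_\<beta>
    proof eventually_elim
      case (elim z)
      then have "dist (J (fst z)) (J (snd z)) \<le> D" by (intro \<theta>_dist) auto
      then show ?case using q by (auto intro!: powr_mono2)
    qed
  qed measurable
  have "transport_cost q X \<beta> = (\<integral>\<^sup>+z. ennreal (dist (J (fst z)) (J (snd z)) powr q) \<partial>\<beta>)"
    unfolding transport_cost_def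
    by (intro nn_integral_cong) (use \<beta>_space isometric_onD[OF J] in \<open>auto split: prod.split\<close>)
  also have "\<dots> = ennreal (real_cost \<beta>)"
    unfolding real_cost_def by (rule nn_integral_eq_integral[OF i]) simp
  finally show "transport_cost q X \<beta> = ennreal (real_cost \<beta>)" .
qed

text \<open>\<open>sum_K_le\<close> integrated against \<open>\<beta>\<close>: the two remainder
  weights integrate to \<open>a0 \<delta> L L\<close> and \<open>a1 \<delta> L L\<close>, each at
  most \<open>e\<close>, whence \<open>2 * e * D powr q\<close>.\<close>

lemma sum_BK_le:
  assumes gs: "good_scale e \<delta> L"
  shows "(\<Sum>l\<le>L. \<Sum>l'\<le>L. B \<beta> \<delta> L l l' * K \<delta> L l l') \<le> real_cost \<beta> + e + 2 * e * D powr q"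
proof -
  interpret prob_space \<beta> by (rule \<beta>_prob)
  have \<delta>: "\<delta> > 0" using gs by (simp add: good_scale_def)
  note [measurable] = c_\<beta>_measurable[OF \<delta>]
  have ic: "integrable \<beta> (\<lambda>z. c \<delta> L l (J (fst z)))" "integrable \<beta> (\<lambda>z. c \<delta> L l (J (snd z)))" for l
    by (rule integrable_const_bound[of _ 1]; simp add: c_bounds)+
  have "(\<Sum>l\<le>L. \<Sum>l'\<le>L. B \<beta> \<delta> L l l' * K \<delta> L l l')
    = (\<integral>z. (\<Sum>l\<le>L. \<Sum>l'\<le>L. c \<delta> L l (J (fst z)) * c \<delta> L l' (J (snd z)) * K \<delta> L l l') \<partial>\<beta>)"
    unfolding B_def
    by (subst Bochner_Integration.integral_sum, intro Bochner_Integration.integrable_sum integrable_mult_left cc_integrable \<delta>,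
        subst Bochner_Integration.integral_sum, intro integrable_mult_left cc_integrable \<delta>, simp)
  also have "\<dots> \<le> (\<integral>z. dist (J (fst z)) (J (snd z)) powr q + e + D powr q * (c \<delta> L L (J (fst z)) + c \<delta> L L (J (snd z))) \<partial>\<beta>)"
  proof (rule integral_mono_AE)
    show "integrable \<beta> (\<lambda>z. \<Sum>l\<le>L. \<Sum>l'\<le>L. c \<delta> L l (J (fst z)) * c \<delta> L l' (J (snd z)) * K \<delta> L l l')"
      by (intro Bochner_Integration.integrable_sum integrable_mult_left cc_integrable \<delta>)
    show "integrable \<beta> (\<lambda>z. dist (J (fst z)) (J (snd z)) powr q + e + D powr q * (c \<delta> L L (J (fst z)) + c \<delta> L L (J (snd z))))"
      by (intro Bochner_Integration.integrable_add integrable_mult_right real_cost_integrable ic integrable_const)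
    show "AE z in \<beta>. (\<Sum>l\<le>L. \<Sum>l'\<le>L. c \<delta> L l (J (fst z)) * c \<delta> L l' (J (snd z)) * K \<delta> L l l')
      \<le> dist (J (fst z)) (J (snd z)) powr q + e + D powr q * (c \<delta> L L (J (fst z)) + c \<delta> L L (J (snd z)))"
      using AE_\<beta> by eventually_elim (rule sum_K_le[OF gs], auto)
  qed
  also have "\<dots> = real_cost \<beta> + e + D powr q * ((\<integral>z. c \<delta> L L (J (fst z)) \<partial>\<beta>) + (\<integral>z. c \<delta> L L (J (snd z)) \<partial>\<beta>))"
    unfolding real_cost_def using real_cost_integrable ic by (simp add: prob_space)
  also have "(\<integral>z. c \<delta> L L (J (fst z)) \<partial>\<beta>) = a0 \<delta> L L"
    unfolding a0_def \<beta>_distr(1)[symmetric]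
    by (rule integral_distr[symmetric, OF \<beta>_proj(1) measurable_compose[OF J_borel c_measurable[OF \<delta>]]])
  also have "(\<integral>z. c \<delta> L L (J (snd z)) \<partial>\<beta>) = a1 \<delta> L L"
    unfolding a1_def \<beta>_distr(2)[symmetric]
    by (rule integral_distr[symmetric, OF \<beta>_proj(2) measurable_compose[OF J_borel c_measurable[OF \<delta>]]])
  also have "D powr q * (a0 \<delta> L L + a1 \<delta> L L) \<le> D powr q * (e + e)"
    using gs by (intro mult_left_mono) (auto simp: good_scale_def)
  finally show ?thesis by (simp add: algebra_simps)
qed

end

end

text \<open>Inside a cell \<open>\<phi>\<close> may be replaced by the constant \<open>b\<close>,
  with an error of the oscillation times the mass of the cell.\<close>

lemma cell_average:
  assumes int: "integrable \<nu> f" and f: "\<And>x. 0 \<le> f x" and \<phi>: "\<phi> \<in> borel_measurable \<nu>" "\<And>x. \<bar>\<phi> x\<bar> \<le> (1::real)"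
    and osc: "\<And>x. f x \<noteq> 0 \<Longrightarrow> \<bar>\<phi> x - b\<bar> \<le> k"
  shows "integrable \<nu> (\<lambda>x. \<phi> x * f x)" "\<bar>(\<integral>x. \<phi> x * f x \<partial>\<nu>) - b * (\<integral>x. f x \<partial>\<nu>)\<bar> \<le> k * (\<integral>x. f x \<partial>\<nu>)"
proof -
  show i: "integrable \<nu> (\<lambda>x. \<phi> x * f x)"
  proof (rule Bochner_Integration.integrable_bound[OF int])
    show "AE x in \<nu>. norm (\<phi> x * f x) \<le> norm (f x)"
      using \<phi>(2) by (intro AE_I2) (simp add: abs_mult mult_left_le_one_le)
  qed (use \<phi> int in auto)
  have "(\<integral>x. \<phi> x * f x \<partial>\<nu>) - b * (\<integral>x. f x \<partial>\<nu>) = (\<integral>x. \<phi> x * f x - b * f x \<partial>\<nu>)"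
    using i int by simp
  also have "\<bar>\<dots>\<bar> \<le> (\<integral>x. \<bar>\<phi> x * f x - b * f x\<bar> \<partial>\<nu>)" by (rule integral_abs_bound)
  also have "\<dots> \<le> (\<integral>x. k * f x \<partial>\<nu>)"
  proof (rule integral_mono)
    show "\<bar>\<phi> x * f x - b * f x\<bar> \<le> k * f x" for x
    proof (cases "f x = 0")
      case False
      have "\<bar>\<phi> x * f x - b * f x\<bar> = \<bar>\<phi> x - b\<bar> * f x"
        using f[of x] by (simp add: left_diff_distrib[symmetric] abs_mult)
      also have "\<dots> \<le> k * f x" using osc[OF False] f[of x] by (rule mult_right_mono)
      finally show ?thesis .
    qed simp
  qed (use i int in auto)
  finally show "\<bar>(\<integral>x. \<phi> x * f x \<partial>\<nu>) - b * (\<integral>x. f x \<partial>\<nu>)\<bar> \<le> k * (\<integral>x. f x \<partial>\<nu>)" by simp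
qed

context transport_pair
begin

section \<open>Integrals of test functions through cell averages\<close>

context
  fixes \<phi> :: "'w \<Rightarrow> real" and \<delta> \<omega> e L
  assumes \<phi>: "test_function \<phi>" and gs: "good_scale e \<delta> L" and \<omega>: "0 \<le> \<omega>"
    and osc: "\<And>u v. dist u v < 2 * \<delta> \<Longrightarrow> \<bar>\<phi> u - \<phi> v\<bar> \<le> \<omega>"
begin

text \<open>A proper cell lies within \<open>2 * \<delta>\<close> of its centre; the remainder cell
  has no such centre, and only the range [0,1] of \<open>\<phi>\<close> is available.\<close>

lemma osc_cell: "c \<delta> L l w \<noteq> 0 \<Longrightarrow> \<bar>\<phi> w - \<phi> (p l)\<bar> \<le> (if l < L then \<omega> else 1)"
  using osc cell_nonzeroD(2)[of \<delta> \<theta> p L l w] gs test_functionD(1,2)[OF \<phi>, of w] test_functionD(1,2)[OF \<phi>, of "p l"]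
  by (auto simp: good_scale_def abs_le_iff)

lemma sum_osc_le:
  assumes a: "\<And>l. 0 \<le> a l" "(\<Sum>l\<le>L. a l) = 1" "a L \<le> e"
  shows "(\<Sum>l\<le>L. (if l < L then \<omega> else 1) * a l) \<le> \<omega> + e"
proof -
  have "{..L} = insert L {..<L}" by auto
  then have "(\<Sum>l\<le>L. (if l < L then \<omega> else 1) * a l) = a L + \<omega> * (\<Sum>l<L. a l)"
    by (simp add: sum_distrib_left)
  moreover have "(\<Sum>l<L. a l) \<le> (\<Sum>l\<le>L. a l)" using a(1) by (intro sum_mono2) auto
  then have "\<omega> * (\<Sum>l<L. a l) \<le> \<omega> * 1" using a(2) \<omega> by (intro mult_left_mono) auto
  ultimately show ?thesis using a(3) by simp
qed

text \<open>The discrete sums at the cell centres are the common term through which integrals on the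
  limit space and on an approximating space are compared.\<close>

lemma integral_cells_\<mu>:
  "\<bar>(\<integral>x. \<phi> (J x) \<partial>\<mu>\<^sub>0) - (\<Sum>l\<le>L. \<phi> (p l) * a0 \<delta> L l)\<bar> \<le> \<omega> + e"
  "\<bar>(\<integral>x. \<phi> (J x) \<partial>\<mu>\<^sub>1) - (\<Sum>l\<le>L. \<phi> (p l) * a1 \<delta> L l)\<bar> \<le> \<omega> + e"
proof -
  have \<delta>: "\<delta> > 0" using gs by (simp add: good_scale_def)
  have [measurable]: "(\<lambda>x. \<phi> (J x)) \<in> borel_measurable m" "(\<lambda>x. \<theta> (J x)) \<in> borel_measurable m"
    by (rule measurable_compose[OF J_meas test_functionD(6)[OF \<phi>]] measurable_compose[OF J_meas test_functionD(6)[OF \<theta>_test]])+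
  have gen: "\<bar>(\<integral>x. \<phi> (J x) \<partial>density m \<rho>) - (\<Sum>l\<le>L. \<phi> (p l) * a l)\<bar> \<le> \<omega> + e"
    if \<rho>: "\<rho> \<in> borel_measurable m" and i: "\<And>l. integrable (density m \<rho>) (\<lambda>x. c \<delta> L l (J x))"
      and a: "\<And>l. a l = (\<integral>x. c \<delta> L l (J x) \<partial>density m \<rho>)" "\<And>l. 0 \<le> a l" "(\<Sum>l\<le>L. a l) = 1" "a L \<le> e"
      and AE: "AE x in density m \<rho>. J x \<in> S" for \<rho> a
  proof -
    note [measurable] = \<rho>
    have ca: "integrable (density m \<rho>) (\<lambda>x. \<phi> (J x) * c \<delta> L l (J x))"
      "\<bar>(\<integral>x. \<phi> (J x) * c \<delta> L l (J x) \<partial>density m \<rho>) - \<phi> (p l) * a l\<bar> \<le> (if l < L then \<omega> else 1) * a l" for l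
      unfolding a(1) using cell_average[of "density m \<rho>" "\<lambda>x. c \<delta> L l (J x)" "\<lambda>x. \<phi> (J x)" "\<phi> (p l)" "if l < L then \<omega> else 1", OF i]
        c_bounds(1) test_functionD(3)[OF \<phi>] osc_cell by auto
    have "(\<integral>x. \<phi> (J x) \<partial>density m \<rho>) = (\<integral>x. (\<Sum>l\<le>L. \<phi> (J x) * c \<delta> L l (J x)) \<partial>density m \<rho>)"
      unfolding sum_distrib_left[symmetric] sum_cell
    proof (intro integral_cong_AE)
      show "AE x in density m \<rho>. \<phi> (J x) = \<phi> (J x) * \<theta> (J x)"
        using AE by eventually_elim (simp add: \<theta>_S)
    qed measurable
    also have "\<dots> = (\<Sum>l\<le>L. \<integral>x. \<phi> (J x) * c \<delta> L l (J x) \<partial>density m \<rho>)"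
      by (rule Bochner_Integration.integral_sum) (rule ca)
    finally have "(\<integral>x. \<phi> (J x) \<partial>density m \<rho>) - (\<Sum>l\<le>L. \<phi> (p l) * a l)
      = (\<Sum>l\<le>L. (\<integral>x. \<phi> (J x) * c \<delta> L l (J x) \<partial>density m \<rho>) - \<phi> (p l) * a l)"
      by (simp add: sum_subtractf)
    also have "\<bar>\<dots>\<bar> \<le> (\<Sum>l\<le>L. (if l < L then \<omega> else 1) * a l)"
      by (rule order_trans[OF sum_abs sum_mono]) (rule ca(2))
    also have "\<dots> \<le> \<omega> + e" by (rule sum_osc_le[OF a(2,3,4)])
    finally show ?thesis .
  qed
  show "\<bar>(\<integral>x. \<phi> (J x) \<partial>\<mu>\<^sub>0) - (\<Sum>l\<le>L. \<phi> (p l) * a0 \<delta> L l)\<bar> \<le> \<omega> + e"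
    by (rule gen) (use c_integrable_\<mu>[OF \<delta>] a_nonneg sum_a[OF \<delta>] gs AE_S in \<open>auto simp: a0_def good_scale_def\<close>)
  show "\<bar>(\<integral>x. \<phi> (J x) \<partial>\<mu>\<^sub>1) - (\<Sum>l\<le>L. \<phi> (p l) * a1 \<delta> L l)\<bar> \<le> \<omega> + e"
    by (rule gen) (use c_integrable_\<mu>[OF \<delta>] a_nonneg sum_a[OF \<delta>] gs AE_S in \<open>auto simp: a1_def good_scale_def\<close>)
qed

end

end

text \<open>One approximating space on which the cell masses are already large enough for a density
  bound \<open>M'\<close>; later \<open>M'\<close> is \<open>M\<close> plus a small error.\<close>

locale spread_pair = transport_pair X m J p \<rho>\<^sub>0 \<rho>\<^sub>1 M D q
  for X :: "'b metric" and m :: "'b measure" and J :: "'b \<Rightarrow> 'w::complete_space" and p :: "nat \<Rightarrow> 'w"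
    and \<rho>\<^sub>0 \<rho>\<^sub>1 :: "'b \<Rightarrow> ennreal" and M D q :: real +
  fixes X' :: "'a metric" and m' :: "'a measure" and J' :: "'a \<Rightarrow> 'w" and e \<delta> M' :: real and L :: nat
  assumes mm': "metric_measure_space X' m'" and J': "isometric_on X' J'" and gs: "good_scale e \<delta> L"
    and M': "M' \<ge> 0" and a_le': "\<And>l. l \<le> L \<Longrightarrow> a0 \<delta> L l \<le> M' * (\<integral>x. c \<delta> L l (J' x) \<partial>m')"
      "\<And>l. l \<le> L \<Longrightarrow> a1 \<delta> L l \<le> M' * (\<integral>x. c \<delta> L l (J' x) \<partial>m')"
begin

lemma \<delta>: "\<delta> > 0" and e: "e > 0" using gs by (auto simp: good_scale_def)

abbreviation f where "f l x \<equiv> c \<delta> L l (J' x)"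

sublocale d: discretization m' "{..L}" "\<lambda>l x. f l x"
proof (intro discretization.intro discretization_axioms.intro)
  show "sigma_finite_measure m'" by (rule mm_sigma_finite[OF mm'])
qed (auto intro: c_integrable[OF mm' J' \<delta>] c_bounds)

lemma J'_meas [measurable]: "J' \<in> borel_measurable m'" by (rule mm_isometric_measurable[OF mm' J'])

lemma a_le_mass: "l \<le> L \<Longrightarrow> a0 \<delta> L l \<le> M' * d.mass l" "l \<le> L \<Longrightarrow> a1 \<delta> L l \<le> M' * d.mass l"
  unfolding d.mass_def by (fact a_le')+

lemma a_zero: "l \<le> L \<Longrightarrow> d.mass l = 0 \<Longrightarrow> a0 \<delta> L l = 0" "l \<le> L \<Longrightarrow> d.mass l = 0 \<Longrightarrow> a1 \<delta> L l = 0"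
  using a_le_mass[of l] a_nonneg[of \<delta> L l] by auto

abbreviation "\<sigma>\<^sub>0 x \<equiv> ennreal (d.spread (a0 \<delta> L) x)"
abbreviation "\<sigma>\<^sub>1 x \<equiv> ennreal (d.spread (a1 \<delta> L) x)"

lemma spread_le_\<theta>: "d.spread (a0 \<delta> L) x \<le> M' * \<theta> (J' x)" "d.spread (a1 \<delta> L) x \<le> M' * \<theta> (J' x)"
proof -
  have "d.spread (a0 \<delta> L) x \<le> M' * (\<Sum>l\<le>L. f l x)" "d.spread (a1 \<delta> L) x \<le> M' * (\<Sum>l\<le>L. f l x)"
    by (rule d.spread_le[OF M']; auto intro: a_nonneg a_le_mass)+
  then show "d.spread (a0 \<delta> L) x \<le> M' * \<theta> (J' x)" "d.spread (a1 \<delta> L) x \<le> M' * \<theta> (J' x)"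
    by (simp_all add: sum_cell)
qed

lemma \<sigma>_zero: "\<theta> (J' x) = 0 \<Longrightarrow> \<sigma>\<^sub>0 x = 0" "\<theta> (J' x) = 0 \<Longrightarrow> \<sigma>\<^sub>1 x = 0"
  using spread_le_\<theta>[of x] by (simp_all add: ennreal_neg)

lemma \<sigma>_prob: "density m' \<sigma>\<^sub>0 \<in> borel_prob X'" "density m' \<sigma>\<^sub>1 \<in> borel_prob X'"
  unfolding borel_prob_def
  using d.prob_space_spread[of "a0 \<delta> L"] d.prob_space_spread[of "a1 \<delta> L"] a_nonneg a_zero sum_a[OF \<delta>] mm_sets[OF mm'] by auto

lemma \<sigma>_esssup: "esssup m' \<sigma>\<^sub>0 \<le> ennreal M'" "esssup m' \<sigma>\<^sub>1 \<le> ennreal M'"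
proof -
  have "M' * \<theta> w \<le> M' * 1" for w using M' \<theta>_le1 by (intro mult_left_mono) auto
  then have "\<sigma>\<^sub>0 x \<le> ennreal M'" "\<sigma>\<^sub>1 x \<le> ennreal M'" for x
    using spread_le_\<theta>[of x] by (auto intro!: ennreal_leI elim!: order_trans)
  then show "esssup m' \<sigma>\<^sub>0 \<le> ennreal M'" "esssup m' \<sigma>\<^sub>1 \<le> ennreal M'"
    by (auto intro!: esssup_I)
qed

text \<open>Where \<open>infdist\<close> to \<open>S\<close> exceeds \<open>\<eta>\<close> the
  cutoff, hence the density, vanishes; this region is open, so it contains no point of the
  support.\<close>

lemma msupport_density:
  assumes [measurable]: "\<sigma> \<in> borel_measurable m'" and z: "\<And>x. \<theta> (J' x) = 0 \<Longrightarrow> \<sigma> x = (0::ennreal)"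
    and x: "x \<in> msupport X' (density m' \<sigma>)"
  shows "x \<in> mspace X'" "infdist (J' x) S \<le> \<eta>"
proof -
  show xX: "x \<in> mspace X'" using x by (simp add: msupport_def)
  show "infdist (J' x) S \<le> \<eta>"
  proof (rule ccontr)
    assume "\<not> infdist (J' x) S \<le> \<eta>"
    define U where "U = {y \<in> topspace (mtop X'). J' y \<in> {w. \<eta> < infdist w S}}"
    have "open {w. \<eta> < infdist w S}" by (intro open_Collect_less continuous_intros)
    then have "openin euclidean {w. \<eta> < infdist w S}" by (rule iffD1[OF open_openin])
    then have U: "openin (mtop X') U"
      unfolding U_def by (rule openin_continuous_map_preimage[OF isometric_on_continuous_map[OF J']])
    then have Us: "U \<in> sets m'" using openin_sets_mborel mm_sets[OF mm'] by auto
    have "x \<in> U" using xX \<open>\<not> infdist (J' x) S \<le> \<eta>\<close> by (simp add: U_def)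
    with x U have "emeasure (density m' \<sigma>) U > 0" by (auto simp: msupport_def)
    moreover have "emeasure (density m' \<sigma>) U = (\<integral>\<^sup>+y. \<sigma> y * indicator U y \<partial>m')"
      using Us by (intro emeasure_density) auto
    moreover have "\<sigma> y * indicator U y = 0" for y
      using z[of y] \<theta>_nonzeroD[of "J' y"]
      by (cases "\<theta> (J' y) = 0") (auto simp: U_def indicator_def)
    ultimately show False by simp
  qed
qed

text \<open>Both supports lie in the closed \<open>\<eta>\<close>-neighbourhood of \<open>S\<close>,
  and the choice of \<open>\<eta>\<close> keeps the diameter strictly below \<open>D\<close>; thus
  the profile function is needed only at the original \<open>D\<close>.\<close>

lemma \<sigma>_diam: "mdiam X' (msupport X' (density m' \<sigma>\<^sub>0) \<union> msupport X' (density m' \<sigma>\<^sub>1)) < ennreal D"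
proof -
  have sup: "x \<in> mspace X' \<and> infdist (J' x) S \<le> \<eta>"
    if "x \<in> msupport X' (density m' \<sigma>\<^sub>0) \<union> msupport X' (density m' \<sigma>\<^sub>1)" for x
    using that msupport_density[of \<sigma>\<^sub>0 x] msupport_density[of \<sigma>\<^sub>1 x] \<sigma>_zero by auto
  have "mdiam X' (msupport X' (density m' \<sigma>\<^sub>0) \<union> msupport X' (density m' \<sigma>\<^sub>1)) \<le> ennreal (s + 2 * \<eta>)"
    unfolding mdiam_def
  proof (rule SUP_least)
    fix z assume "z \<in> (msupport X' (density m' \<sigma>\<^sub>0) \<union> msupport X' (density m' \<sigma>\<^sub>1)) \<times> (msupport X' (density m' \<sigma>\<^sub>0) \<union> msupport X' (density m' \<sigma>\<^sub>1))"
    then obtain x y where z: "z = (x, y)" and xy: "x \<in> mspace X'" "infdist (J' x) S \<le> \<eta>" "y \<in> mspace X'" "infdist (J' y) S \<le> \<eta>"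
      using sup by blast
    then show "(case z of (x, y) \<Rightarrow> ennreal (mdist X' x y)) \<le> ennreal (s + 2 * \<eta>)"
      using near_S_\<eta>[OF xy(2,4)] isometric_onD[OF J' xy(1,3)] by (simp add: ennreal_leI)
  qed
  also have "\<dots> < ennreal D" using \<eta> s(1) by (intro ennreal_lessI) auto
  finally show ?thesis .
qed

text \<open>Both integrals are within \<open>\<omega> + e\<close> of the same sum over cell
  centres.\<close>

lemma integral_spread_close:
  assumes \<phi>: "test_function \<phi>" and \<omega>: "0 \<le> \<omega>" and osc: "\<And>u v. dist u v < 2 * \<delta> \<Longrightarrow> \<bar>\<phi> u - \<phi> v\<bar> \<le> \<omega>"
  shows "\<bar>(\<integral>x. \<phi> (J' x) \<partial>density m' \<sigma>\<^sub>0) - (\<integral>x. \<phi> (J x) \<partial>\<mu>\<^sub>0)\<bar> \<le> 2 * \<omega> + 2 * e"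
    "\<bar>(\<integral>x. \<phi> (J' x) \<partial>density m' \<sigma>\<^sub>1) - (\<integral>x. \<phi> (J x) \<partial>\<mu>\<^sub>1)\<bar> \<le> 2 * \<omega> + 2 * e"
proof -
  have [measurable]: "(\<lambda>x. \<phi> (J' x)) \<in> borel_measurable m'"
    by (rule measurable_compose[OF J'_meas test_functionD(6)[OF \<phi>]])
  have ca: "integrable m' (\<lambda>x. \<phi> (J' x) * f l x)"
    "\<bar>(\<integral>x. \<phi> (J' x) * f l x \<partial>m') - \<phi> (p l) * d.mass l\<bar> \<le> (if l < L then \<omega> else 1) * d.mass l" for l
    unfolding d.mass_def
    using cell_average[of m' "f l" "\<lambda>x. \<phi> (J' x)" "\<phi> (p l)" "if l < L then \<omega> else 1", OF c_integrable[OF mm' J' \<delta>]]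
      c_bounds(1) test_functionD(3)[OF \<phi>] osc_cell[OF \<phi> gs \<omega> osc] by auto
  have gen: "\<bar>(\<integral>x. \<phi> (J' x) \<partial>density m' (\<lambda>x. ennreal (d.spread a x))) - (\<Sum>l\<le>L. \<phi> (p l) * a l)\<bar> \<le> \<omega> + e"
    if a: "\<And>l. 0 \<le> a l" "(\<Sum>l\<le>L. a l) = 1" "a L \<le> e" "\<And>l. l \<le> L \<Longrightarrow> d.mass l = 0 \<Longrightarrow> a l = 0" for a
  proof -
    have "(\<integral>x. \<phi> (J' x) \<partial>density m' (\<lambda>x. ennreal (d.spread a x))) = (\<Sum>l\<le>L. a l / d.mass l * (\<integral>x. \<phi> (J' x) * f l x \<partial>m'))"
      by (rule d.integral_density_spread) (use a ca in auto)
    then have "(\<integral>x. \<phi> (J' x) \<partial>density m' (\<lambda>x. ennreal (d.spread a x))) - (\<Sum>l\<le>L. \<phi> (p l) * a l)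
      = (\<Sum>l\<le>L. a l / d.mass l * (\<integral>x. \<phi> (J' x) * f l x \<partial>m') - \<phi> (p l) * a l)"
      by (simp add: sum_subtractf)
    also have "\<bar>\<dots>\<bar> \<le> (\<Sum>l\<le>L. (if l < L then \<omega> else 1) * a l)"
    proof (rule order_trans[OF sum_abs sum_mono])
      fix l assume "l \<in> {..L}"
      then have l: "l \<le> L" by simp
      show "\<bar>a l / d.mass l * (\<integral>x. \<phi> (J' x) * f l x \<partial>m') - \<phi> (p l) * a l\<bar> \<le> (if l < L then \<omega> else 1) * a l"
      proof (cases "d.mass l = 0")
        case True
        then show ?thesis using a(4)[OF l] by simp
      next
        case False
        then have pos: "d.mass l > 0" using d.mass_nonneg[of l] l by simp
        let ?d = "(\<integral>x. \<phi> (J' x) * f l x \<partial>m') - \<phi> (p l) * d.mass l"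
        have "a l / d.mass l * (\<integral>x. \<phi> (J' x) * f l x \<partial>m') - \<phi> (p l) * a l = a l / d.mass l * ?d"
          using pos by (simp add: field_simps)
        then have "\<bar>a l / d.mass l * (\<integral>x. \<phi> (J' x) * f l x \<partial>m') - \<phi> (p l) * a l\<bar> = a l / d.mass l * \<bar>?d\<bar>"
          using pos a(1)[of l] by (simp add: abs_mult)
        also have "\<dots> \<le> a l / d.mass l * ((if l < L then \<omega> else 1) * d.mass l)"
          by (rule mult_left_mono[OF ca(2)[of l] divide_nonneg_pos[OF a(1)[of l] pos]])
        also have "\<dots> = (if l < L then \<omega> else 1) * a l" using pos by simp
        finally show ?thesis .
      qed
    qed
    also have "\<dots> \<le> \<omega> + e" by (rule sum_osc_le[OF \<phi> gs \<omega> osc a(1,2,3)])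
    finally show ?thesis .
  qed
  have aL: "a0 \<delta> L L \<le> e" "a1 \<delta> L L \<le> e" using gs by (simp_all add: good_scale_def)
  have g: "\<bar>(\<integral>x. \<phi> (J' x) \<partial>density m' \<sigma>\<^sub>0) - (\<Sum>l\<le>L. \<phi> (p l) * a0 \<delta> L l)\<bar> \<le> \<omega> + e"
    "\<bar>(\<integral>x. \<phi> (J' x) \<partial>density m' \<sigma>\<^sub>1) - (\<Sum>l\<le>L. \<phi> (p l) * a1 \<delta> L l)\<bar> \<le> \<omega> + e"
    by (rule gen[OF a_nonneg(1) sum_a(1)[OF \<delta>] aL(1) a_zero(1)] gen[OF a_nonneg(2) sum_a(2)[OF \<delta>] aL(2) a_zero(2)]; assumption)+
  show "\<bar>(\<integral>x. \<phi> (J' x) \<partial>density m' \<sigma>\<^sub>0) - (\<integral>x. \<phi> (J x) \<partial>\<mu>\<^sub>0)\<bar> \<le> 2 * \<omega> + 2 * e"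
    using g(1) integral_cells_\<mu>(1)[OF \<phi> gs \<omega> osc] by linarith
  show "\<bar>(\<integral>x. \<phi> (J' x) \<partial>density m' \<sigma>\<^sub>1) - (\<integral>x. \<phi> (J x) \<partial>\<mu>\<^sub>1)\<bar> \<le> 2 * \<omega> + 2 * e"
    using g(2) integral_cells_\<mu>(2)[OF \<phi> gs \<omega> osc] by linarith
qed

text \<open>Optimality is used against the coupling obtained by discretising \<open>\<beta>\<close>
  and spreading it on \<open>X'\<close>; its cost is estimated cell by cell through
  \<open>K\<close>.\<close>

lemma optimal_cost_le:
  assumes opt: "optimal_coupling q X' (density m' \<sigma>\<^sub>0) (density m' \<sigma>\<^sub>1) \<alpha>" and \<beta>: "\<beta> \<in> couplings X \<mu>\<^sub>0 \<mu>\<^sub>1"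
  shows "transport_cost q X' \<alpha> \<le> ennreal (real_cost \<beta> + e + 2 * e * D powr q)"
proof -
  let ?B = "B \<beta> \<delta> L"
  define \<beta>' where "\<beta>' = density (m' \<Otimes>\<^sub>M m') (\<lambda>z. ennreal (d.spread2 ?B z))"
  note sp = B_nonneg[OF \<beta>] B_sums[OF \<beta> \<delta>] a_zero
  have s': "sets m' = sets (mborel X')" by (rule mm_sets[OF mm'])
  have "\<beta>' \<in> couplings X' (density m' \<sigma>\<^sub>0) (density m' \<sigma>\<^sub>1)"
    unfolding couplings_def
  proof (intro CollectI conjI)
    show "sets \<beta>' = sets (mborel X' \<Otimes>\<^sub>M mborel X')"
      unfolding \<beta>'_def using sets_pair_measure_cong[OF s' s'] by simp
    have "distr \<beta>' (mborel X') fst = distr \<beta>' m' fst" by (rule distr_cong) (use s' in auto)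
    also have "\<dots> = density m' \<sigma>\<^sub>0" unfolding \<beta>'_def by (rule d.distr_spread2_fst[where a = "a0 \<delta> L" and b = "a1 \<delta> L"]) (use sp in auto)
    finally show "distr \<beta>' (mborel X') fst = density m' \<sigma>\<^sub>0" .
    have "distr \<beta>' (mborel X') snd = distr \<beta>' m' snd" by (rule distr_cong) (use s' in auto)
    also have "\<dots> = density m' \<sigma>\<^sub>1" unfolding \<beta>'_def by (rule d.distr_spread2_snd[where a = "a0 \<delta> L" and b = "a1 \<delta> L"]) (use sp in auto)
    finally show "distr \<beta>' (mborel X') snd = density m' \<sigma>\<^sub>1" .
  qed
  then have "transport_cost q X' \<alpha> \<le> transport_cost q X' \<beta>'"
    using opt by (auto simp: optimal_coupling_def)
  also have "\<dots> \<le> ennreal (\<Sum>l\<in>{..L}. \<Sum>l'\<in>{..L}. ?B l l' * K \<delta> L l l')"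
    unfolding transport_cost_def \<beta>'_def
  proof (rule d.nn_integral_spread2_le[where a = "a0 \<delta> L" and b = "a1 \<delta> L"])
    have [measurable]: "(\<lambda>z. case z of (x, y) \<Rightarrow> mdist X' x y) \<in> borel_measurable (m' \<Otimes>\<^sub>M m')"
      using borel_measurable_mdist[OF mm_separable[OF mm']]
      by (simp add: measurable_cong_sets[OF sets_pair_measure_cong[OF s' s'] refl])
    have "(\<lambda>z. ennreal ((case z of (x, y) \<Rightarrow> mdist X' x y) powr q)) \<in> borel_measurable (m' \<Otimes>\<^sub>M m')"
      by measurable
    then show "(\<lambda>(x, y). ennreal (mdist X' x y powr q)) \<in> borel_measurable (m' \<Otimes>\<^sub>M m')"
      by (simp add: case_prod_beta')
    fix l l' x y assume "x \<in> space m'" "y \<in> space m'" "f l x \<noteq> 0" "f l' y \<noteq> 0"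
    then show "(case (x, y) of (x, y) \<Rightarrow> ennreal (mdist X' x y powr q)) \<le> ennreal (K \<delta> L l l')"
      using powr_dist_le_K[OF \<delta>, of L l "J' x" l' "J' y"] isometric_onD[OF J', of x y] mm_space[OF mm']
      by (simp add: ennreal_leI)
  qed (use sp K_nonneg in auto)
  also have "\<dots> \<le> ennreal (real_cost \<beta> + e + 2 * e * D powr q)"
    by (intro ennreal_leI sum_BK_le[OF \<beta> gs])
  finally show ?thesis .
qed

text \<open>The density bound from BIP is recorded as an inequality of integrals at each time, a
  form that passes through the embedding and through weak limits.\<close>

lemma approximate_plan:
  assumes BIP: "has_BIP X' m' C'"
  obtains \<pi> where "\<pi> \<in> borel_prob (Geo X')"
    and "\<And>t g. t \<in> {0..1} \<Longrightarrow> g \<in> borel_measurable (mborel X') \<Longrightarrow>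
      (\<integral>\<^sup>+\<gamma>. g (\<gamma> t) \<partial>\<pi>) \<le> ennreal (C' q D * M') * (\<integral>\<^sup>+x. g x \<partial>m')"
    and "AE \<gamma> in \<pi>. \<theta> (J' (\<gamma> 0)) \<noteq> 0 \<and> \<theta> (J' (\<gamma> 1)) \<noteq> 0"
    and "\<And>\<phi> \<omega>. test_function \<phi> \<Longrightarrow> 0 \<le> \<omega> \<Longrightarrow> (\<And>u v. dist u v < 2 * \<delta> \<Longrightarrow> \<bar>\<phi> u - \<phi> v\<bar> \<le> \<omega>) \<Longrightarrow>
      \<bar>(\<integral>\<gamma>. \<phi> (J' (\<gamma> 0)) \<partial>\<pi>) - (\<integral>x. \<phi> (J x) \<partial>\<mu>\<^sub>0)\<bar> \<le> 2 * \<omega> + 2 * e \<and>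
      \<bar>(\<integral>\<gamma>. \<phi> (J' (\<gamma> 1)) \<partial>\<pi>) - (\<integral>x. \<phi> (J x) \<partial>\<mu>\<^sub>1)\<bar> \<le> 2 * \<omega> + 2 * e"
    and "\<And>\<beta>. \<beta> \<in> couplings X \<mu>\<^sub>0 \<mu>\<^sub>1 \<Longrightarrow>
      (\<integral>\<^sup>+\<gamma>. ennreal (dist (J' (\<gamma> 0)) (J' (\<gamma> 1)) powr q) \<partial>\<pi>) \<le> ennreal (real_cost \<beta> + e + 2 * e * D powr q)"
proof -
  have fin: "esssup m' \<sigma>\<^sub>0 < \<infinity>" "esssup m' \<sigma>\<^sub>1 < \<infinity>"
    using \<sigma>_esssup by (auto intro: le_less_trans)
  have "C' q D \<ge> 1" using BIP q D unfolding has_BIP_def by blast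
  have \<sigma>m: "\<sigma>\<^sub>0 \<in> borel_measurable m'" "\<sigma>\<^sub>1 \<in> borel_measurable m'" by auto
  obtain \<pi> where \<pi>: "\<pi> \<in> OptGeo q X' (density m' \<sigma>\<^sub>0) (density m' \<sigma>\<^sub>1)"
    and dens: "\<forall>t\<in>{0..1}. \<exists>\<rho>\<^sub>t\<in>borel_measurable m'. distr \<pi> (mborel X') (\<lambda>\<gamma>. \<gamma> t) = density m' \<rho>\<^sub>t \<and>
        esssup m' \<rho>\<^sub>t \<le> ennreal (C' q D) * max (esssup m' \<sigma>\<^sub>0) (esssup m' \<sigma>\<^sub>1)"
    using BIP q D \<sigma>m \<sigma>_prob fin \<sigma>_diam unfolding has_BIP_def by blast
  have \<pi>b: "\<pi> \<in> borel_prob (Geo X')" using \<pi> by (simp add: OptGeo_def)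
  have opt: "optimal_coupling q X' (density m' \<sigma>\<^sub>0) (density m' \<sigma>\<^sub>1) (distr \<pi> (mborel X' \<Otimes>\<^sub>M mborel X') (\<lambda>\<gamma>. (\<gamma> 0, \<gamma> 1)))"
    using \<pi> by (simp add: OptGeo_def)
  have \<pi>s: "sets \<pi> = sets (mborel (Geo X'))" using \<pi>b by (simp add: borel_prob_def)
  have ev: "(\<lambda>\<gamma>. \<gamma> t) \<in> \<pi> \<rightarrow>\<^sub>M mborel X'" if "t \<in> {0..1}" for t
    unfolding measurable_cong_sets[OF \<pi>s refl] by (rule Geo_eval_measurable[OF that])
  have ev01: "(\<lambda>\<gamma>. \<gamma> 0) \<in> \<pi> \<rightarrow>\<^sub>M mborel X'" "(\<lambda>\<gamma>. \<gamma> 1) \<in> \<pi> \<rightarrow>\<^sub>M mborel X'" by (rule ev, simp)+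
  have ev2: "(\<lambda>\<gamma>. (\<gamma> 0, \<gamma> 1)) \<in> \<pi> \<rightarrow>\<^sub>M mborel X' \<Otimes>\<^sub>M mborel X'"
    using ev01 by (rule measurable_Pair)
  have d0: "distr \<pi> (mborel X') (\<lambda>\<gamma>. \<gamma> 0) = density m' \<sigma>\<^sub>0" and d1: "distr \<pi> (mborel X') (\<lambda>\<gamma>. \<gamma> 1) = density m' \<sigma>\<^sub>1"
  proof -
    have "distr (distr \<pi> (mborel X' \<Otimes>\<^sub>M mborel X') (\<lambda>\<gamma>. (\<gamma> 0, \<gamma> 1))) (mborel X') fst = density m' \<sigma>\<^sub>0"
      "distr (distr \<pi> (mborel X' \<Otimes>\<^sub>M mborel X') (\<lambda>\<gamma>. (\<gamma> 0, \<gamma> 1))) (mborel X') snd = density m' \<sigma>\<^sub>1"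
      using opt by (auto simp: optimal_coupling_def couplings_def)
    then show "distr \<pi> (mborel X') (\<lambda>\<gamma>. \<gamma> 0) = density m' \<sigma>\<^sub>0" "distr \<pi> (mborel X') (\<lambda>\<gamma>. \<gamma> 1) = density m' \<sigma>\<^sub>1"
      using ev2 by (auto simp: distr_distr comp_def)
  qed
  have J'b: "J' \<in> borel_measurable (mborel X')" by (rule isometric_on_measurable[OF J'])
  show ?thesis
  proof (rule that[OF \<pi>b])
    fix t :: real and g :: "'a \<Rightarrow> ennreal" assume t: "t \<in> {0..1}" and g: "g \<in> borel_measurable (mborel X')"
    then have gm: "g \<in> borel_measurable m'" by (simp add: measurable_cong_sets[OF mm_sets[OF mm'] refl])
    obtain \<rho>\<^sub>t where [measurable]: "\<rho>\<^sub>t \<in> borel_measurable m'" and \<rho>t: "distr \<pi> (mborel X') (\<lambda>\<gamma>. \<gamma> t) = density m' \<rho>\<^sub>t"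
      "esssup m' \<rho>\<^sub>t \<le> ennreal (C' q D) * max (esssup m' \<sigma>\<^sub>0) (esssup m' \<sigma>\<^sub>1)"
      using dens t by blast
    have "max (esssup m' \<sigma>\<^sub>0) (esssup m' \<sigma>\<^sub>1) \<le> ennreal M'" using \<sigma>_esssup by simp
    then have "esssup m' \<rho>\<^sub>t \<le> ennreal (C' q D) * ennreal M'"
      by (rule order_trans[OF \<rho>t(2) mult_left_mono]) simp
    also have "\<dots> = ennreal (C' q D * M')" using \<open>C' q D \<ge> 1\<close> M' by (simp add: ennreal_mult)
    finally have ess: "esssup m' \<rho>\<^sub>t \<le> ennreal (C' q D * M')" .
    have "AE x in m'. \<rho>\<^sub>t x \<le> esssup m' \<rho>\<^sub>t" by (rule esssup_AE)
    then have le: "AE x in m'. \<rho>\<^sub>t x \<le> ennreal (C' q D * M')"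
      by eventually_elim (rule order_trans[OF _ ess])
    have "(\<integral>\<^sup>+\<gamma>. g (\<gamma> t) \<partial>\<pi>) = (\<integral>\<^sup>+x. g x \<partial>density m' \<rho>\<^sub>t)"
      unfolding \<rho>t(1)[symmetric] by (rule nn_integral_distr[OF ev[OF t], symmetric]) (simp add: g)
    also have "\<dots> = (\<integral>\<^sup>+x. \<rho>\<^sub>t x * g x \<partial>m')" using gm by (intro nn_integral_density) auto
    also have "\<dots> \<le> (\<integral>\<^sup>+x. ennreal (C' q D * M') * g x \<partial>m')"
    proof (rule nn_integral_mono_AE)
      show "AE x in m'. \<rho>\<^sub>t x * g x \<le> ennreal (C' q D * M') * g x"
        using le by eventually_elim (simp add: mult_right_mono)
    qed
    also have "\<dots> = ennreal (C' q D * M') * (\<integral>\<^sup>+x. g x \<partial>m')" using gm by (intro nn_integral_cmult)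
    finally show "(\<integral>\<^sup>+\<gamma>. g (\<gamma> t) \<partial>\<pi>) \<le> ennreal (C' q D * M') * (\<integral>\<^sup>+x. g x \<partial>m')" .
  next
    have nz0: "AE x in distr \<pi> (mborel X') (\<lambda>\<gamma>. \<gamma> 0). \<theta> (J' x) \<noteq> 0"
      unfolding d0 AE_density[OF \<sigma>m(1)]
    proof (intro AE_I2 impI notI)
      fix x assume "0 < \<sigma>\<^sub>0 x" "\<theta> (J' x) = 0"
      then show False using \<sigma>_zero(1)[of x] by (simp only: less_irrefl)
    qed
    have nz1: "AE x in distr \<pi> (mborel X') (\<lambda>\<gamma>. \<gamma> 1). \<theta> (J' x) \<noteq> 0"
      unfolding d1 AE_density[OF \<sigma>m(2)]
    proof (intro AE_I2 impI notI)
      fix x assume "0 < \<sigma>\<^sub>1 x" "\<theta> (J' x) = 0"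
      then show False using \<sigma>_zero(2)[of x] by (simp only: less_irrefl)
    qed
    show "AE \<gamma> in \<pi>. \<theta> (J' (\<gamma> 0)) \<noteq> 0 \<and> \<theta> (J' (\<gamma> 1)) \<noteq> 0"
      using AE_distrD[OF ev01(1) nz0] AE_distrD[OF ev01(2) nz1] by eventually_elim (rule conjI)
  next
    fix \<phi> :: "'w \<Rightarrow> real" and \<omega> assume \<phi>: "test_function \<phi>" and h: "0 \<le> \<omega>" "\<And>u v. dist u v < 2 * \<delta> \<Longrightarrow> \<bar>\<phi> u - \<phi> v\<bar> \<le> \<omega>"
    have \<phi>J: "(\<lambda>x. \<phi> (J' x)) \<in> borel_measurable (mborel X')"
      by (rule measurable_compose[OF J'b test_functionD(6)[OF \<phi>]])
    have "(\<integral>\<gamma>. \<phi> (J' (\<gamma> 0)) \<partial>\<pi>) = (\<integral>x. \<phi> (J' x) \<partial>density m' \<sigma>\<^sub>0)"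
      "(\<integral>\<gamma>. \<phi> (J' (\<gamma> 1)) \<partial>\<pi>) = (\<integral>x. \<phi> (J' x) \<partial>density m' \<sigma>\<^sub>1)"
      unfolding d0[symmetric] d1[symmetric] by (rule integral_distr[OF _ \<phi>J, symmetric]; rule ev01)+
    then show "\<bar>(\<integral>\<gamma>. \<phi> (J' (\<gamma> 0)) \<partial>\<pi>) - (\<integral>x. \<phi> (J x) \<partial>\<mu>\<^sub>0)\<bar> \<le> 2 * \<omega> + 2 * e \<and>
      \<bar>(\<integral>\<gamma>. \<phi> (J' (\<gamma> 1)) \<partial>\<pi>) - (\<integral>x. \<phi> (J x) \<partial>\<mu>\<^sub>1)\<bar> \<le> 2 * \<omega> + 2 * e"
      using integral_spread_close[OF \<phi> h] by simp
  next
    fix \<beta> assume \<beta>: "\<beta> \<in> couplings X \<mu>\<^sub>0 \<mu>\<^sub>1"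
    have mm2: "(\<lambda>z. ennreal ((case z of (x, y) \<Rightarrow> mdist X' x y) powr q)) \<in> borel_measurable (mborel X' \<Otimes>\<^sub>M mborel X')"
      by (rule measurable_compose[OF borel_measurable_mdist[OF mm_separable[OF mm']]]) measurable
    have sp: "\<gamma> 0 \<in> mspace X' \<and> \<gamma> 1 \<in> mspace X'" if "\<gamma> \<in> space \<pi>" for \<gamma>
      using measurable_space[OF ev01(1) that] measurable_space[OF ev01(2) that] by simp
    have "(\<integral>\<^sup>+\<gamma>. ennreal (dist (J' (\<gamma> 0)) (J' (\<gamma> 1)) powr q) \<partial>\<pi>)
      = (\<integral>\<^sup>+\<gamma>. ennreal ((case (\<gamma> 0, \<gamma> 1) of (x, y) \<Rightarrow> mdist X' x y) powr q) \<partial>\<pi>)"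
      using sp isometric_onD[OF J'] by (intro nn_integral_cong) auto
    also have "\<dots> = transport_cost q X' (distr \<pi> (mborel X' \<Otimes>\<^sub>M mborel X') (\<lambda>\<gamma>. (\<gamma> 0, \<gamma> 1)))"
      unfolding transport_cost_def case_prod_beta'
      by (rule nn_integral_distr[OF ev2, symmetric]) (use mm2 in \<open>simp add: case_prod_beta'\<close>)
    also have "\<dots> \<le> ennreal (real_cost \<beta> + e + 2 * e * D powr q)"
      by (rule optimal_cost_le[OF opt \<beta>])
    finally show "(\<integral>\<^sup>+\<gamma>. ennreal (dist (J' (\<gamma> 0)) (J' (\<gamma> 1)) powr q) \<partial>\<pi>) \<le> ennreal (real_cost \<beta> + e + 2 * e * D powr q)" .
  qed
qed

end

section \<open>Passage to the limit\<close>

text \<open>The power of the distance is in general neither bounded nor uniformly continuous. The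
  cap at \<open>D\<close> repairs both and changes nothing on geodesics of length at most
  \<open>D\<close>.\<close>

lemma unif_cont2_capped_powr:
  assumes "q > 0" "D \<ge> 0"
  shows "unif_cont2 (\<lambda>u v :: 'w::metric_space. min (dist u v) D powr q)"
  unfolding unif_cont2_def
proof (intro allI impI)
  fix e :: real assume e: "e > 0"
  have "continuous_on {0..D} (\<lambda>u. u powr q)"
    using assms by (intro continuous_on_powr' continuous_intros) auto
  then have "uniformly_continuous_on {0..D} (\<lambda>u. u powr q)"
    by (rule compact_uniformly_continuous) simp
  then obtain d where d: "d > 0"
    "\<And>a b. a \<in> {0..D} \<Longrightarrow> b \<in> {0..D} \<Longrightarrow> dist a b < d \<Longrightarrow> dist (a powr q) (b powr q) < e"
    using e unfolding uniformly_continuous_on_def by metis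
  have close: "\<bar>min (dist u v) D powr q - min (dist u' v') D powr q\<bar> < e"
    if "dist u u' < d / 2" "dist v v' < d / 2" for u u' v v' :: 'w
  proof -
    have "\<bar>dist u v - dist u' v'\<bar> < d"
      using that dist_triangle[of u v u'] dist_triangle[of u' v v'] dist_triangle[of u' v' u] dist_triangle[of u v' v]
      by (simp add: dist_commute abs_less_iff)
    then have "\<bar>min (dist u v) D - min (dist u' v') D\<bar> < d" by linarith
    then show ?thesis using d(2)[of "min (dist u v) D" "min (dist u' v') D"] assms(2)
      by (simp add: dist_real_def)
  qed
  show "\<exists>d>0. \<forall>(u::'w) u' v v'. dist u u' < d \<longrightarrow> dist v v' < d \<longrightarrow>
      \<bar>min (dist u v) D powr q - min (dist u' v') D powr q\<bar> < e"
  proof (intro exI[of _ "d / 2"] conjI allI impI)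
    show "d / 2 > 0" using d(1) by simp
    fix u u' v v' :: 'w assume "dist u u' < d / 2" "dist v v' < d / 2"
    then show "\<bar>min (dist u v) D powr q - min (dist u' v') D powr q\<bar> < e" by (rule close)
  qed
qed

text \<open>\<open>q\<close> and \<open>D\<close> are fixed from here on, and \<open>C\<close>
  stands for the single value of the limiting profile function at them.\<close>

locale plan_limit = transport_pair X m J p \<rho>\<^sub>0 \<rho>\<^sub>1 M D q
  for X :: "'b metric" and m :: "'b measure" and J :: "'b \<Rightarrow> 'w::complete_space" and p :: "nat \<Rightarrow> 'w"
    and \<rho>\<^sub>0 \<rho>\<^sub>1 :: "'b \<Rightarrow> ennreal" and M D q :: real +
  fixes X' :: "nat \<Rightarrow> 'a metric" and m' :: "nat \<Rightarrow> 'a measure" and J' :: "nat \<Rightarrow> 'a \<Rightarrow> 'w"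
    and C' :: "nat \<Rightarrow> real \<Rightarrow> real \<Rightarrow> real" and C :: real
  assumes mm': "\<And>n. metric_measure_space (X' n) (m' n)" and J': "\<And>n. isometric_on (X' n) (J' n)"
    and dense': "\<And>n x. x \<in> mspace (X' n) \<Longrightarrow> J' n x \<in> closure (range p)"
    and conv: "\<And>\<phi> :: 'w \<Rightarrow> real. continuous_on UNIV \<phi> \<Longrightarrow> bounded (range \<phi>) \<Longrightarrow> bounded {w. \<phi> w \<noteq> 0} \<Longrightarrow>
      (\<lambda>n. \<integral>x. \<phi> (J' n x) \<partial>m' n) \<longlonglongrightarrow> (\<integral>x. \<phi> (J x) \<partial>m)"
    and BIP: "\<And>n. has_BIP (X' n) (m' n) (C' n)"
    and C: "limsup (\<lambda>n. ereal (C' n q D)) \<le> ereal C"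
begin

lemma C'_ge1: "C' n q D \<ge> 1"
  using BIP[of n] q D unfolding has_BIP_def by blast

lemma C_ge1: "C \<ge> 1"
proof -
  have "ereal 1 \<le> limsup (\<lambda>n. ereal (C' n q D))"
    using C'_ge1 by (intro le_Limsup) auto
  with C show ?thesis by (metis ereal_less_eq(3) order_trans)
qed

text \<open>All errors are expressed by 1 / Suc k, and \<open>k \<le> n\<close> forces the index of
  the space to infinity, so one limit in \<open>k\<close> handles everything.\<close>

definition plan_at where
  "plan_at k n \<delta> \<pi> \<longleftrightarrow> k \<le> n \<and> \<delta> \<le> 1 / Suc k \<and> \<pi> \<in> borel_prob (Geo (X' n)) \<and>
     (\<forall>t\<in>{0..1}. \<forall>g\<in>borel_measurable (mborel (X' n)).
       (\<integral>\<^sup>+\<gamma>. g (\<gamma> t) \<partial>\<pi>) \<le> ennreal ((C + 1 / Suc k) * (M + 1 / Suc k)) * (\<integral>\<^sup>+x. g x \<partial>m' n)) \<and>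
     (AE \<gamma> in \<pi>. \<theta> (J' n (\<gamma> 0)) \<noteq> 0 \<and> \<theta> (J' n (\<gamma> 1)) \<noteq> 0) \<and>
     (\<forall>\<phi> \<omega>. test_function \<phi> \<longrightarrow> 0 \<le> \<omega> \<longrightarrow> (\<forall>u v. dist u v < 2 * \<delta> \<longrightarrow> \<bar>\<phi> u - \<phi> v\<bar> \<le> \<omega>) \<longrightarrow>
      \<bar>(\<integral>\<gamma>. \<phi> (J' n (\<gamma> 0)) \<partial>\<pi>) - (\<integral>x. \<phi> (J x) \<partial>\<mu>\<^sub>0)\<bar> \<le> 2 * \<omega> + 2 * (1 / Suc k) \<and>
      \<bar>(\<integral>\<gamma>. \<phi> (J' n (\<gamma> 1)) \<partial>\<pi>) - (\<integral>x. \<phi> (J x) \<partial>\<mu>\<^sub>1)\<bar> \<le> 2 * \<omega> + 2 * (1 / Suc k)) \<and>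
     (\<forall>\<beta>\<in>couplings X \<mu>\<^sub>0 \<mu>\<^sub>1. (\<integral>\<^sup>+\<gamma>. ennreal (dist (J' n (\<gamma> 0)) (J' n (\<gamma> 1)) powr q) \<partial>\<pi>)
        \<le> ennreal (real_cost \<beta> + 1 / Suc k + 2 * (1 / Suc k) * D powr q))"

text \<open>If the cell has positive mass in the limit space, the extra \<open>e\<close> gives a
  strict inequality that convergence preserves eventually; if the mass is 0, then
  \<open>a \<le> 0\<close> and the claim is a matter of signs.\<close>

lemma eventually_mass:
  assumes \<delta>: "\<delta> > 0" and e: "e > 0" and a: "a \<le> M * (\<integral>x. c \<delta> L l (J x) \<partial>m)"
  shows "\<forall>\<^sub>F n in sequentially. a \<le> (M + e) * (\<integral>x. c \<delta> L l (J' n x) \<partial>m' n)"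
proof (cases "(\<integral>x. c \<delta> L l (J x) \<partial>m) = 0")
  case True
  have "0 \<le> (\<integral>x. c \<delta> L l (J' n x) \<partial>m' n)" for n by (intro integral_nonneg_AE AE_I2 c_bounds)
  then have "0 \<le> (M + e) * (\<integral>x. c \<delta> L l (J' n x) \<partial>m' n)" for n
    using M(1) e by (intro mult_nonneg_nonneg) simp_all
  moreover have "a \<le> 0" using a unfolding True by simp
  ultimately have "a \<le> (M + e) * (\<integral>x. c \<delta> L l (J' n x) \<partial>m' n)" for n
    by (meson order_trans)
  then show ?thesis by (rule always_eventually[OF allI])
next
  case False
  moreover have "0 \<le> (\<integral>x. c \<delta> L l (J x) \<partial>m)" by (intro integral_nonneg_AE AE_I2 c_bounds)
  ultimately have "M * (\<integral>x. c \<delta> L l (J x) \<partial>m) < (M + e) * (\<integral>x. c \<delta> L l (J x) \<partial>m)"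
    using e by (intro mult_strict_right_mono) auto
  with a have lt: "a < (M + e) * (\<integral>x. c \<delta> L l (J x) \<partial>m)" by (rule le_less_trans)
  have "(\<lambda>n. \<integral>x. c \<delta> L l (J' n x) \<partial>m' n) \<longlonglongrightarrow> (\<integral>x. c \<delta> L l (J x) \<partial>m)"
  proof (rule conv[of "c \<delta> L l"])
    show "continuous_on UNIV (c \<delta> L l)" by (rule continuous_on_cell[OF \<delta> test_functionD(5)[OF \<theta>_test]])
    show "bounded (range (c \<delta> L l))"
      unfolding bounded_iff using c_bounds(3) by (intro exI[of _ 1]) auto
  qed (rule c_bounded[OF \<delta>])
  then have "(\<lambda>n. (M + e) * (\<integral>x. c \<delta> L l (J' n x) \<partial>m' n)) \<longlonglongrightarrow> (M + e) * (\<integral>x. c \<delta> L l (J x) \<partial>m)"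
    by (intro tendsto_intros)
  from order_tendstoD(1)[OF this lt] show ?thesis by eventually_elim simp
qed

text \<open>The scale and the number of cells are fixed first; then only finitely many cell masses
  have to be compared, and a single large \<open>n\<close> serves them all.\<close>

lemma plan_exists: "\<exists>n \<delta> \<pi>. plan_at k n \<delta> \<pi>"
proof -
  let ?e = "1 / real (Suc k)"
  have e: "?e > 0" by simp
  obtain \<delta> L where gs: "good_scale ?e \<delta> L" using good_scale_exists[OF e] by blast
  then have \<delta>: "\<delta> > 0" "\<delta> \<le> ?e" by (auto simp: good_scale_def)
  have "limsup (\<lambda>n. ereal (C' n q D)) < ereal (C + ?e)"
    using C by (rule le_less_trans) simp
  then have "\<forall>\<^sub>F n in sequentially. ereal (C' n q D) < ereal (C + ?e)"
    by (rule Limsup_lessD)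
  moreover have "\<forall>\<^sub>F n in sequentially. \<forall>l\<in>{..L}. a0 \<delta> L l \<le> (M + ?e) * (\<integral>x. c \<delta> L l (J' n x) \<partial>m' n)"
    by (intro eventually_ball_finite ballI eventually_mass[OF \<delta>(1) e] a_le[OF \<delta>(1)]) simp
  moreover have "\<forall>\<^sub>F n in sequentially. \<forall>l\<in>{..L}. a1 \<delta> L l \<le> (M + ?e) * (\<integral>x. c \<delta> L l (J' n x) \<partial>m' n)"
    by (intro eventually_ball_finite ballI eventually_mass[OF \<delta>(1) e] a_le[OF \<delta>(1)]) simp
  moreover have "\<forall>\<^sub>F n in sequentially. k \<le> n" by (rule eventually_ge_at_top)
  ultimately have "\<forall>\<^sub>F n in sequentially. k \<le> n \<and> C' n q D < C + ?e \<and>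
      (\<forall>l\<in>{..L}. a0 \<delta> L l \<le> (M + ?e) * (\<integral>x. c \<delta> L l (J' n x) \<partial>m' n)) \<and>
      (\<forall>l\<in>{..L}. a1 \<delta> L l \<le> (M + ?e) * (\<integral>x. c \<delta> L l (J' n x) \<partial>m' n))"
    by eventually_elim simp
  then obtain n where n: "k \<le> n" "C' n q D < C + ?e"
      "\<And>l. l \<le> L \<Longrightarrow> a0 \<delta> L l \<le> (M + ?e) * (\<integral>x. c \<delta> L l (J' n x) \<partial>m' n)"
      "\<And>l. l \<le> L \<Longrightarrow> a1 \<delta> L l \<le> (M + ?e) * (\<integral>x. c \<delta> L l (J' n x) \<partial>m' n)"
    unfolding eventually_sequentially by blast
  interpret sp: spread_pair X m J p \<rho>\<^sub>0 \<rho>\<^sub>1 M D q "X' n" "m' n" "J' n" ?e \<delta> "M + ?e" L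
    by unfold_locales (use mm' J' gs M(1) n in auto)
  have cm: "(C' n q D) * (M + ?e) \<le> (C + ?e) * (M + ?e)"
    using n(2) M(1) by (intro mult_right_mono) auto
  show ?thesis
  proof (rule sp.approximate_plan[OF BIP])
    fix \<pi> assume \<pi>: "\<pi> \<in> borel_prob (Geo (X' n))"
    and dom: "\<And>t g. t \<in> {0..1} \<Longrightarrow> g \<in> borel_measurable (mborel (X' n)) \<Longrightarrow>
      (\<integral>\<^sup>+\<gamma>. g (\<gamma> t) \<partial>\<pi>) \<le> ennreal (C' n q D * (M + ?e)) * (\<integral>\<^sup>+x. g x \<partial>m' n)"
    and sup: "AE \<gamma> in \<pi>. \<theta> (J' n (\<gamma> 0)) \<noteq> 0 \<and> \<theta> (J' n (\<gamma> 1)) \<noteq> 0"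
    and test: "\<And>\<phi> \<omega>. test_function \<phi> \<Longrightarrow> 0 \<le> \<omega> \<Longrightarrow> (\<And>u v. dist u v < 2 * \<delta> \<Longrightarrow> \<bar>\<phi> u - \<phi> v\<bar> \<le> \<omega>) \<Longrightarrow>
      \<bar>(\<integral>\<gamma>. \<phi> (J' n (\<gamma> 0)) \<partial>\<pi>) - (\<integral>x. \<phi> (J x) \<partial>\<mu>\<^sub>0)\<bar> \<le> 2 * \<omega> + 2 * ?e \<and>
      \<bar>(\<integral>\<gamma>. \<phi> (J' n (\<gamma> 1)) \<partial>\<pi>) - (\<integral>x. \<phi> (J x) \<partial>\<mu>\<^sub>1)\<bar> \<le> 2 * \<omega> + 2 * ?e"
    and cost: "\<And>\<beta>. \<beta> \<in> couplings X \<mu>\<^sub>0 \<mu>\<^sub>1 \<Longrightarrow>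
      (\<integral>\<^sup>+\<gamma>. ennreal (dist (J' n (\<gamma> 0)) (J' n (\<gamma> 1)) powr q) \<partial>\<pi>) \<le> ennreal (real_cost \<beta> + ?e + 2 * ?e * D powr q)"
    have "plan_at k n \<delta> \<pi>"
      unfolding plan_at_def
    proof (intro conjI ballI allI impI)
      show "k \<le> n" "\<delta> \<le> ?e" "\<pi> \<in> borel_prob (Geo (X' n))" by (rule n(1), rule \<delta>(2), rule \<pi>)
      show "AE \<gamma> in \<pi>. \<theta> (J' n (\<gamma> 0)) \<noteq> 0 \<and> \<theta> (J' n (\<gamma> 1)) \<noteq> 0" by (rule sup)
    next
      fix t :: real and g :: "'a \<Rightarrow> ennreal" assume tg: "t \<in> {0..1}" "g \<in> borel_measurable (mborel (X' n))"
      have "(\<integral>\<^sup>+\<gamma>. g (\<gamma> t) \<partial>\<pi>) \<le> ennreal (C' n q D * (M + ?e)) * (\<integral>\<^sup>+x. g x \<partial>m' n)"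
        by (rule dom[OF tg])
      also have "\<dots> \<le> ennreal ((C + ?e) * (M + ?e)) * (\<integral>\<^sup>+x. g x \<partial>m' n)"
        by (rule mult_right_mono[OF ennreal_leI[OF cm]]) simp
      finally show "(\<integral>\<^sup>+\<gamma>. g (\<gamma> t) \<partial>\<pi>) \<le> ennreal ((C + ?e) * (M + ?e)) * (\<integral>\<^sup>+x. g x \<partial>m' n)" .
    next
      fix \<phi> :: "'w \<Rightarrow> real" and \<omega> assume \<phi>: "test_function \<phi>" "0 \<le> \<omega>" "\<forall>u v. dist u v < 2 * \<delta> \<longrightarrow> \<bar>\<phi> u - \<phi> v\<bar> \<le> \<omega>"
      have osc: "\<bar>\<phi> u - \<phi> v\<bar> \<le> \<omega>" if "dist u v < 2 * \<delta>" for u v using \<phi>(3) that by blast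
      from test[OF \<phi>(1,2) osc]
      show "\<bar>(\<integral>\<gamma>. \<phi> (J' n (\<gamma> 0)) \<partial>\<pi>) - (\<integral>x. \<phi> (J x) \<partial>\<mu>\<^sub>0)\<bar> \<le> 2 * \<omega> + 2 * ?e"
        "\<bar>(\<integral>\<gamma>. \<phi> (J' n (\<gamma> 1)) \<partial>\<pi>) - (\<integral>x. \<phi> (J x) \<partial>\<mu>\<^sub>1)\<bar> \<le> 2 * \<omega> + 2 * ?e" by auto
    qed (rule cost)
    then show ?thesis by blast
  qed
qed

section \<open>Domination and tightness along a sequence of chosen plans\<close>

definition e where "e k = 1 / real (Suc k)"

context
  fixes n \<delta> \<pi> assumes plan: "\<And>k. plan_at k (n k) (\<delta> k) (\<pi> k)"
begin

lemma e_pos: "e k > 0" by (simp add: e_def)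

lemma e_lim: "e \<longlonglongrightarrow> 0"
  unfolding e_def using LIMSEQ_inverse_real_of_nat by (simp add: inverse_eq_divide)

lemma n_lim: "filterlim n at_top sequentially"
  by (rule filterlim_at_top_mono[OF filterlim_ident]) (use plan in \<open>auto simp: plan_at_def\<close>)

lemma \<pi>_borel: "\<pi> k \<in> borel_prob (Geo (X' (n k)))" using plan[of k] by (simp add: plan_at_def)

lemma \<pi>_prob: "prob_space (\<pi> k)" and \<pi>_sets: "sets (\<pi> k) = sets (mborel (Geo (X' (n k))))"
  using \<pi>_borel[of k] by (auto simp: borel_prob_def)

lemma \<pi>_space: "space (\<pi> k) = mspace (Geo (X' (n k)))"
  using sets_eq_imp_space_eq[OF \<pi>_sets] by simp

definition crv where "crv k \<gamma> t = J' (n k) (\<gamma> t)" for k and \<gamma> :: "real \<Rightarrow> 'a" and t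

lemma crv_meas: "t \<in> {0..1} \<Longrightarrow> (\<lambda>\<gamma>. crv k \<gamma> t) \<in> borel_measurable (\<pi> k)"
  unfolding crv_def measurable_cong_sets[OF \<pi>_sets refl]
  by (rule measurable_compose[OF Geo_eval_measurable isometric_on_measurable[OF J']])

lemma crv_geodesic: "\<gamma> \<in> space (\<pi> k) \<Longrightarrow> unit_geodesic (crv k \<gamma>)"
proof -
  assume "\<gamma> \<in> space (\<pi> k)"
  then have G: "\<gamma> \<in> mspace (Geo (X' (n k)))" by (simp only: \<pi>_space)
  have d: "dist (crv k \<gamma> s) (crv k \<gamma> t) = mdist (X' (n k)) (\<gamma> s) (\<gamma> t)" if "s \<in> {0..1}" "t \<in> {0..1}" for s t
    unfolding crv_def by (rule isometric_onD[OF J' Geo_in_mspace[OF G that(1)] Geo_in_mspace[OF G that(2)]])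
  have g: "\<forall>s\<in>{0..1}. \<forall>t\<in>{0..1}. mdist (X' (n k)) (\<gamma> s) (\<gamma> t) = \<bar>s - t\<bar> * mdist (X' (n k)) (\<gamma> 0) (\<gamma> 1)"
    using G unfolding mspace_Geo by blast
  show ?thesis
    unfolding unit_geodesic_def
  proof (intro ballI)
    fix s t :: real assume st: "s \<in> {0..1}" "t \<in> {0..1}"
    have "mdist (X' (n k)) (\<gamma> s) (\<gamma> t) = \<bar>s - t\<bar> * mdist (X' (n k)) (\<gamma> 0) (\<gamma> 1)" using g st by blast
    moreover have "dist (crv k \<gamma> 0) (crv k \<gamma> 1) = mdist (X' (n k)) (\<gamma> 0) (\<gamma> 1)" by (rule d) simp_all
    ultimately show "dist (crv k \<gamma> s) (crv k \<gamma> t) = \<bar>s - t\<bar> * dist (crv k \<gamma> 0) (crv k \<gamma> 1)"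
      by (simp only: d[OF st])
  qed
qed

lemma crv_closure: "\<gamma> \<in> space (\<pi> k) \<Longrightarrow> t \<in> {0..1} \<Longrightarrow> crv k \<gamma> t \<in> closure (range p)"
  unfolding crv_def \<pi>_space by (rule dense'[OF Geo_in_mspace])

lemma AE_crv: "AE \<gamma> in \<pi> k. \<theta> (crv k \<gamma> 0) \<noteq> 0 \<and> \<theta> (crv k \<gamma> 1) \<noteq> 0"
  using plan[of k] unfolding plan_at_def crv_def by (elim conjE)

lemma AE_len: "AE \<gamma> in \<pi> k. dist (crv k \<gamma> 0) (crv k \<gamma> 1) \<le> D"
  using AE_crv by eventually_elim (blast intro: \<theta>_dist)

lemma nn_crv_le:
  assumes "t \<in> {0..1}" and g: "g \<in> borel_measurable borel"
  shows "(\<integral>\<^sup>+\<gamma>. g (crv k \<gamma> t) \<partial>\<pi> k) \<le> ennreal ((C + e k) * (M + e k)) * (\<integral>\<^sup>+x. g (J' (n k) x) \<partial>m' (n k))"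
proof -
  have gm: "(\<lambda>x. g (J' (n k) x)) \<in> borel_measurable (mborel (X' (n k)))"
    by (rule measurable_compose[OF isometric_on_measurable[OF J'] g])
  have "\<forall>t\<in>{0..1}. \<forall>g\<in>borel_measurable (mborel (X' (n k))).
       (\<integral>\<^sup>+\<gamma>. g (\<gamma> t) \<partial>\<pi> k) \<le> ennreal ((C + 1 / Suc k) * (M + 1 / Suc k)) * (\<integral>\<^sup>+x. g x \<partial>m' (n k))"
    using plan[of k] unfolding plan_at_def by (elim conjE)
  from bspec[OF bspec[OF this assms(1)] gm] show ?thesis unfolding crv_def e_def .
qed

lemma integral_crv_le:
  assumes t: "t \<in> {0..1}" and f: "continuous_on UNIV f" "\<And>w. 0 \<le> f w" "\<And>w. f w \<le> 1" "bounded {w. f w \<noteq> 0}"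
  shows "(\<integral>\<gamma>. f (crv k \<gamma> t) \<partial>\<pi> k) \<le> (C + e k) * (M + e k) * (\<integral>x. f (J' (n k) x) \<partial>m' (n k))"
proof -
  interpret prob_space "\<pi> k" by (rule \<pi>_prob)
  have fm: "f \<in> borel_measurable borel" by (rule borel_measurable_continuous_onI[OF f(1)])
  have [measurable]: "(\<lambda>\<gamma>. f (crv k \<gamma> t)) \<in> borel_measurable (\<pi> k)"
    by (rule measurable_compose[OF crv_meas[OF t] fm])
  have i1: "integrable (\<pi> k) (\<lambda>\<gamma>. f (crv k \<gamma> t))"
    by (rule integrable_const_bound[of _ 1]) (use f in auto)
  obtain a R where "\<And>w. f w \<noteq> 0 \<Longrightarrow> dist a w \<le> R" using f(4) unfolding bounded_def by blast
  then have i2: "integrable (m' (n k)) (\<lambda>x. f (J' (n k) x))"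
    by (intro mm_integrable[OF mm' J' fm, of 1 a R]) (use f in \<open>auto simp: dist_commute\<close>)
  have nn: "0 \<le> (\<integral>x. f (J' (n k) x) \<partial>m' (n k))" using f(2) by (intro integral_nonneg_AE) auto
  have A: "0 \<le> (C + e k) * (M + e k)" using C_ge1 M(1) e_pos[of k] by (intro mult_nonneg_nonneg) auto
  have "ennreal (\<integral>\<gamma>. f (crv k \<gamma> t) \<partial>\<pi> k) = (\<integral>\<^sup>+\<gamma>. ennreal (f (crv k \<gamma> t)) \<partial>\<pi> k)"
    by (rule nn_integral_eq_integral[OF i1, symmetric]) (simp add: f)
  also have "\<dots> \<le> ennreal ((C + e k) * (M + e k)) * (\<integral>\<^sup>+x. ennreal (f (J' (n k) x)) \<partial>m' (n k))"
    by (rule nn_crv_le[OF t, of "\<lambda>w. ennreal (f w)"]) (use fm in measurable)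
  also have "(\<integral>\<^sup>+x. ennreal (f (J' (n k) x)) \<partial>m' (n k)) = ennreal (\<integral>x. f (J' (n k) x) \<partial>m' (n k))"
    by (rule nn_integral_eq_integral[OF i2]) (simp add: f)
  finally show ?thesis
    unfolding ennreal_mult[OF A nn, symmetric] using mult_nonneg_nonneg[OF A nn] by (simp only: ennreal_le_iff)
qed

lemma conv_n:
  assumes f: "continuous_on UNIV f" "\<And>w. 0 \<le> f w" "\<And>w. f w \<le> 1" "bounded {w. f w \<noteq> 0}"
  shows "(\<lambda>k. (C + e k) * (M + e k) * (\<integral>x. f (J' (n k) x) \<partial>m' (n k))) \<longlonglongrightarrow> C * M * (\<integral>x. f (J x) \<partial>m)"
proof -
  have "bounded (range f)" unfolding bounded_iff using f(2,3) by (intro exI[of _ 1]) auto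
  then have "(\<lambda>n. \<integral>x. f (J' n x) \<partial>m' n) \<longlonglongrightarrow> (\<integral>x. f (J x) \<partial>m)" by (rule conv[OF f(1) _ f(4)])
  then have "(\<lambda>k. \<integral>x. f (J' (n k) x) \<partial>m' (n k)) \<longlonglongrightarrow> (\<integral>x. f (J x) \<partial>m)"
    by (rule filterlim_compose[OF _ n_lim])
  then have "(\<lambda>k. (C + e k) * (M + e k) * (\<integral>x. f (J' (n k) x) \<partial>m' (n k))) \<longlonglongrightarrow> (C + 0) * (M + 0) * (\<integral>x. f (J x) \<partial>m)"
    by (intro tendsto_intros e_lim)
  then show ?thesis by simp
qed

text \<open>\<open>f N\<close> is 1 at curve points far from the first \<open>N\<close> points of
  \<open>p\<close>, so the bad probability is at most its integral, which is dominated through the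
  reference measures. In the limit space the integral of \<open>f N\<close> tends to 0 because
  \<open>p\<close> is dense there; this fixes \<open>N\<close>, and then \<open>k\<close> is taken
  large.\<close>

lemma crv_tight:
  assumes t: "t \<in> {0..1}" and d: "d > 0" and \<epsilon>: "\<epsilon> > 0"
  shows "\<exists>N. \<forall>\<^sub>F k in sequentially. measure (\<pi> k) {\<gamma>\<in>space (\<pi> k). \<forall>i<N. d \<le> dist (crv k \<gamma> t) (p i)} \<le> \<epsilon>"
proof -
  obtain w0 where w0: "w0 \<in> S" using S_nonempty by blast
  have \<theta>w0: "\<theta> w0 \<noteq> 0" using \<theta>_S[OF w0] by simp
  \<comment> \<open>A curve point is within \<open>D\<close> of the start of the curve, which is
    within \<open>D\<close> of \<open>w0\<close>, hence \<open>2 * D\<close>. Bumps of size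
    \<open>d / 2\<close> vanish beyond \<open>d\<close>, hence \<open>d / 2\<close>.\<close>
  have D2: "2 * D > 0" and d2: "d / 2 > 0" using D d by auto
  define f where "f N w = bump (2 * D) w0 w * rest (d / 2) p N w" for N w
  have f01: "0 \<le> f N w" "f N w \<le> 1" "f N w \<le> bump (2 * D) w0 w" for N w
    unfolding f_def using bump_bounds[of "2 * D" w0 w] rest_bounds[of "d/2" p N w]
    by (auto intro!: mult_nonneg_nonneg mult_le_one mult_left_le)
  have fc: "continuous_on UNIV (f N)" for N
    unfolding f_def[abs_def] by (intro continuous_intros continuous_on_bump continuous_on_rest D2 d2)
  have fsupp: "f N w \<noteq> 0 \<Longrightarrow> dist w0 w \<le> 4 * D" for N w
    using bump_nonzeroD[OF D2, of w0 w] by (auto simp: f_def dist_commute)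
  have fb: "bounded {w. f N w \<noteq> 0}" for N
    unfolding bounded_def using fsupp by blast
  have bm: "bump (2 * D) w0 \<in> borel_measurable borel"
    by (rule borel_measurable_continuous_onI[OF continuous_on_bump[OF D2]])
  have "(\<lambda>N. \<integral>x. f N (J x) \<partial>m) \<longlonglongrightarrow> (\<integral>x. 0 \<partial>m)"
  proof (rule integral_dominated_convergence[where M = m and s = "\<lambda>N x. f N (J x)" and f = "\<lambda>_. 0" and w = "\<lambda>x. bump (2 * D) w0 (J x)"])
    show "(\<lambda>x. f N (J x)) \<in> borel_measurable m" for N
      by (rule measurable_compose[OF J_meas borel_measurable_continuous_onI[OF fc]])
    show "integrable m (\<lambda>x. bump (2 * D) w0 (J x))"
      by (rule mm_integrable[OF mm J bm, of 1 w0 "4 * D"])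
         (use bump_bounds[of "2 * D" w0] bump_nonzeroD[OF D2, of w0] in \<open>auto simp: less_imp_le\<close>)
    show "AE x in m. norm (f N (J x)) \<le> bump (2 * D) w0 (J x)" for N
      using f01 by (intro AE_I2) simp
    show "AE x in m. (\<lambda>N. f N (J x)) \<longlonglongrightarrow> 0"
    proof (rule AE_I2)
      fix x assume "x \<in> space m"
      then obtain i where i: "dist (p i) (J x) < d / 2"
        using dense[of x] d2 unfolding closure_approachable mm_space[OF mm] by blast
      have "f N (J x) = 0" if "N \<ge> Suc i" for N
        using rest_nonzeroD[OF d2, of p N "J x" i] i that by (auto simp: f_def dist_commute)
      then show "(\<lambda>N. f N (J x)) \<longlonglongrightarrow> 0" by (intro tendsto_eventually) (auto simp: eventually_sequentially)
    qed
  qed simp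
  then have "(\<lambda>N. C * M * (\<integral>x. f N (J x) \<partial>m)) \<longlonglongrightarrow> C * M * 0" by (intro tendsto_intros) simp
  then have "\<forall>\<^sub>F N in sequentially. C * M * (\<integral>x. f N (J x) \<partial>m) < \<epsilon>" using \<epsilon> by (intro order_tendstoD) auto
  then obtain N where N: "C * M * (\<integral>x. f N (J x) \<partial>m) < \<epsilon>" by (auto simp: eventually_sequentially)
  have ev: "\<forall>\<^sub>F k in sequentially. (C + e k) * (M + e k) * (\<integral>x. f N (J' (n k) x) \<partial>m' (n k)) < \<epsilon>"
    by (rule order_tendstoD(2)[OF conv_n[OF fc f01(1,2) fb] N])
  have le: "measure (\<pi> k) {\<gamma>\<in>space (\<pi> k). \<forall>i<N. d \<le> dist (crv k \<gamma> t) (p i)} \<le> (\<integral>\<gamma>. f N (crv k \<gamma> t) \<partial>\<pi> k)" for k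
  proof -
    interpret prob_space "\<pi> k" by (rule \<pi>_prob)
    note [measurable] = crv_meas[OF t]
    let ?A = "{\<gamma>\<in>space (\<pi> k). \<forall>i<N. d \<le> dist (crv k \<gamma> t) (p i)}"
    have A: "?A \<in> sets (\<pi> k)" by measurable
    have fm: "(\<lambda>\<gamma>. f N (crv k \<gamma> t)) \<in> borel_measurable (\<pi> k)"
      by (rule measurable_compose[OF crv_meas[OF t] borel_measurable_continuous_onI[OF fc]])
    have "measure (\<pi> k) ?A = (\<integral>\<gamma>. indicat_real ?A \<gamma> \<partial>\<pi> k)"
      using A sets.sets_into_space[OF A] by (simp add: Int_absorb2)
    also have "\<dots> \<le> (\<integral>\<gamma>. f N (crv k \<gamma> t) \<partial>\<pi> k)"
    proof (rule integral_mono_AE)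
      show "integrable (\<pi> k) (indicat_real ?A)"
        by (rule integrable_real_indicator[OF A]) (simp add: less_top[symmetric])
      show "integrable (\<pi> k) (\<lambda>\<gamma>. f N (crv k \<gamma> t))"
        by (rule integrable_const_bound[of _ 1]) (use f01 fm in auto)
      show "AE \<gamma> in \<pi> k. indicat_real ?A \<gamma> \<le> f N (crv k \<gamma> t)"
        using AE_crv[of k] AE_space
      proof eventually_elim
        case (elim \<gamma>)
        show ?case
        proof (cases "\<gamma> \<in> ?A")
          case True
          have g: "dist (crv k \<gamma> s) (crv k \<gamma> r) = \<bar>s - r\<bar> * dist (crv k \<gamma> 0) (crv k \<gamma> 1)" if "s \<in> {0..1}" "r \<in> {0..1}" for s r
            using crv_geodesic[OF elim(2)] that unfolding unit_geodesic_def by blast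
          have "dist (crv k \<gamma> t) (crv k \<gamma> 0) = \<bar>t - 0\<bar> * dist (crv k \<gamma> 0) (crv k \<gamma> 1)"
            by (rule g[OF t]) simp
          also have "\<dots> \<le> 1 * D"
            using t elim(1) by (intro mult_mono \<theta>_dist) auto
          finally have "dist (crv k \<gamma> t) w0 \<le> 2 * D"
            using \<theta>_dist[of "crv k \<gamma> 0" w0] elim(1) \<theta>w0 dist_triangle[of "crv k \<gamma> t" w0 "crv k \<gamma> 0"] by simp
          then have 1: "bump (2 * D) w0 (crv k \<gamma> t) = 1" by (rule bump_eq_1[OF D2])
          have "bump (d / 2) (p i) (crv k \<gamma> t) = 0" if "i < N" for i
            using True that bump_nonzeroD[OF d2, of "p i" "crv k \<gamma> t"] by fastforce
          then have "f N (crv k \<gamma> t) = 1" unfolding f_def 1 rest_def by simp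
          then show ?thesis by (simp add: indicator_def)
        qed (use f01 in simp)
      qed
    qed
    finally show ?thesis .
  qed
  have "\<forall>\<^sub>F k in sequentially. measure (\<pi> k) {\<gamma>\<in>space (\<pi> k). \<forall>i<N. d \<le> dist (crv k \<gamma> t) (p i)} \<le> \<epsilon>"
    using ev
  proof eventually_elim
    case (elim k)
    show ?case
      using le[of k] integral_crv_le[OF t fc f01(1,2) fb, of k N] elim by linarith
  qed
  then show ?thesis by blast
qed

end

end

context plan_limit
begin

text \<open>Every property of the chosen plans is an equality or inequality for integrals of bounded
  uniformly continuous functionals of at most two times, up to errors tending to 0, so it holds for
  the limit law.\<close>

lemma limit_geodesics:
  obtains P :: "(nat \<Rightarrow> nat) measure" and \<Gamma> where "prob_space P"
    and "\<And>x. unit_geodesic (\<Gamma> x)" "\<And>x. dist (\<Gamma> x 0) (\<Gamma> x 1) \<le> D"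
    and "\<And>t w. t \<in> {0..1} \<Longrightarrow> (\<lambda>x. dist (\<Gamma> x t) w) \<in> borel_measurable P"
    and "\<And>x t. t \<in> {0..1} \<Longrightarrow> \<Gamma> x t \<in> closure (range p)"
    and "\<And>\<phi> t. test_function \<phi> \<Longrightarrow> t \<in> {0..1} \<Longrightarrow> (\<integral>x. \<phi> (\<Gamma> x t) \<partial>P) \<le> C * M * (\<integral>x. \<phi> (J x) \<partial>m)"
    and "\<And>\<phi>. test_function \<phi> \<Longrightarrow> (\<integral>x. \<phi> (\<Gamma> x 0) \<partial>P) = (\<integral>x. \<phi> (J x) \<partial>\<mu>\<^sub>0)"
    and "\<And>\<phi>. test_function \<phi> \<Longrightarrow> (\<integral>x. \<phi> (\<Gamma> x 1) \<partial>P) = (\<integral>x. \<phi> (J x) \<partial>\<mu>\<^sub>1)"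
    and "\<And>\<beta>. \<beta> \<in> couplings X \<mu>\<^sub>0 \<mu>\<^sub>1 \<Longrightarrow> (\<integral>x. dist (\<Gamma> x 0) (\<Gamma> x 1) powr q \<partial>P) \<le> real_cost \<beta>"
proof -
  have "\<forall>k. \<exists>n \<delta> \<pi>. plan_at k n \<delta> \<pi>" by (rule allI) (rule plan_exists)
  then obtain n \<delta> \<pi> where plan: "\<And>k. plan_at k (n k) (\<delta> k) (\<pi> k)" by metis
  let ?c = "crv n"
  have cm: "(\<lambda>\<gamma>. dist (?c k \<gamma> t) (p i)) \<in> borel_measurable (\<pi> k)" if t: "t \<in> {0..1}" for k t i
    by (rule borel_measurable_dist_const[OF crv_meas[OF plan t]])
  show ?thesis
  proof (rule random_geodesics_compactness[of \<pi> ?c p D])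
    show "prob_space (\<pi> k)" for k by (rule \<pi>_prob[OF plan])
    show "unit_geodesic (?c k \<gamma>)" if "\<gamma> \<in> space (\<pi> k)" for k \<gamma> by (rule crv_geodesic[OF plan that])
    show "?c k \<gamma> t \<in> closure (range p)" if "\<gamma> \<in> space (\<pi> k)" "t \<in> {0..1}" for k \<gamma> t by (rule crv_closure[OF plan that])
    show "AE \<gamma> in \<pi> k. dist (?c k \<gamma> 0) (?c k \<gamma> 1) \<le> D" for k by (rule AE_len[OF plan])
    show "(\<lambda>\<gamma>. dist (?c k \<gamma> t) (p i)) \<in> borel_measurable (\<pi> k)" if "t \<in> {0..1}" for k t i by (rule cm[OF that])
    show "\<exists>N. \<forall>\<^sub>F k in sequentially. measure (\<pi> k) {\<gamma>\<in>space (\<pi> k). \<forall>i<N. d \<le> dist (?c k \<gamma> t) (p i)} \<le> \<epsilon>"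
      if "t \<in> {0..1}" "d > 0" "\<epsilon> > 0" for t d \<epsilon> by (rule crv_tight[OF plan that])
  next
  fix r and P :: "(nat \<Rightarrow> nat) measure" and \<Gamma> assume r: "strict_mono r" and P: "prob_space P"
    and \<Gamma>: "\<And>x. unit_geodesic (\<Gamma> x)" "\<And>x. dist (\<Gamma> x 0) (\<Gamma> x 1) \<le> D"
      "\<And>x t. t \<in> {0..1} \<Longrightarrow> \<Gamma> x t \<in> closure (range p)"
    and \<Gamma>m: "\<And>t w. t \<in> {0..1} \<Longrightarrow> (\<lambda>x. dist (\<Gamma> x t) w) \<in> borel_measurable P"
    and lim: "\<And>F B s t. (\<And>u v. \<bar>F u v\<bar> \<le> B) \<Longrightarrow> unif_cont2 F \<Longrightarrow> s \<in> {0..1} \<Longrightarrow> t \<in> {0..1} \<Longrightarrow>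
           (\<lambda>k. \<integral>\<omega>. F (?c (r k) \<omega> s) (?c (r k) \<omega> t) \<partial>\<pi> (r k)) \<longlonglongrightarrow> (\<integral>x. F (\<Gamma> x s) (\<Gamma> x t) \<partial>P)"
  interpret P: prob_space P by fact
  have e_r: "(\<lambda>k. e (r k)) \<longlonglongrightarrow> 0"
    using LIMSEQ_subseq_LIMSEQ[OF e_lim[OF plan] r] by (simp add: comp_def)
  have \<delta>_le: "\<delta> k \<le> e k" for k using plan[of k] unfolding plan_at_def e_def by (elim conjE)
  have lim\<phi>: "(\<lambda>k. \<integral>\<gamma>. \<phi> (?c (r k) \<gamma> t) \<partial>\<pi> (r k)) \<longlonglongrightarrow> (\<integral>x. \<phi> (\<Gamma> x t) \<partial>P)"
    if "test_function \<phi>" "t \<in> {0..1}" for \<phi> t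
    by (rule lim[of "\<lambda>u v. \<phi> u" 1 t t, OF test_functionD(3)[OF that(1)] unif_cont2_left[OF test_functionD(4)[OF that(1)]] that(2) that(2)])
  have dom: "(\<integral>x. \<phi> (\<Gamma> x t) \<partial>P) \<le> C * M * (\<integral>x. \<phi> (J x) \<partial>m)" if \<phi>: "test_function \<phi>" and t: "t \<in> {0..1}" for \<phi> t
  proof (rule LIMSEQ_le[OF lim\<phi>[OF \<phi> t]])
    show "(\<lambda>k. (C + e (r k)) * (M + e (r k)) * (\<integral>x. \<phi> (J' (n (r k)) x) \<partial>m' (n (r k)))) \<longlonglongrightarrow> C * M * (\<integral>x. \<phi> (J x) \<partial>m)"
      using LIMSEQ_subseq_LIMSEQ[OF conv_n[OF plan test_functionD(5,1,2,7)[OF \<phi>]] r] by (simp add: comp_def)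
    show "\<exists>N. \<forall>k\<ge>N. (\<integral>\<gamma>. \<phi> (?c (r k) \<gamma> t) \<partial>\<pi> (r k)) \<le> (C + e (r k)) * (M + e (r k)) * (\<integral>x. \<phi> (J' (n (r k)) x) \<partial>m' (n (r k)))"
      by (intro exI allI impI integral_crv_le[OF plan t test_functionD(5,1,2,7)[OF \<phi>]])
  qed
  \<comment> \<open>Once \<open>2 * \<delta> k\<close> is below the modulus of continuity for
    \<open>\<epsilon> / 4\<close>, the error is at most \<open>2 * (\<epsilon> / 4)\<close> plus
    \<open>2 * e k\<close>, and the latter is eventually below
    \<open>\<epsilon> / 4\<close>.\<close>
  have marg: "(\<integral>x. \<phi> (\<Gamma> x t) \<partial>P) = l"
    if \<phi>: "test_function \<phi>" and t: "t \<in> {0..1}"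
      and close: "\<And>k \<omega>. 0 \<le> \<omega> \<Longrightarrow> (\<forall>u v. dist u v < 2 * \<delta> k \<longrightarrow> \<bar>\<phi> u - \<phi> v\<bar> \<le> \<omega>) \<Longrightarrow>
        \<bar>(\<integral>\<gamma>. \<phi> (?c k \<gamma> t) \<partial>\<pi> k) - l\<bar> \<le> 2 * \<omega> + 2 * e k" for \<phi> t l
  proof (rule LIMSEQ_unique[OF lim\<phi>[OF \<phi> t]], rule LIMSEQ_I)
    fix \<epsilon> :: real assume \<epsilon>: "\<epsilon> > 0"
    then have "\<epsilon> / 4 > 0" by simp
    then obtain d where d: "d > 0" "\<And>u v. dist u v < d \<Longrightarrow> dist (\<phi> u) (\<phi> v) < \<epsilon> / 4"
      using test_functionD(4)[OF \<phi>] unfolding uniformly_continuous_on_def by (metis UNIV_I dist_commute)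
    have "\<forall>\<^sub>F k in sequentially. e (r k) < min (d / 2) (\<epsilon> / 8)"
      using d(1) \<epsilon> by (intro order_tendstoD(2)[OF e_r]) simp
    then obtain k0 where k0: "\<And>k. k \<ge> k0 \<Longrightarrow> e (r k) < min (d / 2) (\<epsilon> / 8)" by (auto simp: eventually_sequentially)
    have "norm ((\<integral>\<gamma>. \<phi> (?c (r k) \<gamma> t) \<partial>\<pi> (r k)) - l) < \<epsilon>" if "k \<ge> k0" for k
    proof -
      have "\<bar>\<phi> u - \<phi> v\<bar> \<le> \<epsilon> / 4" if "dist u v < 2 * \<delta> (r k)" for u v
        using d(2)[of u v] that k0[OF \<open>k \<ge> k0\<close>] \<delta>_le[of "r k"] by (simp add: dist_real_def)
      then have "\<bar>(\<integral>\<gamma>. \<phi> (?c (r k) \<gamma> t) \<partial>\<pi> (r k)) - l\<bar> \<le> 2 * (\<epsilon> / 4) + 2 * e (r k)"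
        using \<epsilon> by (intro close) auto
      also have "\<dots> < \<epsilon>" using k0[OF that] \<epsilon> by simp
      finally show ?thesis by simp
    qed
    then show "\<exists>no. \<forall>k\<ge>no. norm ((\<integral>\<gamma>. \<phi> (?c (r k) \<gamma> t) \<partial>\<pi> (r k)) - l) < \<epsilon>" by blast
  qed
  have closeb: "\<forall>\<phi> \<omega>. test_function \<phi> \<longrightarrow> 0 \<le> \<omega> \<longrightarrow> (\<forall>u v. dist u v < 2 * \<delta> k \<longrightarrow> \<bar>\<phi> u - \<phi> v\<bar> \<le> \<omega>) \<longrightarrow>
      \<bar>(\<integral>\<gamma>. \<phi> (?c k \<gamma> 0) \<partial>\<pi> k) - (\<integral>x. \<phi> (J x) \<partial>\<mu>\<^sub>0)\<bar> \<le> 2 * \<omega> + 2 * e k \<and>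
      \<bar>(\<integral>\<gamma>. \<phi> (?c k \<gamma> 1) \<partial>\<pi> k) - (\<integral>x. \<phi> (J x) \<partial>\<mu>\<^sub>1)\<bar> \<le> 2 * \<omega> + 2 * e k" for k
    using plan[of k] unfolding plan_at_def crv_def[OF plan] e_def by (elim conjE)
  have marg0: "(\<integral>x. \<phi> (\<Gamma> x 0) \<partial>P) = (\<integral>x. \<phi> (J x) \<partial>\<mu>\<^sub>0)" if \<phi>: "test_function \<phi>" for \<phi>
  proof (rule marg[OF \<phi>])
    show "0 \<in> {0..1::real}" by simp
    fix k and \<omega> :: real assume w: "0 \<le> \<omega>" and osc: "\<forall>u v. dist u v < 2 * \<delta> k \<longrightarrow> \<bar>\<phi> u - \<phi> v\<bar> \<le> \<omega>"
    show "\<bar>(\<integral>\<gamma>. \<phi> (?c k \<gamma> 0) \<partial>\<pi> k) - (\<integral>x. \<phi> (J x) \<partial>\<mu>\<^sub>0)\<bar> \<le> 2 * \<omega> + 2 * e k"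
      by (rule closeb[of k, THEN spec, of \<phi>, THEN spec, of \<omega>, THEN mp, OF \<phi>, THEN mp, OF w, THEN mp, OF osc, THEN conjunct1])
  qed
  have marg1: "(\<integral>x. \<phi> (\<Gamma> x 1) \<partial>P) = (\<integral>x. \<phi> (J x) \<partial>\<mu>\<^sub>1)" if \<phi>: "test_function \<phi>" for \<phi>
  proof (rule marg[OF \<phi>])
    show "1 \<in> {0..1::real}" by simp
    fix k and \<omega> :: real assume w: "0 \<le> \<omega>" and osc: "\<forall>u v. dist u v < 2 * \<delta> k \<longrightarrow> \<bar>\<phi> u - \<phi> v\<bar> \<le> \<omega>"
    show "\<bar>(\<integral>\<gamma>. \<phi> (?c k \<gamma> 1) \<partial>\<pi> k) - (\<integral>x. \<phi> (J x) \<partial>\<mu>\<^sub>1)\<bar> \<le> 2 * \<omega> + 2 * e k"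
      by (rule closeb[of k, THEN spec, of \<phi>, THEN spec, of \<omega>, THEN mp, OF \<phi>, THEN mp, OF w, THEN mp, OF osc, THEN conjunct2])
  qed
  have cost: "(\<integral>x. dist (\<Gamma> x 0) (\<Gamma> x 1) powr q \<partial>P) \<le> real_cost \<beta>" if \<beta>: "\<beta> \<in> couplings X \<mu>\<^sub>0 \<mu>\<^sub>1" for \<beta>
  proof -
    \<comment> \<open>The capped cost; the cap disappears in the last step because the limit curves
      have length at most \<open>D\<close>.\<close>
    let ?F = "\<lambda>u v :: 'w. min (dist u v) D powr q"
    have FB: "\<bar>?F u v\<bar> \<le> D powr q" for u v using D q by (auto intro!: powr_mono2)
    have uc: "unif_cont2 ?F" using q D by (intro unif_cont2_capped_powr) auto
    have l: "(\<lambda>k. \<integral>\<gamma>. ?F (?c (r k) \<gamma> 0) (?c (r k) \<gamma> 1) \<partial>\<pi> (r k)) \<longlonglongrightarrow> (\<integral>x. ?F (\<Gamma> x 0) (\<Gamma> x 1) \<partial>P)"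
      by (rule lim[OF FB uc]) simp_all
    have rc: "0 \<le> real_cost \<beta>" unfolding real_cost_def by (intro integral_nonneg_AE) simp
    have le: "(\<integral>\<gamma>. ?F (?c k \<gamma> 0) (?c k \<gamma> 1) \<partial>\<pi> k) \<le> real_cost \<beta> + e k + 2 * e k * D powr q" for k
    proof -
      interpret prob_space "\<pi> k" by (rule \<pi>_prob[OF plan])
      have "(\<lambda>\<gamma>. ?F (?c k \<gamma> 0) (?c k \<gamma> 1)) \<in> borel_measurable (\<pi> k)"
        by (rule borel_measurable_unif_cont2[OF uc, where p = p]; (rule crv_closure[OF plan] cm)?; simp)
      then have i: "integrable (\<pi> k) (\<lambda>\<gamma>. ?F (?c k \<gamma> 0) (?c k \<gamma> 1))"
        by (rule integrable_const_bound[where B = "D powr q", rotated]) (use FB in \<open>simp add: AE_I2\<close>)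
      have pos: "0 \<le> real_cost \<beta> + e k + 2 * e k * D powr q"
        using rc e_pos[OF plan, of k] by (intro add_nonneg_nonneg mult_nonneg_nonneg) auto
      have "\<forall>\<beta>\<in>couplings X \<mu>\<^sub>0 \<mu>\<^sub>1. (\<integral>\<^sup>+\<gamma>. ennreal (dist (?c k \<gamma> 0) (?c k \<gamma> 1) powr q) \<partial>\<pi> k)
        \<le> ennreal (real_cost \<beta> + e k + 2 * e k * D powr q)"
        using plan[of k] unfolding plan_at_def crv_def[OF plan] e_def by (elim conjE)
      from bspec[OF this \<beta>]
      have b: "(\<integral>\<^sup>+\<gamma>. ennreal (dist (?c k \<gamma> 0) (?c k \<gamma> 1) powr q) \<partial>\<pi> k) \<le> ennreal (real_cost \<beta> + e k + 2 * e k * D powr q)" .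
      have "ennreal (\<integral>\<gamma>. ?F (?c k \<gamma> 0) (?c k \<gamma> 1) \<partial>\<pi> k) = (\<integral>\<^sup>+\<gamma>. ennreal (?F (?c k \<gamma> 0) (?c k \<gamma> 1)) \<partial>\<pi> k)"
        by (rule nn_integral_eq_integral[OF i, symmetric]) simp
      also have "\<dots> \<le> (\<integral>\<^sup>+\<gamma>. ennreal (dist (?c k \<gamma> 0) (?c k \<gamma> 1) powr q) \<partial>\<pi> k)"
        using D q by (intro nn_integral_mono ennreal_leI powr_mono2) auto
      also note b
      finally show ?thesis using pos by (simp only: ennreal_le_iff)
    qed
    have "(\<lambda>k. real_cost \<beta> + e (r k) + 2 * e (r k) * D powr q) \<longlonglongrightarrow> real_cost \<beta> + 0 + 2 * 0 * D powr q"
      by (intro tendsto_intros e_r)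
    from LIMSEQ_le[OF l this] le have "(\<integral>x. ?F (\<Gamma> x 0) (\<Gamma> x 1) \<partial>P) \<le> real_cost \<beta>" by simp
    then show ?thesis using \<Gamma>(2) by (simp add: min_absorb1)
  qed
  show thesis
  proof (rule that[of P \<Gamma>])
    show "prob_space P" by (rule P)
    show "unit_geodesic (\<Gamma> x)" "dist (\<Gamma> x 0) (\<Gamma> x 1) \<le> D" for x by (rule \<Gamma>(1), rule \<Gamma>(2))
    show "(\<lambda>x. dist (\<Gamma> x t) w) \<in> borel_measurable P" if "t \<in> {0..1}" for t w using that by (rule \<Gamma>m)
    show "\<Gamma> x t \<in> closure (range p)" if "t \<in> {0..1}" for x t using that by (rule \<Gamma>(3))
    show "(\<integral>x. \<phi> (\<Gamma> x t) \<partial>P) \<le> C * M * (\<integral>x. \<phi> (J x) \<partial>m)" if "test_function \<phi>" "t \<in> {0..1}" for \<phi> t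
      using that by (rule dom)
    show "(\<integral>x. \<phi> (\<Gamma> x 0) \<partial>P) = (\<integral>x. \<phi> (J x) \<partial>\<mu>\<^sub>0)" if "test_function \<phi>" for \<phi> using that by (rule marg0)
    show "(\<integral>x. \<phi> (\<Gamma> x 1) \<partial>P) = (\<integral>x. \<phi> (J x) \<partial>\<mu>\<^sub>1)" if "test_function \<phi>" for \<phi> using that by (rule marg1)
    show "(\<integral>x. dist (\<Gamma> x 0) (\<Gamma> x 1) powr q \<partial>P) \<le> real_cost \<beta>" if "\<beta> \<in> couplings X \<mu>\<^sub>0 \<mu>\<^sub>1" for \<beta> using that by (rule cost)
  qed
  qed
qed

end

text \<open>Limit curves are found in the ambient space only; closedness of the image lets them be
  pulled back to \<open>X\<close> from countably many times.\<close>

lemma isometric_on_closed_image: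
  fixes J :: "'b \<Rightarrow> 'w::metric_space"
  assumes compl: "mcomplete_of X" and J: "isometric_on X J"
  shows "closed (J ` mspace X)"
  unfolding closed_sequential_limits
proof (intro allI impI, elim conjE)
  interpret Metric_space "mspace X" "mdist X" by simp
  fix y l assume y: "\<forall>n. y n \<in> J ` mspace X" and l: "y \<longlonglongrightarrow> l"
  then have "\<forall>n. \<exists>x. x \<in> mspace X \<and> y n = J x" by blast
  then obtain x where x: "\<And>n. x n \<in> mspace X" "\<And>n. y n = J (x n)" by metis
  have "MCauchy x"
    unfolding MCauchy_def
  proof (intro conjI allI impI)
    show "range x \<subseteq> mspace X" using x(1) by blast
    fix \<epsilon> :: real assume "\<epsilon> > 0"
    then obtain N where N: "\<And>k k'. k \<ge> N \<Longrightarrow> k' \<ge> N \<Longrightarrow> dist (y k) (y k') < \<epsilon>"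
      using LIMSEQ_imp_Cauchy[OF l] unfolding Cauchy_def by blast
    have "mdist X (x k) (x k') < \<epsilon>" if "k \<ge> N" "k' \<ge> N" for k k'
      using N[OF that] isometric_onD[OF J x(1) x(1)] by (simp add: x(2))
    then show "\<exists>N. \<forall>k k'. N \<le> k \<longrightarrow> N \<le> k' \<longrightarrow> mdist X (x k) (x k') < \<epsilon>" by blast
  qed
  then obtain a where "limitin mtopology x a sequentially"
    using compl unfolding mcomplete_of_def mcomplete_def by blast
  then have a: "a \<in> mspace X" "\<And>\<epsilon>. \<epsilon> > 0 \<Longrightarrow> \<forall>\<^sub>F n in sequentially. mdist X (x n) a < \<epsilon>"
    unfolding limitin_metric by (auto elim!: eventually_mono)
  have "y \<longlonglongrightarrow> J a"
  proof (rule tendstoI)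
    fix \<epsilon> :: real assume "\<epsilon> > 0"
    from a(2)[OF this] show "\<forall>\<^sub>F n in sequentially. dist (y n) (J a) < \<epsilon>"
      by (simp add: x(2) isometric_onD[OF J x(1) a(1)])
  qed
  then have "l = J a" using l LIMSEQ_unique by blast
  then show "l \<in> J ` mspace X" using a(1) by blast
qed

text \<open>Radon-Nikodym gives the density. Where it is at least b = c + 1 / Suc j, on a set
  \<open>A\<close>, one has b m(A) \<le> \<nu>(A) \<le> c m(A); since \<nu>(A) is finite, so is
  m(A), and thus \<open>A\<close> is null.\<close>

lemma bounded_density_exists:
  assumes sf: "sigma_finite_measure m" and fin: "finite_measure \<nu>" and sets: "sets \<nu> = sets m"
    and c: "c \<ge> 0" and le: "\<And>A. A \<in> sets m \<Longrightarrow> emeasure \<nu> A \<le> ennreal c * emeasure m A"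
  shows "\<exists>\<rho>\<in>borel_measurable m. \<nu> = density m \<rho> \<and> (AE x in m. \<rho> x \<le> ennreal c)"
proof -
  interpret sigma_finite_measure m by fact
  interpret N: finite_measure \<nu> by fact
  have "absolutely_continuous m \<nu>"
    unfolding absolutely_continuous_def
  proof
    fix A assume "A \<in> null_sets m"
    then show "A \<in> null_sets \<nu>" using le[of A] sets by (auto simp: null_sets_def)
  qed
  then obtain \<rho> where \<rho>: "\<rho> \<in> borel_measurable m" "density m \<rho> = \<nu>"
    using Radon_Nikodym[of \<nu>] sets by blast
  note [measurable] = \<rho>(1)
  have null: "AE x in m. \<not> ennreal (c + 1 / Suc j) \<le> \<rho> x" for j
  proof -
    let ?b = "c + 1 / real (Suc j)"
    define A where "A = {x \<in> space m. ennreal ?b \<le> \<rho> x}"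
    have A: "A \<in> sets m" unfolding A_def by measurable
    have "ennreal ?b * emeasure m A = (\<integral>\<^sup>+x. ennreal ?b * indicator A x \<partial>m)"
      using A by (simp add: nn_integral_cmult_indicator)
    also have "\<dots> \<le> (\<integral>\<^sup>+x. \<rho> x * indicator A x \<partial>m)"
      by (intro nn_integral_mono) (auto simp: A_def indicator_def)
    also have "\<dots> = emeasure \<nu> A"
      using A unfolding \<rho>(2)[symmetric] by (simp add: emeasure_density)
    finally have 1: "ennreal ?b * emeasure m A \<le> emeasure \<nu> A" .
    have b: "?b > 0" using c by (simp add: add_nonneg_pos)
    have "emeasure m A \<noteq> \<infinity>"
      using 1 N.emeasure_finite[of A] b by (auto simp: ennreal_mult_top top_unique)
    then obtain r where r: "emeasure m A = ennreal r" "r \<ge> 0"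
      by (cases "emeasure m A") auto
    have "ennreal ?b * ennreal r \<le> ennreal c * ennreal r" using 1 le[OF A] r(1) by (metis order_trans)
    then have "ennreal (?b * r) \<le> ennreal (c * r)"
      by (simp only: ennreal_mult[OF less_imp_le[OF b] r(2)] ennreal_mult[OF c r(2)])
    then have "?b * r \<le> c * r" using c r(2) by (simp only: ennreal_le_iff[OF mult_nonneg_nonneg])
    then have "r / real (Suc j) \<le> 0" by (simp add: algebra_simps)
    then have "r = 0" using r(2) by (simp add: divide_le_0_iff)
    then have "A \<in> null_sets m" using A r(1) by (auto simp: null_sets_def)
    then show ?thesis by (rule AE_I') (auto simp: A_def)
  qed
  have "AE x in m. \<forall>j. \<not> ennreal (c + 1 / Suc j) \<le> \<rho> x"
    unfolding AE_all_countable using null by blast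
  then have "AE x in m. \<rho> x \<le> ennreal c"
  proof eventually_elim
    case (elim x)
    have "(\<lambda>j. ennreal (c + 1 / Suc j)) \<longlonglongrightarrow> ennreal (c + 0)"
      by (intro tendsto_intros) (use LIMSEQ_inverse_real_of_nat in \<open>simp add: inverse_eq_divide\<close>)
    then show ?case
      using elim by (intro LIMSEQ_le_const[of "\<lambda>j. ennreal (c + 1 / Suc j)"]) (auto simp: not_le less_imp_le)
  qed
  with \<rho> show ?thesis by blast
qed

text \<open>The inequality is applied to a set and to its complement; both measures have total mass
  1.\<close>

lemma prob_measure_le_imp_eq:
  assumes "prob_space \<nu>" "prob_space \<mu>" "sets \<nu> = sets \<mu>"
    and le: "\<And>A. A \<in> sets \<nu> \<Longrightarrow> emeasure \<nu> A \<le> emeasure \<mu> A"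
  shows "\<nu> = \<mu>"
proof (rule measure_eqI)
  interpret N: prob_space \<nu> by fact
  interpret U: prob_space \<mu> by fact
  have sp: "space \<nu> = space \<mu>" using assms(3) by (rule sets_eq_imp_space_eq)
  fix A assume A: "A \<in> sets \<nu>"
  have l: "measure \<nu> B \<le> measure \<mu> B" if "B \<in> sets \<nu>" for B
    using le[OF that] by (simp add: N.emeasure_eq_measure U.emeasure_eq_measure)
  have "measure \<nu> (space \<nu> - A) = 1 - measure \<nu> A" using A by (rule N.prob_compl)
  moreover have "measure \<mu> (space \<nu> - A) = 1 - measure \<mu> A"
    unfolding sp by (rule U.prob_compl) (use A assms(3) in simp)
  ultimately have "measure \<nu> A = measure \<mu> A"
    using l[OF A] l[of "space \<nu> - A"] A by fastforce
  then show "emeasure \<nu> A = emeasure \<mu> A"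
    by (simp add: N.emeasure_eq_measure U.emeasure_eq_measure)
qed (fact assms(3))

text \<open>These functions vanish on \<open>A\<close> and detect points at positive distance from
  it once \<open>N\<close> is large; the subtracted slope makes the support bounded.\<close>

lemma test_function_far:
  fixes A :: "'w::metric_space set"
  shows "test_function (\<lambda>w. max 0 (min 1 (infdist w A) - dist w w0 / real (Suc N)))" (is "test_function ?f")
  unfolding test_function_def
proof (intro conjI allI)
  fix w
  show "0 \<le> ?f w" by simp
  have "min 1 (infdist w A) \<le> 1" "0 \<le> dist w w0 / real (Suc N)" by simp_all
  then show "?f w \<le> 1" by linarith
next
  have "2-lipschitz_on UNIV ?f"
  proof (rule lipschitz_onI)
    fix u v :: 'w
    have 1: "\<bar>infdist u A - infdist v A\<bar> \<le> dist u v" by (rule infdist_triangle_abs)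
    have "dist u w0 / real (Suc N) - dist v w0 / real (Suc N) = (dist u w0 - dist v w0) / real (Suc N)"
      by (rule diff_divide_distrib[symmetric])
    then have "\<bar>dist u w0 / real (Suc N) - dist v w0 / real (Suc N)\<bar> = \<bar>dist u w0 - dist v w0\<bar> / real (Suc N)"
      by (simp add: abs_divide)
    also have "\<dots> \<le> \<bar>dist u w0 - dist v w0\<bar> / 1"
      by (rule divide_left_mono) simp_all
    also have "\<dots> \<le> dist u v"
      using dist_triangle[of u w0 v] dist_triangle[of v w0 u] by (simp add: dist_commute abs_le_iff)
    finally have 2: "\<bar>dist u w0 / real (Suc N) - dist v w0 / real (Suc N)\<bar> \<le> dist u v" .
    show "dist (?f u) (?f v) \<le> 2 * dist u v"
      unfolding dist_real_def using 1 2 by linarith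
  qed simp
  then show "uniformly_continuous_on UNIV ?f" by (rule lipschitz_on_uniformly_continuous)
  have "dist w0 w \<le> real (Suc N)" if "?f w \<noteq> 0" for w
  proof -
    have "min 1 (infdist w A) \<le> 1" by simp
    then have "dist w w0 / real (Suc N) < 1" using that by linarith
    then have "dist w w0 < real (Suc N)" by (simp add: divide_less_eq)
    then show ?thesis by (simp add: dist_commute)
  qed
  then show "bounded {w. ?f w \<noteq> 0}"
    unfolding bounded_def by (intro exI[of _ w0] exI[of _ "real (Suc N)"] ballI) (simp only: mem_Collect_eq)
qed

context plan_limit
begin

text \<open>The marginals themselves become reference measures, so that the comparison by test
  functions can be used against them.\<close>

lemma mm_\<mu>: "metric_measure_space X \<mu>\<^sub>0" "metric_measure_space X \<mu>\<^sub>1"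
proof -
  have "complete_separable X" using mm by (simp add: metric_measure_space_def)
  moreover have "emeasure \<mu>\<^sub>0 (mspace X) = 1" "emeasure \<mu>\<^sub>1 (mspace X) = 1"
    using P0.emeasure_space_1 P1.emeasure_space_1 mm_space[OF mm] by simp_all
  moreover have "emeasure \<mu>\<^sub>0 B < \<infinity>" "emeasure \<mu>\<^sub>1 B < \<infinity>" for B
    using P0.emeasure_finite[of B] P1.emeasure_finite[of B] by (auto simp: less_top[symmetric])
  ultimately show "metric_measure_space X \<mu>\<^sub>0" "metric_measure_space X \<mu>\<^sub>1"
    unfolding metric_measure_space_def using mm_sets[OF mm] by auto
qed

text \<open>The limit curves are moved back to \<open>X\<close> by inverting \<open>J\<close>, which
  requires that almost surely the whole curve lies in the image of \<open>J\<close>; the plan is the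
  law of the pulled-back curve.\<close>

lemma interpolating_plan:
  "\<exists>\<pi>\<in>OptGeo q X \<mu>\<^sub>0 \<mu>\<^sub>1. \<forall>t\<in>{0..1}. \<exists>\<rho>\<^sub>t\<in>borel_measurable m.
     distr \<pi> (mborel X) (\<lambda>\<gamma>. \<gamma> t) = density m \<rho>\<^sub>t \<and> esssup m \<rho>\<^sub>t \<le> ennreal (C * M)"
proof (rule limit_geodesics)
  fix P :: "(nat \<Rightarrow> nat) measure" and \<Gamma>
  assume P: "prob_space P"
    and \<Gamma>: "\<And>x. unit_geodesic (\<Gamma> x)" "\<And>x. dist (\<Gamma> x 0) (\<Gamma> x 1) \<le> D"
    and \<Gamma>m: "\<And>t w. t \<in> {0..1} \<Longrightarrow> (\<lambda>x. dist (\<Gamma> x t) w) \<in> borel_measurable P"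
    and \<Gamma>c: "\<And>x t. t \<in> {0..1} \<Longrightarrow> \<Gamma> x t \<in> closure (range p)"
    and dom: "\<And>\<phi> t. test_function \<phi> \<Longrightarrow> t \<in> {0..1} \<Longrightarrow> (\<integral>x. \<phi> (\<Gamma> x t) \<partial>P) \<le> C * M * (\<integral>x. \<phi> (J x) \<partial>m)"
    and marg0: "\<And>\<phi>. test_function \<phi> \<Longrightarrow> (\<integral>x. \<phi> (\<Gamma> x 0) \<partial>P) = (\<integral>x. \<phi> (J x) \<partial>\<mu>\<^sub>0)"
    and marg1: "\<And>\<phi>. test_function \<phi> \<Longrightarrow> (\<integral>x. \<phi> (\<Gamma> x 1) \<partial>P) = (\<integral>x. \<phi> (J x) \<partial>\<mu>\<^sub>1)"
    and cost: "\<And>\<beta>. \<beta> \<in> couplings X \<mu>\<^sub>0 \<mu>\<^sub>1 \<Longrightarrow> (\<integral>x. dist (\<Gamma> x 0) (\<Gamma> x 1) powr q \<partial>P) \<le> real_cost \<beta>"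
  interpret P: prob_space P by fact
  interpret X: Metric_space "mspace X" "mdist X" by simp
  have CM: "0 \<le> C * M" using C_ge1 M(1) by simp
  obtain y0 where y0: "y0 \<in> mspace X" using mm_nonempty[OF mm] by blast
  let ?A = "J ` mspace X"
  have clA: "closed ?A"
    using mm by (intro isometric_on_closed_image[OF _ J]) (simp add: metric_measure_space_def complete_separable_def)
  have Ane: "?A \<noteq> {}" using y0 by blast
  have \<phi>\<Gamma>: "(\<lambda>x. \<phi> (\<Gamma> x t)) \<in> borel_measurable P" if \<phi>: "test_function \<phi>" and t: "t \<in> {0..1}" for \<phi> t
    by (rule borel_measurable_unif_cont2[OF unif_cont2_left[OF test_functionD(4)[OF \<phi>]], where p = p, OF \<Gamma>c[OF t] \<Gamma>c[OF t] \<Gamma>m[OF t] \<Gamma>m[OF t]])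
  have AE_A: "AE x in P. \<Gamma> x t \<in> ?A" if t: "t \<in> {0..1}" for t
  proof -
    \<comment> \<open>These vanish on the image of \<open>J\<close>, so domination by the reference
      measure makes their expectations along the curve zero; letting \<open>N\<close> grow forces
      \<open>infdist\<close> to the image to be 0.\<close>
    define f where "f N w = max 0 (min 1 (infdist w ?A) - dist w (J y0) / real (Suc N))" for N w
    have tf: "test_function (f N)" for N unfolding f_def[abs_def] by (rule test_function_far)
    have "AE x in P. f N (\<Gamma> x t) = 0" for N
    proof -
      have "f N (J x) = 0" if "x \<in> space m" for x
        using that by (simp add: f_def mm_space[OF mm])
      then have "(\<integral>x. f N (J x) \<partial>m) = (\<integral>x. 0 \<partial>m)" by (intro Bochner_Integration.integral_cong) auto
      then have "(\<integral>x. f N (\<Gamma> x t) \<partial>P) \<le> 0" using dom[OF tf t, of N] by simp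
      moreover have "0 \<le> (\<integral>x. f N (\<Gamma> x t) \<partial>P)"
        by (intro integral_nonneg_AE AE_I2 test_functionD(1)[OF tf])
      ultimately have z: "(\<integral>x. f N (\<Gamma> x t) \<partial>P) = 0" by simp
      have i: "integrable P (\<lambda>x. f N (\<Gamma> x t))"
        by (rule P.integrable_const_bound[where B = 1, OF _ \<phi>\<Gamma>[OF tf t]]) (simp add: test_functionD(3)[OF tf])
      show ?thesis
        using integral_nonneg_eq_0_iff_AE[OF i] z test_functionD(1)[OF tf] by simp
    qed
    then have "AE x in P. \<forall>N. f N (\<Gamma> x t) = 0" unfolding AE_all_countable by blast
    then show ?thesis
    proof eventually_elim
      case (elim x)
      have "min 1 (infdist (\<Gamma> x t) ?A) \<le> dist (\<Gamma> x t) (J y0) / real (Suc N)" for N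
      proof -
        have "f N (\<Gamma> x t) = 0" using elim by blast
        then show ?thesis unfolding f_def by linarith
      qed
      moreover have "(\<lambda>N. dist (\<Gamma> x t) (J y0) / real (Suc N)) \<longlonglongrightarrow> 0"
        by (rule LIMSEQ_Suc[OF lim_const_over_n])
      ultimately have "min 1 (infdist (\<Gamma> x t) ?A) \<le> 0" by (intro LIMSEQ_le_const) auto
      then have "infdist (\<Gamma> x t) ?A = 0" using infdist_nonneg[of "\<Gamma> x t" ?A] by linarith
      then show ?case using in_closed_iff_infdist_zero[OF clA Ane] by blast
    qed
  qed
  \<comment> \<open>Countably many times turn "almost surely at each time" into "almost surely at
    all times", by continuity of the curve and closedness of the image.\<close>
  obtain T :: "real set" where T: "countable T" "T \<subseteq> {0..1}" "{0..1} \<subseteq> closure T" by (rule separable)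
  have "AE x in P. \<forall>t\<in>T. \<Gamma> x t \<in> ?A"
    unfolding AE_ball_countable[OF T(1)] using AE_A T(2) by blast
  then have "AE x in P. \<forall>t\<in>{0..1}. \<Gamma> x t \<in> ?A"
  proof eventually_elim
    case (elim x)
    show ?case
    proof
      fix t :: real assume t: "t \<in> {0..1}"
      then have "t \<in> closure T" using T(3) by (rule subsetD[rotated])
      then obtain u where u: "\<And>k. u k \<in> T" "u \<longlonglongrightarrow> t" unfolding closure_sequential by metis
      let ?l = "dist (\<Gamma> x 0) (\<Gamma> x 1)"
      have uT: "u k \<in> {0..1}" for k by (rule subsetD[OF T(2) u(1)])
      have g: "dist (\<Gamma> x (u k)) (\<Gamma> x t) = \<bar>u k - t\<bar> * ?l" for k
        using \<Gamma>(1)[of x] uT[of k] t unfolding unit_geodesic_def by blast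
      have "(\<lambda>k. \<bar>u k - t\<bar> * ?l) \<longlonglongrightarrow> \<bar>t - t\<bar> * ?l" by (intro tendsto_intros u)
      then have "(\<lambda>k. dist (\<Gamma> x (u k)) (\<Gamma> x t)) \<longlonglongrightarrow> 0" unfolding g by simp
      then have "(\<lambda>k. \<Gamma> x (u k)) \<longlonglongrightarrow> \<Gamma> x t" by (rule iffD2[OF tendsto_dist_iff])
      then show "\<Gamma> x t \<in> ?A" by (rule closed_sequentially[OF clA, rotated]) (use elim u(1) in blast)
    qed
  qed
  \<comment> \<open>A measurable null set containing the bad outcomes; on it the curve is replaced
    by the constant \<open>y0\<close>, so that \<open>G\<close> is a geodesic for every
    outcome.\<close>
  then obtain Z where Z: "{x \<in> space P. \<not> (\<forall>t\<in>{0..1}. \<Gamma> x t \<in> ?A)} \<subseteq> Z" "emeasure P Z = 0" "Z \<in> sets P"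
    by (rule AE_E)
  have AZ: "AE x in P. x \<notin> Z" using Z(2,3) by (intro AE_not_in) (simp add: null_sets_def)
  define G where "G x = restrict (\<lambda>t. if x \<in> Z then y0 else inv_into (mspace X) J (\<Gamma> x t)) {0..1}" for x
  have G: "G x t \<in> mspace X" "J (G x t) = \<Gamma> x t" if "x \<in> space P" "x \<notin> Z" "t \<in> {0..1}" for x t
  proof -
    have "\<Gamma> x t \<in> ?A" using Z(1) that by blast
    then show "G x t \<in> mspace X" "J (G x t) = \<Gamma> x t"
      using that inv_into_into[of "\<Gamma> x t" J "mspace X"] f_inv_into_f[of "\<Gamma> x t" J "mspace X"] by (simp_all add: G_def)
  qed
  have GZ: "G x t = y0" if "x \<in> Z" "t \<in> {0..1}" for x t using that by (simp add: G_def)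
  have GX: "G x t \<in> mspace X" if "x \<in> space P" "t \<in> {0..1}" for x t
    using G(1)[OF that(1) _ that(2)] GZ[OF _ that(2)] y0 by (cases "x \<in> Z") auto
  have Geo: "G x \<in> mspace (Geo X)" if x: "x \<in> space P" for x
    unfolding mspace_Geo
  proof (intro conjI ballI)
    show "G x \<in> extensional {0..1}" unfolding G_def by simp
    show "G x \<in> {0..1} \<rightarrow> mspace X" using GX[OF x] by blast
    fix s t :: real assume st: "s \<in> {0..1}" "t \<in> {0..1}"
    have 01: "(0::real) \<in> {0..1}" "(1::real) \<in> {0..1}" by simp_all
    show "mdist X (G x s) (G x t) = \<bar>s - t\<bar> * mdist X (G x 0) (G x 1)"
    proof (cases "x \<in> Z")
      case True
      then show ?thesis using st y0 by (simp add: GZ)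
    next
      case False
      have d: "mdist X (G x a) (G x b) = dist (\<Gamma> x a) (\<Gamma> x b)" if "a \<in> {0..1}" "b \<in> {0..1}" for a b
        using isometric_onD[OF J G(1)[OF x False that(1)] G(1)[OF x False that(2)]]
        unfolding G(2)[OF x False that(1)] G(2)[OF x False that(2)] by (rule sym)
      show ?thesis unfolding d[OF st] d[OF 01] using \<Gamma>(1)[of x] st unfolding unit_geodesic_def by blast
    qed
  qed
  have Gt: "(\<lambda>x. G x t) \<in> P \<rightarrow>\<^sub>M mborel X" if t: "t \<in> {0..1}" for t
  proof (rule measurable_into_mborel[OF mm_separable[OF mm]])
    show "(\<lambda>x. G x t) \<in> space P \<rightarrow> mspace X" using GX t by blast
    fix y assume y: "y \<in> mspace X"
    note [measurable] = \<Gamma>m[OF t] Z(3)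
    have "(\<lambda>x. if x \<in> Z then mdist X y0 y else dist (\<Gamma> x t) (J y)) \<in> borel_measurable P" by measurable
    then show "(\<lambda>x. mdist X (G x t) y) \<in> borel_measurable P"
    proof (rule measurable_cong[THEN iffD1, rotated])
      fix x assume x: "x \<in> space P"
      show "(if x \<in> Z then mdist X y0 y else dist (\<Gamma> x t) (J y)) = mdist X (G x t) y"
        using GZ[OF _ t, of x] G[OF x _ t] isometric_onD[OF J GX[OF x t] y] by auto
    qed
  qed
  have G_meas: "G \<in> P \<rightarrow>\<^sub>M mborel (Geo X)"
    by (rule measurable_into_Geo[OF mm_separable[OF mm] _ Gt]) (use Geo in blast)
  define \<pi> where "\<pi> = distr P (mborel (Geo X)) G"
  have \<pi>_prob: "\<pi> \<in> borel_prob (Geo X)"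
    unfolding borel_prob_def \<pi>_def using P.prob_space_distr[OF G_meas] by simp
  have ev: "(\<lambda>\<gamma>. \<gamma> t) \<in> \<pi> \<rightarrow>\<^sub>M mborel X" if "t \<in> {0..1}" for t
    unfolding \<pi>_def measurable_distr_eq1 by (rule Geo_eval_measurable[OF that])
  have ev01: "(\<lambda>\<gamma>. \<gamma> 0) \<in> \<pi> \<rightarrow>\<^sub>M mborel X" "(\<lambda>\<gamma>. \<gamma> 1) \<in> \<pi> \<rightarrow>\<^sub>M mborel X" by (rule ev, simp)+
  define \<nu> where "\<nu> t = distr P (mborel X) (\<lambda>x. G x t)" for t
  have \<nu>: "distr \<pi> (mborel X) (\<lambda>\<gamma>. \<gamma> t) = \<nu> t" if "t \<in> {0..1}" for t
    unfolding \<pi>_def \<nu>_def using distr_distr[OF Geo_eval_measurable[OF that] G_meas] by (simp add: comp_def)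
  have \<nu>_sets: "sets (\<nu> t) = sets (mborel X)" for t by (simp add: \<nu>_def)
  have \<nu>_prob: "prob_space (\<nu> t)" if "t \<in> {0..1}" for t
    unfolding \<nu>_def by (rule P.prob_space_distr[OF Gt[OF that]])
  have \<nu>_int: "(\<integral>y. \<phi> (J y) \<partial>\<nu> t) = (\<integral>x. \<phi> (\<Gamma> x t) \<partial>P)" if \<phi>: "test_function \<phi>" and t: "t \<in> {0..1}" for \<phi> t
  proof -
    have m: "(\<lambda>y. \<phi> (J y)) \<in> borel_measurable (mborel X)"
      by (rule measurable_compose[OF isometric_on_measurable[OF J] test_functionD(6)[OF \<phi>]])
    have "(\<integral>y. \<phi> (J y) \<partial>\<nu> t) = (\<integral>x. \<phi> (J (G x t)) \<partial>P)"
      unfolding \<nu>_def by (rule integral_distr[OF Gt[OF t] m])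
    also have "\<dots> = (\<integral>x. \<phi> (\<Gamma> x t) \<partial>P)"
    proof (rule integral_cong_AE)
      show "AE x in P. \<phi> (J (G x t)) = \<phi> (\<Gamma> x t)"
        using AZ AE_space
      proof eventually_elim
        case (elim x)
        show ?case unfolding G(2)[OF elim(2,1) t] ..
      qed
    qed (rule measurable_compose[OF Gt[OF t] m], rule \<phi>\<Gamma>[OF \<phi> t])
    finally show ?thesis .
  qed
  have \<nu>_fin: "finite_measure (\<nu> t)" if "t \<in> {0..1}" for t
    using \<nu>_prob[OF that] by (rule prob_space.finite_measure)
  \<comment> \<open>Equal integrals of test functions give domination with constant 1, and between
    probability measures domination is equality.\<close>
  have eq0: "\<nu> 0 = \<mu>\<^sub>0" and eq1: "\<nu> 1 = \<mu>\<^sub>1"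
  proof -
    have 01: "(0::real) \<in> {0..1}" "(1::real) \<in> {0..1}" by simp_all
    have "emeasure (\<nu> 0) A \<le> ennreal 1 * emeasure \<mu>\<^sub>0 A" if "A \<in> sets (\<nu> 0)" for A
      by (rule emeasure_le_of_test_functions[OF mm_\<mu>(1) J \<nu>_fin[OF 01(1)] \<nu>_sets _ _ that])
         (simp_all add: \<nu>_int[OF _ 01(1)] marg0)
    then show "\<nu> 0 = \<mu>\<^sub>0"
      by (intro prob_measure_le_imp_eq \<nu>_prob[OF 01(1)] P0.prob_space_axioms) (simp_all add: \<nu>_sets mm_sets[OF mm])
    have "emeasure (\<nu> 1) A \<le> ennreal 1 * emeasure \<mu>\<^sub>1 A" if "A \<in> sets (\<nu> 1)" for A
      by (rule emeasure_le_of_test_functions[OF mm_\<mu>(2) J \<nu>_fin[OF 01(2)] \<nu>_sets _ _ that])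
         (simp_all add: \<nu>_int[OF _ 01(2)] marg1)
    then show "\<nu> 1 = \<mu>\<^sub>1"
      by (intro prob_measure_le_imp_eq \<nu>_prob[OF 01(2)] P1.prob_space_axioms) (simp_all add: \<nu>_sets mm_sets[OF mm])
  qed
  let ?BB = "mborel X \<Otimes>\<^sub>M mborel X"
  have ev2: "(\<lambda>\<gamma>. (\<gamma> 0, \<gamma> 1)) \<in> \<pi> \<rightarrow>\<^sub>M ?BB" by (rule measurable_Pair[OF ev01])
  let ?\<alpha> = "distr \<pi> ?BB (\<lambda>\<gamma>. (\<gamma> 0, \<gamma> 1))"
  have "distr ?\<alpha> (mborel X) fst = \<mu>\<^sub>0" "distr ?\<alpha> (mborel X) snd = \<mu>\<^sub>1"
    using distr_distr[OF measurable_fst ev2] distr_distr[OF measurable_snd ev2] \<nu>[of 0] \<nu>[of 1] eq0 eq1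
    by (simp_all add: comp_def)
  then have cpl: "?\<alpha> \<in> couplings X \<mu>\<^sub>0 \<mu>\<^sub>1" by (simp add: couplings_def)
  have hm: "(\<lambda>z. ennreal ((case z of (x, y) \<Rightarrow> mdist X x y) powr q)) \<in> borel_measurable ?BB"
    by (rule measurable_compose[OF borel_measurable_mdist[OF mm_separable[OF mm]]]) measurable
  have G2: "(\<lambda>x. (G x 0, G x 1)) \<in> P \<rightarrow>\<^sub>M ?BB" by (intro measurable_Pair Gt) simp_all
  have \<alpha>_eq: "?\<alpha> = distr P ?BB (\<lambda>x. (G x 0, G x 1))"
  proof -
    have "(\<lambda>\<gamma>. (\<gamma> 0, \<gamma> 1)) \<in> mborel (Geo X) \<rightarrow>\<^sub>M ?BB" by (intro measurable_Pair Geo_eval_measurable) simp_all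
    from distr_distr[OF this G_meas] show ?thesis unfolding \<pi>_def by (simp add: comp_def)
  qed
  have opt: "optimal_coupling q X \<mu>\<^sub>0 \<mu>\<^sub>1 ?\<alpha>"
    unfolding optimal_coupling_def
  proof (intro conjI ballI cpl)
    fix \<beta> assume \<beta>: "\<beta> \<in> couplings X \<mu>\<^sub>0 \<mu>\<^sub>1"
    have 01: "(0::real) \<in> {0..1}" "(1::real) \<in> {0..1}" by simp_all
    have [measurable]: "(\<lambda>x. dist (\<Gamma> x 0) (\<Gamma> x 1)) \<in> borel_measurable P"
      by (rule borel_measurable_unif_cont2[OF unif_cont2_dist, where p = p, OF \<Gamma>c[OF 01(1)] \<Gamma>c[OF 01(2)] \<Gamma>m[OF 01(1)] \<Gamma>m[OF 01(2)]])
    have "transport_cost q X ?\<alpha> = (\<integral>\<^sup>+z. ennreal ((case z of (x, y) \<Rightarrow> mdist X x y) powr q) \<partial>?\<alpha>)"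
      unfolding transport_cost_def by (simp add: case_prod_beta')
    also have "\<dots> = (\<integral>\<^sup>+x. ennreal ((case (G x 0, G x 1) of (x, y) \<Rightarrow> mdist X x y) powr q) \<partial>P)"
      unfolding \<alpha>_eq by (rule nn_integral_distr[OF G2]) (simp add: hm)
    also have "\<dots> = (\<integral>\<^sup>+x. ennreal (dist (\<Gamma> x 0) (\<Gamma> x 1) powr q) \<partial>P)"
    proof (rule nn_integral_cong_AE)
      show "AE x in P. ennreal ((case (G x 0, G x 1) of (x, y) \<Rightarrow> mdist X x y) powr q) = ennreal (dist (\<Gamma> x 0) (\<Gamma> x 1) powr q)"
        using AZ AE_space
      proof eventually_elim
        case (elim x)
        have "mdist X (G x 0) (G x 1) = dist (\<Gamma> x 0) (\<Gamma> x 1)"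
          using isometric_onD[OF J GX[OF elim(2) 01(1)] GX[OF elim(2) 01(2)]]
          unfolding G(2)[OF elim(2,1) 01(1)] G(2)[OF elim(2,1) 01(2)] by (rule sym)
        then show ?case by simp
      qed
    qed
    also have "\<dots> = ennreal (\<integral>x. dist (\<Gamma> x 0) (\<Gamma> x 1) powr q \<partial>P)"
    proof (rule nn_integral_eq_integral)
      show "integrable P (\<lambda>x. dist (\<Gamma> x 0) (\<Gamma> x 1) powr q)"
      proof (rule P.integrable_const_bound[where B = "D powr q"])
        show "AE x in P. norm (dist (\<Gamma> x 0) (\<Gamma> x 1) powr q) \<le> D powr q"
          using \<Gamma>(2) q by (intro AE_I2) (simp add: powr_mono2)
      qed measurable
    qed simp
    also have "\<dots> \<le> ennreal (real_cost \<beta>)" by (rule ennreal_leI[OF cost[OF \<beta>]])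
    also have "\<dots> = transport_cost q X \<beta>" by (rule transport_cost_\<beta>[OF \<beta>, symmetric])
    finally show "transport_cost q X ?\<alpha> \<le> transport_cost q X \<beta>" .
  qed
  have dens: "\<exists>\<rho>\<^sub>t\<in>borel_measurable m. distr \<pi> (mborel X) (\<lambda>\<gamma>. \<gamma> t) = density m \<rho>\<^sub>t \<and> esssup m \<rho>\<^sub>t \<le> ennreal (C * M)"
    if t: "t \<in> {0..1}" for t
  proof -
    have "emeasure (\<nu> t) A \<le> ennreal (C * M) * emeasure m A" if "A \<in> sets m" for A
      by (rule emeasure_le_of_test_functions[OF mm J \<nu>_fin[OF t] \<nu>_sets CM])
         (use dom[OF _ t] that in \<open>simp_all add: \<nu>_int[OF _ t] \<nu>_sets mm_sets[OF mm]\<close>)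
    from bounded_density_exists[OF mm_sigma_finite[OF mm] \<nu>_fin[OF t] _ CM this]
    obtain \<rho> where "\<rho> \<in> borel_measurable m" "\<nu> t = density m \<rho>" "AE x in m. \<rho> x \<le> ennreal (C * M)"
      using mm_sets[OF mm] \<nu>_sets by metis
    then show ?thesis using \<nu>[OF t] by (intro bexI[of _ \<rho>]) (auto intro!: esssup_I)
  qed
  show ?thesis
    by (rule bexI[of _ \<pi>]) (use dens \<pi>_prob opt in \<open>auto simp: OptGeo_def\<close>)
qed

end

text \<open>With \<open>M\<close> the larger of the two essential suprema, the bound
  \<open>C q D * M\<close> of \<open>interpolating_plan\<close> is literally the one in BIP;
  \<open>1 \<le> C q D\<close> is inherited through the limsup.\<close>

lemma has_BIP_limit:
  fixes J' :: "nat \<Rightarrow> 'a \<Rightarrow> 'w::complete_space" and J :: "'b \<Rightarrow> 'w" and p :: "nat \<Rightarrow> 'w"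
    and C' :: "nat \<Rightarrow> real \<Rightarrow> real \<Rightarrow> real" and C :: "real \<Rightarrow> real \<Rightarrow> real"
  assumes mm': "\<And>n. metric_measure_space (X' n) (m' n)" and J': "\<And>n. isometric_on (X' n) (J' n)"
    and dense': "\<And>n x. x \<in> mspace (X' n) \<Longrightarrow> J' n x \<in> closure (range p)"
    and mm: "metric_measure_space X m" and J: "isometric_on X J"
    and dense: "\<And>x. x \<in> mspace X \<Longrightarrow> J x \<in> closure (range p)"
    and conv: "\<And>\<phi> :: 'w \<Rightarrow> real. continuous_on UNIV \<phi> \<Longrightarrow> bounded (range \<phi>) \<Longrightarrow> bounded {w. \<phi> w \<noteq> 0} \<Longrightarrow>
      (\<lambda>n. \<integral>x. \<phi> (J' n x) \<partial>m' n) \<longlonglongrightarrow> (\<integral>x. \<phi> (J x) \<partial>m)"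
    and BIP: "\<And>n. has_BIP (X' n) (m' n) (C' n)"
    and C: "\<And>q D. q > 1 \<Longrightarrow> D > 0 \<Longrightarrow> limsup (\<lambda>n. ereal (C' n q D)) \<le> ereal (C q D)"
  shows "has_BIP X m C"
  unfolding has_BIP_def
proof (intro allI impI conjI ballI)
  fix q D :: real assume q: "q > 1" and D: "D > 0"
  have "C' n q D \<ge> 1" for n using BIP[of n] q D unfolding has_BIP_def by blast
  then have "ereal 1 \<le> limsup (\<lambda>n. ereal (C' n q D))" by (intro le_Limsup) auto
  also have "\<dots> \<le> ereal (C q D)" by (rule C[OF q D])
  finally show C1: "1 \<le> C q D" by simp
  fix \<rho>\<^sub>0 \<rho>\<^sub>1 :: "'b \<Rightarrow> ennreal"
  assume \<rho>: "\<rho>\<^sub>0 \<in> borel_measurable m" "\<rho>\<^sub>1 \<in> borel_measurable m"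
    and \<mu>: "density m \<rho>\<^sub>0 \<in> borel_prob X" "density m \<rho>\<^sub>1 \<in> borel_prob X"
    and fin: "esssup m \<rho>\<^sub>0 < \<infinity>" "esssup m \<rho>\<^sub>1 < \<infinity>"
    and diam: "mdiam X (msupport X (density m \<rho>\<^sub>0) \<union> msupport X (density m \<rho>\<^sub>1)) < ennreal D"
  define M where "M = enn2real (max (esssup m \<rho>\<^sub>0) (esssup m \<rho>\<^sub>1))"
  have M_eq: "ennreal M = max (esssup m \<rho>\<^sub>0) (esssup m \<rho>\<^sub>1)"
    unfolding M_def using fin by (intro ennreal_enn2real) (simp add: max_def)
  have M0: "M \<ge> 0" by (simp add: M_def)
  have "AE x in m. \<rho>\<^sub>0 x \<le> ennreal M"
    using esssup_AE[of \<rho>\<^sub>0 m] by eventually_elim (simp add: M_eq le_max_iff_disj)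
  moreover have "AE x in m. \<rho>\<^sub>1 x \<le> ennreal M"
    using esssup_AE[of \<rho>\<^sub>1 m] by eventually_elim (simp add: M_eq le_max_iff_disj)
  ultimately interpret plan_limit X m J p \<rho>\<^sub>0 \<rho>\<^sub>1 M D q X' m' J' C' "C q D"
    using mm J dense \<rho> \<mu> M0 D q diam mm' J' dense' conv BIP C[OF q D]
    by unfold_locales
  have "ennreal (C q D * M) = ennreal (C q D) * max (esssup m \<rho>\<^sub>0) (esssup m \<rho>\<^sub>1)"
    unfolding M_eq[symmetric] using C1 M0 by (intro ennreal_mult) simp_all
  then show "\<exists>\<pi>\<in>OptGeo q X (density m \<rho>\<^sub>0) (density m \<rho>\<^sub>1). \<forall>t\<in>{0..1}.
      \<exists>\<rho>\<^sub>t\<in>borel_measurable m. distr \<pi> (mborel X) (\<lambda>\<gamma>. \<gamma> t) = density m \<rho>\<^sub>t \<and>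
        esssup m \<rho>\<^sub>t \<le> ennreal (C q D) * max (esssup m \<rho>\<^sub>0) (esssup m \<rho>\<^sub>1)"
    using interpolating_plan by (simp only:)
qed

text \<open>The discrete copy of the point type serves as domain so that the bounded continuous functions
  are all bounded functions and form a complete metric space.\<close>
lemma Kuratowski_embedding:
  fixes Z :: "'z metric"
  obtains \<kappa> :: "'z \<Rightarrow> ('z discrete \<Rightarrow>\<^sub>C real)" where "isometric_on Z \<kappa>"
proof (cases "mspace Z = {}")
  case True
  then show ?thesis by (intro that[of "\<lambda>_. 0"]) (simp add: isometric_on_def)
next
  case False
  interpret Metric_space "mspace Z" "mdist Z" by simp
  obtain z0 where z0: "z0 \<in> mspace Z" using False by blast
  \<comment> \<open>Elements of the type outside the carrier are sent to \<open>z0\<close>, so that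
    every coordinate is a distance to a point of \<open>Z\<close>.\<close>
  define r where "r y = (if of_discrete y \<in> mspace Z then of_discrete y else z0)" for y
  have r: "r y \<in> mspace Z" for y using z0 by (simp add: r_def)
  \<comment> \<open>Subtracting the distance to \<open>z0\<close> makes the function bounded, by
    \<open>mdist Z z z0\<close>, and cancels in differences.\<close>
  define \<kappa> where "\<kappa> z = Bcontfun (\<lambda>y. mdist Z z (r y) - mdist Z z0 (r y))" for z
  have \<kappa>: "apply_bcontfun (\<kappa> z) y = mdist Z z (r y) - mdist Z z0 (r y)" if z: "z \<in> mspace Z" for z y
  proof -
    have "(\<lambda>y. mdist Z z (r y) - mdist Z z0 (r y)) \<in> bcontfun"
    proof (rule bcontfun_normI)
      show "continuous_on UNIV (\<lambda>y. mdist Z z (r y) - mdist Z z0 (r y))"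
        unfolding continuous_on_open_vimage[OF open_UNIV] by (auto intro: open_discrete)
      show "norm (mdist Z z (r y) - mdist Z z0 (r y)) \<le> mdist Z z z0" for y
        using triangle[OF z z0 r[of y]] triangle[OF z0 z r[of y]] by (simp add: commute abs_le_iff)
    qed
    then show ?thesis unfolding \<kappa>_def by (simp add: Bcontfun_inverse)
  qed
  have "dist (\<kappa> z) (\<kappa> z') = mdist Z z z'" if z: "z \<in> mspace Z" "z' \<in> mspace Z" for z z'
  proof (rule antisym)
    show "dist (\<kappa> z) (\<kappa> z') \<le> mdist Z z z'"
    proof (rule dist_bound)
      fix y
      show "dist (apply_bcontfun (\<kappa> z) y) (apply_bcontfun (\<kappa> z') y) \<le> mdist Z z z'"
        unfolding \<kappa>[OF z(1)] \<kappa>[OF z(2)] dist_real_def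
        using triangle[OF z r[of y]] triangle[OF z(2,1) r[of y]] by (simp add: commute abs_le_iff)
    qed
    \<comment> \<open>At the coordinate \<open>z'\<close> the two functions differ by exactly
      \<open>mdist Z z z'\<close>.\<close>
    have "mdist Z z z' = dist (apply_bcontfun (\<kappa> z) (discrete z')) (apply_bcontfun (\<kappa> z') (discrete z'))"
      unfolding \<kappa>[OF z(1)] \<kappa>[OF z(2)] dist_real_def using z by (simp add: r_def discrete_inverse)
    also have "\<dots> \<le> dist (\<kappa> z) (\<kappa> z')" by (rule dist_bounded)
    finally show "mdist Z z z' \<le> dist (\<kappa> z) (\<kappa> z')" .
  qed
  then show ?thesis by (intro that[of \<kappa>]) (simp add: isometric_on_def)
qed

section \<open>Transfer of the pmGH convergence to the ambient Banach space\<close>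

lemma isometric_embedding_measurable:
  assumes \<iota>: "isometric_embedding X Z \<iota>" and mm: "metric_measure_space X m"
  shows "\<iota> \<in> m \<rightarrow>\<^sub>M mborel Z"
proof -
  have "continuous_map (mtop X) (mtop Z) \<iota>"
    by (rule Lipschitz_continuous_imp_continuous_map)
       (use \<iota> in \<open>auto simp: Lipschitz_continuous_map_def isometric_embedding_def intro!: exI[of _ 1]\<close>)
  then have "\<iota> \<in> mborel X \<rightarrow>\<^sub>M mborel Z" by (rule continuous_map_measurable_mborel)
  then show ?thesis using measurable_cong_sets[OF mm_sets[OF mm] refl] by blast
qed

lemma C_bs_isometric_on:
  assumes \<kappa>: "isometric_on Z \<kappa>" and \<phi>: "continuous_on UNIV \<phi>" "bounded (range \<phi>)" "bounded {w. \<phi> w \<noteq> 0}"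
  shows "(\<lambda>z. \<phi> (\<kappa> z)) \<in> C_bs Z"
proof -
  interpret Metric_space "mspace Z" "mdist Z" by simp
  have "continuous_map (mtop Z) euclideanreal (\<phi> \<circ> \<kappa>)"
    by (rule continuous_map_compose[OF isometric_on_continuous_map[OF \<kappa>]
          iffD2[OF continuous_map_iff_continuous2 \<phi>(1)]])
  moreover have "bounded ((\<lambda>z. \<phi> (\<kappa> z)) ` mspace Z)"
    by (rule bounded_subset[OF \<phi>(2)]) auto
  moreover have "mbounded {z \<in> mspace Z. \<phi> (\<kappa> z) \<noteq> 0}"
  proof -
    obtain b where b: "\<And>u v. \<phi> u \<noteq> 0 \<Longrightarrow> \<phi> v \<noteq> 0 \<Longrightarrow> dist u v \<le> b"
      using \<phi>(3) unfolding bounded_two_points by blast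
    show ?thesis
    proof (cases "{z \<in> mspace Z. \<phi> (\<kappa> z) \<noteq> 0} = {}")
      case True
      show ?thesis unfolding True by (rule mbounded_empty)
    next
      case False
      then obtain a where a: "a \<in> mspace Z" "\<phi> (\<kappa> a) \<noteq> 0" by blast
      have "{z \<in> mspace Z. \<phi> (\<kappa> z) \<noteq> 0} \<subseteq> mcball a b"
        using b[OF a(2)] a(1) by (auto simp: isometric_onD[OF \<kappa> a(1), symmetric])
      then show ?thesis unfolding mbounded_def by blast
    qed
  qed
  ultimately show ?thesis by (simp add: C_bs_def comp_def)
qed

theorem theorem3p12:
  fixes X :: "nat \<Rightarrow> 'a metric" and m :: "nat \<Rightarrow> 'a measure" and x :: "nat \<Rightarrow> 'a"
    and Xlim :: "'b metric" and mlim :: "'b measure" and xlim :: 'b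
    and C\<^sub>n :: "nat \<Rightarrow> real \<Rightarrow> real \<Rightarrow> real" and C :: "real \<Rightarrow> real \<Rightarrow> real"
  assumes "\<And>n. pointed_metric_measure_space (X n) (m n) (x n)"
    and "pointed_metric_measure_space Xlim mlim xlim"
    and "pmGH_converges TYPE('z) X m x Xlim mlim xlim"
    and "\<And>n. has_BIP (X n) (m n) (C\<^sub>n n)"
    and "\<And>q. q > 1 \<Longrightarrow> mono_on {0<..} (C q)"
    and "\<And>q D. q > 1 \<Longrightarrow> D > 0 \<Longrightarrow> limsup (\<lambda>n. ereal (C\<^sub>n n q D)) \<le> ereal (C q D)"
  shows "has_BIP Xlim mlim C"
proof -
  have mm: "metric_measure_space (X n) (m n)" for n
    using assms(1) by (simp add: pointed_metric_measure_space_def)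
  have mmlim: "metric_measure_space Xlim mlim" and xlim: "xlim \<in> mspace Xlim"
    using assms(2) by (simp_all add: pointed_metric_measure_space_def)
  obtain Z :: "'z metric" and \<iota> \<iota>lim where Z: "complete_separable Z"
    and \<iota>: "\<And>n. isometric_embedding (X n) Z (\<iota> n)" "isometric_embedding Xlim Z \<iota>lim"
    and conv: "\<And>\<phi>. \<phi> \<in> C_bs Z \<Longrightarrow> (\<lambda>n. \<integral>z. \<phi> z \<partial>distr (m n) (mborel Z) (\<iota> n))
        \<longlonglongrightarrow> (\<integral>z. \<phi> z \<partial>distr mlim (mborel Z) \<iota>lim)"
    using assms(3) unfolding pmGH_converges_def by blast
  have \<iota>Z: "\<iota> n y \<in> mspace Z" if "y \<in> mspace (X n)" for n y
    using \<iota>(1)[of n] that by (auto simp: isometric_embedding_def)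
  have \<iota>limZ: "\<iota>lim y \<in> mspace Z" if "y \<in> mspace Xlim" for y
    using \<iota>(2) that by (auto simp: isometric_embedding_def)
  \<comment> \<open>The common space \<open>Z\<close> of the convergence is moved into a complete
    type; composing with \<open>\<kappa>\<close> embeds all the spaces there.\<close>
  obtain \<kappa> :: "'z \<Rightarrow> ('z discrete \<Rightarrow>\<^sub>C real)" where \<kappa>: "isometric_on Z \<kappa>" by (rule Kuratowski_embedding)
  have "separable_space (mtop Z)" using Z by (simp add: complete_separable_def)
  then obtain d :: "nat \<Rightarrow> 'z" where d: "\<And>i. d i \<in> mspace Z"
    "\<And>z e. z \<in> mspace Z \<Longrightarrow> e > 0 \<Longrightarrow> \<exists>i. mdist Z z (d i) < e"
    by (rule separable_dense_sequence) (use \<iota>limZ[OF xlim] in auto)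
  \<comment> \<open>One dense sequence of \<open>Z\<close> supplies the coding points and cell
    centres for all the spaces at once.\<close>
  have dense: "\<kappa> z \<in> closure (range (\<lambda>i. \<kappa> (d i)))" if z: "z \<in> mspace Z" for z
    unfolding closure_approachable
  proof (intro allI impI)
    fix e :: real assume "e > 0"
    from d(2)[OF z this] obtain i where "mdist Z z (d i) < e" ..
    then have "dist (\<kappa> (d i)) (\<kappa> z) < e" unfolding dist_commute[of _ "\<kappa> z"] isometric_onD[OF \<kappa> z d(1)] .
    then show "\<exists>y\<in>range (\<lambda>i. \<kappa> (d i)). dist y (\<kappa> z) < e" by blast
  qed
  show ?thesis
  proof (rule has_BIP_limit[where X' = X and m' = m and C' = C\<^sub>n and J' = "\<lambda>n y. \<kappa> (\<iota> n y)"
        and J = "\<lambda>y. \<kappa> (\<iota>lim y)" and p = "\<lambda>i. \<kappa> (d i)"])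
    show "isometric_on (X n) (\<lambda>y. \<kappa> (\<iota> n y))" for n
      using \<iota>(1)[of n] isometric_onD[OF \<kappa> \<iota>Z \<iota>Z] by (simp add: isometric_on_def isometric_embedding_def)
    show "isometric_on Xlim (\<lambda>y. \<kappa> (\<iota>lim y))"
      using \<iota>(2) isometric_onD[OF \<kappa> \<iota>limZ \<iota>limZ] by (simp add: isometric_on_def isometric_embedding_def)
    show "\<kappa> (\<iota> n y) \<in> closure (range (\<lambda>i. \<kappa> (d i)))" if "y \<in> mspace (X n)" for n y
      by (rule dense[OF \<iota>Z[OF that]])
    show "\<kappa> (\<iota>lim y) \<in> closure (range (\<lambda>i. \<kappa> (d i)))" if "y \<in> mspace Xlim" for y
      by (rule dense[OF \<iota>limZ[OF that]])
    fix \<phi> :: "('z discrete \<Rightarrow>\<^sub>C real) \<Rightarrow> real"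
    assume \<phi>: "continuous_on UNIV \<phi>" "bounded (range \<phi>)" "bounded {w. \<phi> w \<noteq> 0}"
    have C: "(\<lambda>z. \<phi> (\<kappa> z)) \<in> C_bs Z" by (rule C_bs_isometric_on[OF \<kappa> \<phi>])
    have \<phi>m: "(\<lambda>z. \<phi> (\<kappa> z)) \<in> borel_measurable (mborel Z)"
      by (rule measurable_compose[OF isometric_on_measurable[OF \<kappa>] borel_measurable_continuous_onI[OF \<phi>(1)]])
    show "(\<lambda>n. \<integral>y. \<phi> (\<kappa> (\<iota> n y)) \<partial>m n) \<longlonglongrightarrow> (\<integral>y. \<phi> (\<kappa> (\<iota>lim y)) \<partial>mlim)"
      using conv[OF C]
      unfolding integral_distr[OF isometric_embedding_measurable[OF \<iota>(1) mm] \<phi>m]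
        integral_distr[OF isometric_embedding_measurable[OF \<iota>(2) mmlim] \<phi>m] .
  qed (fact mm mmlim assms(4) assms(6))+
qed

end
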